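(* Let $\lambda_0\in\sigma(F)$. Assume that $h$ is small enough. Then there exists $\lambda_h\in\sigma(F_h)$ such that $\lambda_h\to\lambda_0$ as $h\to 0$. For any sequence $\lambda_h\in\sigma(F_h)$ with $\lambda_h\to\lambda_0$ as $h\to0$, the following estimate holds: $$|\lambda_h-\lambda_0|\le C h^{\frac{2\beta}{r_0}},$$ where $r_0$ is the maximum rank of the eigenvectors of $F$ corresponding to $\lambda_0$, and $C>0$ is a constant independent of $h$.
   Context: Function spaces consist of complex-valued functions. $D\subset\mathbb{R}^2$ is a bounded Lipschitz domain, $\|\cdot\|$ is the norm of $L^2(D)$ (and the induced operator norm), and $C>0$ denotes a generic constant. Put $a(u,v)=\int_D\nabla u\cdot\nabla v\,dx$ and $(f,v)=\int_D fv\,dx$. Continuous problem: for $f\in L^2(D)$ let $u\in H^1_0(D)$ be the unique solution of $a(u,v)=(f,v)$ for all $v\in H^1_0(D)$. The solution operator $T:L^2(D)\to H^1_0(D)\subset L^2(D)$, $Tf=u$, is linear and compact. Discrete problem: $\mathcal{T}_h$ is a regular triangular mesh of $D$ with mesh size $h$, and one considers $h\to0$. $V_h\subset H^1_0(D)$ is the linear Lagrange finite element space (continuous, piecewise affine functions vanishing on $\partial D$) associated with $\mathcal{T}_h$, equipped with the $L^2(D)$ norm. $p_h:L^2(D)\to V_h$ is the $L^2$-projection. It satisfies $\|p_hf-f\|\to0$ as $h\to0$ for each $f\in L^2(D)$. For $f\in L^2(D)$ let $u_h\in V_h$ be the unique solution of $a(u_h,v_h)=(f,v_h)=(p_hf,v_h)$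 for all $v_h\in V_h$. $T_h:V_h\to V_h$ is the solution operator $T_hf_h=u_h$, where $f_h=p_hf$. Error estimate defining $\beta$: $\beta>1/2$ ($\beta=1$ if $D$ is convex) is a number such that $\|u-u_h\|\le Ch^{2\beta}\|f\|$ for $f\in L^2(D)$, where $u,u_h$ are the solutions of the continuous and the discrete problem. Operator functions: $\Omega\subset\mathbb{C}\setminus\{0\}$ is compact. For $\lambda\in\Omega$ define $F(\lambda)=T-\frac1\lambda I$ on $L^2(D)$ and $F_h(\lambda)=T_h-\frac1\lambda I$ on $V_h$, where $I$ is the identity. The resolvent set $\rho(F)$ is the set of $\lambda\in\Omega$ for which $F(\lambda)$ has a bounded inverse, and the spectrum is $\sigma(F)=\Omega\setminus\rho(F)$. The sets $\rho(F_h)$ and $\sigma(F_h)=\Omega\setminus\rho(F_h)$ are defined likewise. It is assumed that $\rho(F)\ne\emptyset$. Every $\lambda\in\sigma(F)$ is then an eigenvalue, i.e. $F(\lambda)u=0$ for some $u\neq0$. Rank: an eigenvector of $F$ at $\lambda_0$ is some $u_0\ne0$ with $F(\lambda_0)u_0=0$. A Jordan chain of length $k$ starting at $u_0$ is a tuple $u_0,\dots,u_{k-1}\in L^2(D)$ with $\sum_{j=0}^{m}\frac1{j!}F^{(j)}(\lambda_0)u_{m-j}=0$ for $m=0,\dots,k-1$, where $F^{(j)}$ is the $j$-th derivative in $\lambda$. The rank of $u_0$ is the maximal length of such a chain.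
   Formalization: The existence of λ_h ∈ σ(F_h) with λ_h → λ_0 is claimed only when λ_0 is an interior point of Ω; for λ_0 on the boundary of Ω it can fail, since the discrete eigenvalues may lie outside Ω. The error estimate is unrestricted. *)

theory Defs
  imports "HOL-Analysis.Analysis"
begin

section \<open>Lipschitz domains in the plane\<close>

text \<open>Near each boundary point, in suitable orthonormal coordinates, the domain is the part below
  the graph of a Lipschitz function.\<close>

definition lipschitz_domain :: "(real^2) set \<Rightarrow> bool" where
  "lipschitz_domain D \<longleftrightarrow>
     open D \<and> connected D \<and> bounded D \<and> D \<noteq> {} \<and>
     (\<forall>x\<in>frontier D. \<exists>U e1 e2 L \<phi>.
        open U \<and> x \<in> U \<and> norm e1 = 1 \<and> norm e2 = 1 \<and> e1 \<bullet> e2 = 0 \<and>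
        L-lipschitz_on (UNIV :: real set) \<phi> \<and>
        D \<inter> U = {y\<in>U. y \<bullet> e2 < \<phi> (y \<bullet> e1)})"


section \<open>The space of square integrable functions\<close>

text \<open>Elements of the space are represented by functions on the whole plane, of which only the
  values on \<open>D\<close> matter, and equality in the space is \<open>l2_eq\<close>. Operators act on representatives;
  every property of operators below is stated up to \<open>l2_eq\<close>.\<close>

definition L2 :: "(real^2) set \<Rightarrow> (real^2 \<Rightarrow> complex) set" where
  "L2 D = {f \<in> borel_measurable (lebesgue_on D). integrable (lebesgue_on D) (\<lambda>x. (cmod (f x))\<^sup>2)}"

definition l2_norm :: "(real^2) set \<Rightarrow> (real^2 \<Rightarrow> complex) \<Rightarrow> real" where
  "l2_norm D f = sqrt (LINT x|lebesgue_on D. (cmod (f x))\<^sup>2)"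

definition l2_eq :: "(real^2) set \<Rightarrow> (real^2 \<Rightarrow> complex) \<Rightarrow> (real^2 \<Rightarrow> complex) \<Rightarrow> bool" where
  "l2_eq D f g \<longleftrightarrow> (AE x in lebesgue_on D. f x = g x)"

text \<open>Bilinear, without complex conjugation.\<close>

definition l2_pairing :: "(real^2) set \<Rightarrow> (real^2 \<Rightarrow> complex) \<Rightarrow> (real^2 \<Rightarrow> complex) \<Rightarrow> complex" where
  "l2_pairing D f v = (LINT x|lebesgue_on D. f x * v x)"


section \<open>Sobolev spaces\<close>

definition partial :: "2 \<Rightarrow> (real^2 \<Rightarrow> complex) \<Rightarrow> real^2 \<Rightarrow> complex" where
  "partial i \<phi> x = frechet_derivative \<phi> (at x) (axis i 1)"

primrec C_k :: "nat \<Rightarrow> (real^2 \<Rightarrow> complex) \<Rightarrow> bool" where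
  "C_k 0 \<phi> \<longleftrightarrow> continuous_on UNIV \<phi>"
| "C_k (Suc k) \<phi> \<longleftrightarrow> (\<forall>x. \<phi> differentiable at x) \<and> (\<forall>i. C_k k (partial i \<phi>))"

definition test_functions :: "(real^2) set \<Rightarrow> (real^2 \<Rightarrow> complex) set" where
  "test_functions D =
     {\<phi>. (\<forall>k. C_k k \<phi>) \<and> compact (closure {x. \<phi> x \<noteq> 0}) \<and> closure {x. \<phi> x \<noteq> 0} \<subseteq> D}"

definition is_weak_grad :: "(real^2) set \<Rightarrow> (real^2 \<Rightarrow> complex) \<Rightarrow> (real^2 \<Rightarrow> complex^2) \<Rightarrow> bool" where
  "is_weak_grad D u g \<longleftrightarrow>
     (\<forall>i. (\<lambda>x. g x $ i) \<in> L2 D) \<and>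
     (\<forall>\<phi>\<in>test_functions D. \<forall>i.
        (LINT x|lebesgue_on D. u x * partial i \<phi> x) = - (LINT x|lebesgue_on D. g x $ i * \<phi> x))"

definition H1 :: "(real^2) set \<Rightarrow> (real^2 \<Rightarrow> complex) set" where
  "H1 D = {u \<in> L2 D. \<exists>g. is_weak_grad D u g}"

text \<open>For \<open>u\<close> in \<open>H1 D\<close> the weak gradient is unique up to null sets.\<close>

definition weak_grad :: "(real^2) set \<Rightarrow> (real^2 \<Rightarrow> complex) \<Rightarrow> real^2 \<Rightarrow> complex^2" where
  "weak_grad D u = (SOME g. is_weak_grad D u g)"

definition h1_norm :: "(real^2) set \<Rightarrow> (real^2 \<Rightarrow> complex) \<Rightarrow> real" where
  "h1_norm D u = sqrt ((l2_norm D u)\<^sup>2 + (\<Sum>i\<in>UNIV. (l2_norm D (\<lambda>x. weak_grad D u x $ i))\<^sup>2))"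

definition H10 :: "(real^2) set \<Rightarrow> (real^2 \<Rightarrow> complex) set" where
  "H10 D = {u \<in> H1 D. \<forall>\<epsilon>>0. \<exists>\<phi>\<in>test_functions D. h1_norm D (\<lambda>x. u x - \<phi> x) < \<epsilon>}"

definition dirichlet_form :: "(real^2) set \<Rightarrow> (real^2 \<Rightarrow> complex) \<Rightarrow> (real^2 \<Rightarrow> complex) \<Rightarrow> complex" where
  "dirichlet_form D u v =
     (LINT x|lebesgue_on D. (\<Sum>i\<in>UNIV. weak_grad D u x $ i * weak_grad D v x $ i))"


section \<open>Meshes and finite element spaces\<close>

definition triangular_mesh :: "(real^2) set \<Rightarrow> (real^2) set set \<Rightarrow> bool" where
  "triangular_mesh D \<T> \<longleftrightarrow> triangulation \<T> \<and> (\<forall>K\<in>\<T>. 2 simplex K) \<and> \<Union>\<T> = closure D"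

definition mesh_size :: "(real^2) set set \<Rightarrow> real" where
  "mesh_size \<T> = Max (diameter ` \<T>)"

text \<open>The meshes are indexed by their mesh sizes, which range over \<open>H\<close>. Regularity is the usual
  shape regularity: each triangle contains a disc whose radius is comparable to the diameter of
  the triangle, uniformly over all meshes.\<close>

definition regular_mesh_family ::
    "(real^2) set \<Rightarrow> real set \<Rightarrow> (real \<Rightarrow> (real^2) set set) \<Rightarrow> bool" where
  "regular_mesh_family D H mesh \<longleftrightarrow>
     (\<forall>h\<in>H. triangular_mesh D (mesh h) \<and> mesh_size (mesh h) = h) \<and>
     (\<exists>\<kappa>>0. \<forall>h\<in>H. \<forall>K\<in>mesh h. \<exists>x. cball x (\<kappa> * diameter K) \<subseteq> K)"

definition fem_space :: "(real^2) set \<Rightarrow> (real^2) set set \<Rightarrow> (real^2 \<Rightarrow> complex) set" where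
  "fem_space D \<T> =
     {v \<in> H10 D. continuous_on (closure D) v \<and> (\<forall>x\<in>frontier D. v x = 0) \<and>
        (\<forall>K\<in>\<T>. \<exists>l c. linear l \<and> (\<forall>x\<in>K. v x = l x + c))}"


section \<open>Solution operators\<close>

text \<open>The solution in the trial and test space \<open>V\<close> with data \<open>f\<close>. For \<open>V = H10 D\<close> this is the
  solution operator \<open>T\<close> of the continuous problem. For a finite element space \<open>V\<close> it maps any \<open>f\<close>
  in \<open>L2 D\<close> to the discrete solution, and its restriction to \<open>V\<close> is the discrete solution
  operator \<open>T\<^sub>h\<close>. The discrete solution for \<open>f\<close> is \<open>T\<^sub>h\<close> applied to the projection of \<open>f\<close> onto
  \<open>V\<close>, because \<open>f\<close> and its projection have the same pairing with every element of \<open>V\<close>.\<close>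

definition solution_op ::
    "(real^2) set \<Rightarrow> (real^2 \<Rightarrow> complex) set \<Rightarrow> (real^2 \<Rightarrow> complex) \<Rightarrow> real^2 \<Rightarrow> complex" where
  "solution_op D V f = (SOME u. u \<in> V \<and> (\<forall>v\<in>V. dirichlet_form D u v = l2_pairing D f v))"

definition error_estimate ::
    "(real^2) set \<Rightarrow> real set \<Rightarrow> (real \<Rightarrow> (real^2) set set) \<Rightarrow> real \<Rightarrow> bool" where
  "error_estimate D H mesh \<beta> \<longleftrightarrow>
     (\<exists>C>0. \<forall>h\<in>H. \<forall>f\<in>L2 D.
        l2_norm D (\<lambda>x. solution_op D (H10 D) f x - solution_op D (fem_space D (mesh h)) f x)
          \<le> C * h powr (2 * \<beta>) * l2_norm D f)"


section \<open>Operator functions\<close>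

text \<open>Below, \<open>X\<close> is a linear subspace of \<open>L2 D\<close> with the norm of that space, and operators on
  \<open>X\<close> are only considered on arguments in \<open>X\<close>.\<close>

type_synonym l2_op = "(real^2 \<Rightarrow> complex) \<Rightarrow> real^2 \<Rightarrow> complex"

definition bounded_op :: "(real^2) set \<Rightarrow> (real^2 \<Rightarrow> complex) set \<Rightarrow> l2_op \<Rightarrow> bool" where
  "bounded_op D X A \<longleftrightarrow>
     (\<forall>f\<in>X. A f \<in> X) \<and>
     (\<forall>f\<in>X. \<forall>g\<in>X. \<forall>c. l2_eq D (A (\<lambda>x. c * f x + g x)) (\<lambda>x. c * A f x + A g x)) \<and>
     (\<exists>C. \<forall>f\<in>X. l2_norm D (A f) \<le> C * l2_norm D f)"

definition has_bounded_inverse :: "(real^2) set \<Rightarrow> (real^2 \<Rightarrow> complex) set \<Rightarrow> l2_op \<Rightarrow> bool" where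
  "has_bounded_inverse D X A \<longleftrightarrow>
     (\<exists>B. bounded_op D X B \<and> (\<forall>f\<in>X. l2_eq D (A (B f)) f \<and> l2_eq D (B (A f)) f))"

definition op_resolvent_set ::
    "(real^2) set \<Rightarrow> (real^2 \<Rightarrow> complex) set \<Rightarrow> complex set \<Rightarrow> (complex \<Rightarrow> l2_op) \<Rightarrow> complex set" where
  "op_resolvent_set D X \<Omega> F = {z\<in>\<Omega>. has_bounded_inverse D X (F z)}"

definition op_spectrum ::
    "(real^2) set \<Rightarrow> (real^2 \<Rightarrow> complex) set \<Rightarrow> complex set \<Rightarrow> (complex \<Rightarrow> l2_op) \<Rightarrow> complex set" where
  "op_spectrum D X \<Omega> F = \<Omega> - op_resolvent_set D X \<Omega> F"

text \<open>Derivatives of operator functions are taken with respect to the operator norm.\<close>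

definition has_op_derivative ::
    "(real^2) set \<Rightarrow> (real^2 \<Rightarrow> complex) set \<Rightarrow> (complex \<Rightarrow> l2_op) \<Rightarrow> l2_op \<Rightarrow> complex \<Rightarrow> bool" where
  "has_op_derivative D X F A z \<longleftrightarrow>
     bounded_op D X A \<and>
     (\<forall>\<epsilon>>0. \<exists>\<delta>>0. \<forall>w. 0 < cmod w \<and> cmod w < \<delta> \<longrightarrow>
        (\<forall>u\<in>X. l2_norm D (\<lambda>x. (F (z + w) u x - F z u x) / w - A u x) \<le> \<epsilon> * l2_norm D u))"

primrec op_deriv ::
    "(real^2) set \<Rightarrow> (real^2 \<Rightarrow> complex) set \<Rightarrow> nat \<Rightarrow> (complex \<Rightarrow> l2_op) \<Rightarrow> complex \<Rightarrow> l2_op" where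
  "op_deriv D X 0 F = F"
| "op_deriv D X (Suc j) F = (\<lambda>z. SOME A. has_op_derivative D X (op_deriv D X j F) A z)"

definition eigenvectors ::
    "(real^2) set \<Rightarrow> (real^2 \<Rightarrow> complex) set \<Rightarrow> (complex \<Rightarrow> l2_op) \<Rightarrow> complex \<Rightarrow> (real^2 \<Rightarrow> complex) set" where
  "eigenvectors D X F z = {u\<in>X. \<not> l2_eq D u (\<lambda>_. 0) \<and> l2_eq D (F z u) (\<lambda>_. 0)}"

definition jordan_chain ::
    "(real^2) set \<Rightarrow> (real^2 \<Rightarrow> complex) set \<Rightarrow> (complex \<Rightarrow> l2_op) \<Rightarrow> complex \<Rightarrow>
     nat \<Rightarrow> (nat \<Rightarrow> real^2 \<Rightarrow> complex) \<Rightarrow> bool" where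
  "jordan_chain D X F z k u \<longleftrightarrow>
     k \<ge> 1 \<and> (\<forall>i<k. u i \<in> X) \<and>
     (\<forall>m<k. l2_eq D (\<lambda>x. \<Sum>j\<le>m. 1 / fact j * op_deriv D X j F z (u (m - j)) x) (\<lambda>_. 0))"

definition eigenvector_rank ::
    "(real^2) set \<Rightarrow> (real^2 \<Rightarrow> complex) set \<Rightarrow> (complex \<Rightarrow> l2_op) \<Rightarrow> complex \<Rightarrow>
     (real^2 \<Rightarrow> complex) \<Rightarrow> nat" where
  "eigenvector_rank D X F z u0 = Max {k. \<exists>u. u 0 = u0 \<and> jordan_chain D X F z k u}"

definition max_rank ::
    "(real^2) set \<Rightarrow> (real^2 \<Rightarrow> complex) set \<Rightarrow> (complex \<Rightarrow> l2_op) \<Rightarrow> complex \<Rightarrow> nat" where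
  "max_rank D X F z = Max (eigenvector_rank D X F z ` eigenvectors D X F z)"


section \<open>The eigenvalue problems\<close>

text \<open>These formulas are used for all nonzero \<open>z\<close>, in particular near a given point of the compact
  set in which the spectra are taken, so that derivatives make sense at each of its points.\<close>

definition F_cont :: "(real^2) set \<Rightarrow> complex \<Rightarrow> l2_op" where
  "F_cont D z u = (\<lambda>x. solution_op D (H10 D) u x - 1 / z * u x)"

definition F_disc :: "(real^2) set \<Rightarrow> (real^2) set set \<Rightarrow> complex \<Rightarrow> l2_op" where
  "F_disc D \<T> z u = (\<lambda>x. solution_op D (fem_space D \<T>) u x - 1 / z * u x)"

definition spectrum_cont :: "(real^2) set \<Rightarrow> complex set \<Rightarrow> complex set" where
  "spectrum_cont D \<Omega> = op_spectrum D (L2 D) \<Omega> (F_cont D)"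

definition spectrum_disc :: "(real^2) set \<Rightarrow> (real^2) set set \<Rightarrow> complex set \<Rightarrow> complex set" where
  "spectrum_disc D \<T> \<Omega> = op_spectrum D (fem_space D \<T>) \<Omega> (F_disc D \<T>)"

end

theory Submission
  imports Defs "HOL-Library.Function_Algebras" "HOL-Library.Diagonal_Subsequence"
begin

text \<open>
  The Dirichlet form is symmetric, and therefore so is the solution operator:
  \<open>\<langle>T f, g\<rangle> = \<langle>\<nabla>T f, \<nabla>T g\<rangle> = \<langle>f, T g\<rangle>\<close> in \<open>L\<^sup>2(D)\<close>. With \<open>\<mu> = 1 / \<lambda>\<^sub>0\<close>, a Jordan chain of length two at \<open>\<lambda>\<^sub>0\<close> is a
  solution of \<open>(T - \<mu>) w = - \<mu>\<^sup>2 v\<close> for an eigenvector \<open>v\<close>; taking the inner product with \<open>v\<close> gives \<open>v = 0\<close>. So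
  all ranks are one (\<open>max_rank_eq_1\<close>), and the rate to be proved is \<open>h\<^sup>2\<^sup>\<beta>\<close>.

  The operator \<open>T\<^sub>h\<close> that maps \<open>f\<close> in \<open>L\<^sup>2(D)\<close> to the discrete solution is symmetric for the same reason, has
  finite rank, and has the same nonzero eigenvalues on \<open>L\<^sup>2(D)\<close> as on the finite element space, because its
  eigenvectors lie in its range. The error estimate says that \<open>\<parallel>T - T\<^sub>h\<parallel> \<le> \<epsilon>\<close> with \<open>\<epsilon> = C h\<^sup>2\<^sup>\<beta>\<close>. Hence \<open>T\<close> is a
  limit in norm of operators of finite rank, which makes it compact, and the spectral theory of compact symmetric
  operators compares the eigenvalues. An eigenvector \<open>v\<close> of \<open>T\<close> at \<open>\<mu>\<close> satisfies
  \<open>\<parallel>(T\<^sub>h - \<mu>) v\<parallel> \<le> \<epsilon> \<parallel>v\<parallel>\<close>, so \<open>T\<^sub>h\<close> has an eigenvalue within \<open>\<epsilon>\<close> of \<open>\<mu>\<close>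
  (\<open>eigenvalue_near_approximate_eigenvalue\<close>). Conversely, for \<open>\<nu>\<close> near \<open>\<mu>\<close> every \<open>v\<close> satisfies
  \<open>\<bar>\<nu> - \<mu>\<bar> \<parallel>v\<parallel> / 2 \<le> \<parallel>(T - \<nu>) v\<parallel>\<close> (\<open>shift_lower_bound_near_eigenvalue\<close>), and the right-hand side is at most \<open>\<epsilon> \<parallel>v\<parallel>\<close>
  when \<open>v\<close> is an eigenvector of \<open>T\<^sub>h\<close> at \<open>\<nu>\<close>; so \<open>\<bar>\<nu> - \<mu>\<bar> \<le> 2 \<epsilon>\<close>.

  All this presupposes that the solution operators, which are defined by choice, do solve their equations. For \<open>T\<close>
  this is the representation theorem of Riesz for the inner product \<open>\<langle>\<nabla>u, \<nabla>v\<rangle>\<close> on \<open>H10 D\<close>. It rests on three facts: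
  \<open>L\<^sup>2(D)\<close> is complete (\<open>L2_complete\<close>), weak gradients are unique and hence linear
  (\<open>fundamental_lemma\<close>), and the \<open>L\<^sup>2\<close> norm is bounded by the norm of the gradient (\<open>Poincare\<close>). For a
  finite element space, completeness comes from finite dimension.
\<close>

section \<open>Positive semidefinite inner products\<close>

text \<open>Elements of \<open>L\<^sup>2\<close> are represented by functions, so vectors matter only up to null vectors: the form
  is merely semidefinite, and an equation between vectors \<open>x\<close> and \<open>y\<close> is written as \<open>nrm (x - y) = 0\<close>.
  The carrier \<open>V\<close> singles out the functions on which the form makes sense.\<close>

locale semi_inner = vector_space scale
  for scale :: "complex \<Rightarrow> 'a \<Rightarrow> 'a::ab_group_add" (infixr "*\<^sub>C" 75) +
  fixes V :: "'a set" and ip :: "'a \<Rightarrow> 'a \<Rightarrow> complex"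
  assumes V_subspace: "subspace V"
    and ip_add_left: "\<lbrakk>x \<in> V; y \<in> V; z \<in> V\<rbrakk> \<Longrightarrow> ip (x + y) z = ip x z + ip y z"
    and ip_scale_left: "\<lbrakk>x \<in> V; z \<in> V\<rbrakk> \<Longrightarrow> ip (c *\<^sub>C x) z = c * ip x z"
    and ip_commute: "\<lbrakk>x \<in> V; y \<in> V\<rbrakk> \<Longrightarrow> ip x y = cnj (ip y x)"
    and ip_ge0: "x \<in> V \<Longrightarrow> 0 \<le> Re (ip x x)"
begin

lemma V_closed [simp, intro]:
  "0 \<in> V" "\<lbrakk>x \<in> V; y \<in> V\<rbrakk> \<Longrightarrow> x + y \<in> V" "\<lbrakk>x \<in> V; y \<in> V\<rbrakk> \<Longrightarrow> x - y \<in> V" "x \<in> V \<Longrightarrow> c *\<^sub>C x \<in> V"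
  "x \<in> V \<Longrightarrow> - x \<in> V"
  using V_subspace by (auto intro: subspace_neg subspace_0 subspace_add subspace_diff subspace_scale)

lemma ip_diff_left: "\<lbrakk>x \<in> V; y \<in> V; z \<in> V\<rbrakk> \<Longrightarrow> ip (x - y) z = ip x z - ip y z"
  using ip_add_left[of "x - y" y z] by simp

lemma ip_add_right: "\<lbrakk>x \<in> V; y \<in> V; z \<in> V\<rbrakk> \<Longrightarrow> ip z (x + y) = ip z x + ip z y"
  using ip_commute[of z "x + y"] ip_commute[of z x] ip_commute[of z y] by (simp add: ip_add_left)

lemma ip_diff_right: "\<lbrakk>x \<in> V; y \<in> V; z \<in> V\<rbrakk> \<Longrightarrow> ip z (x - y) = ip z x - ip z y"
  using ip_commute[of z "x - y"] ip_commute[of z x] ip_commute[of z y] by (simp add: ip_diff_left)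

lemma ip_scale_right: "\<lbrakk>x \<in> V; z \<in> V\<rbrakk> \<Longrightarrow> ip z (c *\<^sub>C x) = cnj c * ip z x"
  using ip_commute[of z "c *\<^sub>C x"] ip_commute[of z x] by (simp add: ip_scale_left)

lemma ip_zero_left [simp]: "z \<in> V \<Longrightarrow> ip 0 z = 0"
  using ip_add_left[of 0 0 z] by simp

lemmas ip_linear = ip_add_left ip_add_right ip_diff_left ip_diff_right ip_scale_left ip_scale_right

definition nrm :: "'a \<Rightarrow> real" where
  "nrm x = sqrt (Re (ip x x))"

lemma nrm_ge0 [simp]: "x \<in> V \<Longrightarrow> 0 \<le> nrm x"
  by (simp add: nrm_def ip_ge0)

lemma nrm_zero [simp]: "nrm 0 = 0"
  by (simp add: nrm_def)

lemma nrm_sq: "x \<in> V \<Longrightarrow> (nrm x)\<^sup>2 = Re (ip x x)"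
  by (simp add: nrm_def ip_ge0)

lemma ip_self: "x \<in> V \<Longrightarrow> ip x x = of_real ((nrm x)\<^sup>2)"
  using ip_commute[of x x] by (simp add: nrm_sq complex_eq_iff)

lemma nrm_scale [simp]:
  assumes "x \<in> V"
  shows "nrm (c *\<^sub>C x) = cmod c * nrm x"
proof -
  have "ip (c *\<^sub>C x) (c *\<^sub>C x) = (c * cnj c) * ip x x"
    using assms by (simp add: ip_linear)
  also have "c * cnj c = of_real ((cmod c)\<^sup>2)" by (simp only: complex_norm_square)
  finally have "ip (c *\<^sub>C x) (c *\<^sub>C x) = of_real ((cmod c)\<^sup>2) * ip x x" .
  then show ?thesis by (simp add: nrm_def real_sqrt_mult)
qed

lemma nrm_add_sq: "\<lbrakk>x \<in> V; y \<in> V\<rbrakk> \<Longrightarrow> (nrm (x + y))\<^sup>2 = (nrm x)\<^sup>2 + 2 * Re (ip x y) + (nrm y)\<^sup>2"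
  using ip_commute[of x y] by (simp add: nrm_sq ip_linear)

lemma nrm_diff_sq: "\<lbrakk>x \<in> V; y \<in> V\<rbrakk> \<Longrightarrow> (nrm (x - y))\<^sup>2 = (nrm x)\<^sup>2 - 2 * Re (ip x y) + (nrm y)\<^sup>2"
  using ip_commute[of x y] by (simp add: nrm_sq ip_linear)

lemma nrm_minus_commute: "\<lbrakk>x \<in> V; y \<in> V\<rbrakk> \<Longrightarrow> nrm (x - y) = nrm (y - x)"
  using nrm_scale[of "y - x" "-1"] by simp

text \<open>The usual choice \<open>t = \<langle>x, y\<rangle> / \<parallel>y\<parallel>\<^sup>2\<close> in \<open>\<parallel>x - t y\<parallel>\<^sup>2 \<ge> 0\<close> is unavailable if \<open>y\<close> is null; then
  \<open>\<parallel>x - t y\<parallel>\<^sup>2\<close> is affine in \<open>t\<close>, and a large multiple \<open>t\<close> of \<open>\<langle>x, y\<rangle>\<close> would make it negative unless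
  \<open>\<langle>x, y\<rangle> = 0\<close>.\<close>

lemma Cauchy_Schwarz:
  assumes "x \<in> V" "y \<in> V"
  shows "cmod (ip x y) \<le> nrm x * nrm y"
proof -
  define b where "b = ip x y"
  have key: "0 \<le> (nrm x)\<^sup>2 - 2 * t * (cmod b)\<^sup>2 + t\<^sup>2 * (cmod b)\<^sup>2 * (nrm y)\<^sup>2" for t :: real
  proof -
    have "0 \<le> (nrm (x - (of_real t * b) *\<^sub>C y))\<^sup>2" by simp
    also have "\<dots> = (nrm x)\<^sup>2 - 2 * Re (cnj (of_real t * b) * b) + (cmod (of_real t * b) * nrm y)\<^sup>2"
      using assms by (simp add: nrm_diff_sq ip_linear b_def)
    also have "Re (cnj (of_real t * b) * b) = t * (cmod b)\<^sup>2"
      by (simp add: cmod_power2) (simp add: power2_eq_square algebra_simps)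
    finally show ?thesis by (simp add: norm_mult power_mult_distrib algebra_simps)
  qed
  have "(cmod b)\<^sup>2 \<le> (nrm x * nrm y)\<^sup>2"
  proof (cases "nrm y = 0")
    case True
    have "b = 0"
    proof (rule ccontr)
      assume "b \<noteq> 0"
      then show False
        using key[of "((nrm x)\<^sup>2 + 1) / (cmod b)\<^sup>2"] True zero_le_power2[of "nrm x"]
        by simp
    qed
    then show ?thesis by simp
  next
    case False
    then have pos: "(nrm y)\<^sup>2 > 0" by simp
    have "0 \<le> (nrm x)\<^sup>2 - (cmod b)\<^sup>2 / (nrm y)\<^sup>2"
      using key[of "1 / (nrm y)\<^sup>2"] False by (simp add: field_simps power2_eq_square)
    then show ?thesis using pos by (simp add: field_simps power_mult_distrib)
  qed
  then show ?thesis using assms by (simp add: b_def power2_le_iff_abs_le)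
qed

lemma nrm_triangle: assumes "x \<in> V" "y \<in> V" shows "nrm (x + y) \<le> nrm x + nrm y"
proof (rule power2_le_imp_le)
  have "Re (ip x y) \<le> nrm x * nrm y"
    using Cauchy_Schwarz[OF assms] complex_Re_le_cmod[of "ip x y"] by linarith
  then show "(nrm (x + y))\<^sup>2 \<le> (nrm x + nrm y)\<^sup>2"
    using assms by (simp add: nrm_add_sq power2_sum)
qed (use assms in simp)

lemma nrm_triangle_diff: assumes "x \<in> V" "y \<in> V" shows "nrm (x - y) \<le> nrm x + nrm y"
  using nrm_triangle[of x "0 - y"] nrm_minus_commute[of 0 y] assms by simp

lemma nrm_triangle_le: "\<lbrakk>x \<in> V; y \<in> V; z \<in> V\<rbrakk> \<Longrightarrow> nrm (x - z) \<le> nrm (x - y) + nrm (y - z)"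
  using nrm_triangle[of "x - y" "y - z"] by simp

lemma nrm_diff_ge: "\<lbrakk>x \<in> V; y \<in> V\<rbrakk> \<Longrightarrow> \<bar>nrm x - nrm y\<bar> \<le> nrm (x - y)"
  using nrm_triangle[of "x - y" y] nrm_triangle[of "y - x" x] nrm_minus_commute[of x y] by simp

lemma null_ip: "\<lbrakk>x \<in> V; y \<in> V; nrm x = 0\<rbrakk> \<Longrightarrow> ip x y = 0"
  using Cauchy_Schwarz[of x y] by simp

lemma null_ip_right: "\<lbrakk>x \<in> V; y \<in> V; nrm y = 0\<rbrakk> \<Longrightarrow> ip x y = 0"
  using Cauchy_Schwarz[of x y] by simp

lemma nrm_cong: "\<lbrakk>x \<in> V; y \<in> V; nrm (x - y) = 0\<rbrakk> \<Longrightarrow> nrm x = nrm y"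
  using nrm_diff_ge[of x y] by simp

text \<open>The standard way, below, to prove that two vectors agree up to a null vector.\<close>

lemma null_if_orthogonal: "\<lbrakk>x \<in> V; \<And>y. y \<in> V \<Longrightarrow> ip x y = 0\<rbrakk> \<Longrightarrow> nrm x = 0"
  by (simp add: nrm_def)

definition converges :: "(nat \<Rightarrow> 'a) \<Rightarrow> 'a \<Rightarrow> bool" where
  "converges s x \<longleftrightarrow> (\<lambda>n. nrm (s n - x)) \<longlonglongrightarrow> 0"

definition cauchy :: "(nat \<Rightarrow> 'a) \<Rightarrow> bool" where
  "cauchy s \<longleftrightarrow> (\<forall>e>0. \<exists>N. \<forall>m\<ge>N. \<forall>n\<ge>N. nrm (s m - s n) < e)"

lemma converges_squeeze:
  assumes "\<And>n. s n \<in> V" "x \<in> V" "\<And>n. nrm (s n - x) \<le> e n" "e \<longlonglongrightarrow> 0"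
  shows "converges s x"
  unfolding converges_def
  by (rule tendsto_sandwich[OF _ _ tendsto_const assms(4)]) (use assms in auto)

lemma converges_add:
  assumes "converges s x" "converges t y" "\<And>n. s n \<in> V" "\<And>n. t n \<in> V" "x \<in> V" "y \<in> V"
  shows "converges (\<lambda>n. s n + t n) (x + y)"
proof (rule converges_squeeze)
  show "nrm (s n + t n - (x + y)) \<le> nrm (s n - x) + nrm (t n - y)" for n
    using nrm_triangle[of "s n - x" "t n - y"] assms by (simp add: add_diff_add)
  show "(\<lambda>n. nrm (s n - x) + nrm (t n - y)) \<longlonglongrightarrow> 0"
    using assms(1,2) tendsto_add[of "\<lambda>n. nrm (s n - x)" 0 sequentially "\<lambda>n. nrm (t n - y)" 0]
    by (simp add: converges_def)
qed (use assms in auto)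

lemma converges_scale:
  assumes "converges s x" "\<And>n. s n \<in> V" "x \<in> V"
  shows "converges (\<lambda>n. c *\<^sub>C s n) (c *\<^sub>C x)"
  using assms tendsto_mult_left[of "\<lambda>n. nrm (s n - x)" 0 sequentially "cmod c"]
  by (simp add: converges_def flip: scale_right_diff_distrib)

lemma converges_null_diff:
  assumes "converges s x" "(\<lambda>n. nrm (t n - s n)) \<longlonglongrightarrow> 0" "\<And>n. s n \<in> V" "\<And>n. t n \<in> V" "x \<in> V"
  shows "converges t x"
proof (rule converges_squeeze)
  show "nrm (t n - x) \<le> nrm (t n - s n) + nrm (s n - x)" for n
    using nrm_triangle_le[of "t n" "s n" x] assms by simp
  show "(\<lambda>n. nrm (t n - s n) + nrm (s n - x)) \<longlonglongrightarrow> 0"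
    using assms(1,2) tendsto_add[of "\<lambda>n. nrm (t n - s n)" 0 sequentially "\<lambda>n. nrm (s n - x)" 0]
    by (simp add: converges_def)
qed (use assms in auto)

lemma converges_nrm:
  assumes "converges s x" "\<And>n. s n \<in> V" "x \<in> V"
  shows "(\<lambda>n. nrm (s n)) \<longlonglongrightarrow> nrm x"
proof (rule LIM_zero_cancel, rule Lim_null_comparison)
  show "\<forall>\<^sub>F n in sequentially. norm (nrm (s n) - nrm x) \<le> nrm (s n - x)"
    using nrm_diff_ge assms by simp
qed (use assms in \<open>simp add: converges_def\<close>)

lemma converges_ip:
  assumes "converges s x" "\<And>n. s n \<in> V" "x \<in> V" "y \<in> V"
  shows "(\<lambda>n. ip (s n) y) \<longlonglongrightarrow> ip x y"
proof (rule LIM_zero_cancel, rule Lim_null_comparison)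
  show "\<forall>\<^sub>F n in sequentially. norm (ip (s n) y - ip x y) \<le> nrm (s n - x) * nrm y"
    using Cauchy_Schwarz assms by (simp flip: ip_diff_left)
  show "(\<lambda>n. nrm (s n - x) * nrm y) \<longlonglongrightarrow> 0"
    using assms(1) tendsto_mult_right[of "\<lambda>n. nrm (s n - x)" 0 sequentially "nrm y"] by (simp add: converges_def)
qed

lemma converges_imp_cauchy:
  assumes "converges s x" "\<And>n. s n \<in> V" "x \<in> V"
  shows "cauchy s"
  unfolding cauchy_def
proof (intro allI impI)
  fix e :: real assume "e > 0"
  then obtain N where N: "\<And>n. n \<ge> N \<Longrightarrow> nrm (s n - x) < e / 2"
    using assms order_tendstoD(2)[of "\<lambda>n. nrm (s n - x)" 0 sequentially "e / 2"]
    by (auto simp: converges_def eventually_sequentially)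
  have "nrm (s m - s n) < e" if "m \<ge> N" "n \<ge> N" for m n
    using nrm_triangle_le[of "s m" x "s n"] N[OF that(1)] N[OF that(2)] nrm_minus_commute[of "s n" x] assms
    by simp
  then show "\<exists>N. \<forall>m\<ge>N. \<forall>n\<ge>N. nrm (s m - s n) < e" by blast
qed

lemma cauchy_bounded:
  assumes "cauchy s" "\<And>n. s n \<in> V"
  shows "\<exists>K. \<forall>n. nrm (s n) \<le> K"
proof -
  from assms obtain N where N: "\<And>n. n \<ge> N \<Longrightarrow> nrm (s n - s N) < 1"
    unfolding cauchy_def using zero_less_one by blast
  define K where "K = Max ((\<lambda>n. nrm (s n)) ` {..N})"
  have K: "nrm (s n) \<le> K" if "n \<le> N" for n using that by (simp add: K_def)
  have "nrm (s n) \<le> K + 1" for n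
  proof (cases "n \<le> N")
    case False
    then show ?thesis
      using N[of n] nrm_triangle[of "s n - s N" "s N"] K[of N] assms(2) by simp
  qed (use K[of n] in simp)
  then show ?thesis by blast
qed

lemma cauchy_subseq_converges:
  assumes "cauchy s" "\<And>n. s n \<in> V" "x \<in> V" "strict_mono r" "converges (\<lambda>n. s (r n)) x"
  shows "converges s x"
  unfolding converges_def
proof (rule LIMSEQ_I)
  fix e :: real assume e: "e > 0"
  then obtain N where N: "\<And>m n. m \<ge> N \<Longrightarrow> n \<ge> N \<Longrightarrow> nrm (s m - s n) < e / 2"
    using assms(1) unfolding cauchy_def by (meson half_gt_zero)
  obtain M where M: "\<And>n. n \<ge> M \<Longrightarrow> nrm (s (r n) - x) < e / 2"
    using assms(5) e order_tendstoD(2)[of "\<lambda>n. nrm (s (r n) - x)" 0 sequentially "e / 2"]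
    by (auto simp: converges_def eventually_sequentially)
  define k where "k = max M N"
  have "r k \<ge> N" using seq_suble[OF assms(4), of k] by (simp add: k_def)
  then have "nrm (s n - x) < e" if "n \<ge> N" for n
    using N[OF that \<open>r k \<ge> N\<close>] M[of k] nrm_triangle_le[of "s n" "s (r k)" x] assms by (simp add: k_def)
  then show "\<exists>no. \<forall>n\<ge>no. norm (nrm (s n - x) - 0) < e"
    using assms by auto
qed

lemma semi_inner_subset: "subspace W \<Longrightarrow> W \<subseteq> V \<Longrightarrow> semi_inner scale W ip"
  by unfold_locales (auto simp: subset_iff ip_linear ip_ge0 intro: ip_commute)

end


section \<open>The representation theorem of Riesz\<close>

locale semi_hilbert = semi_inner +
  assumes complete: "\<lbrakk>\<And>n. s n \<in> V; cauchy s\<rbrakk> \<Longrightarrow> \<exists>x\<in>V. converges s x"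
begin

text \<open>The representing vector minimises \<open>\<parallel>v\<parallel>\<^sup>2 - 2 Re (J v)\<close>: by the parallelogram identity every
  minimising sequence is a Cauchy sequence, and the first variation vanishes at its limit.\<close>

theorem Riesz_representation:
  assumes J_add: "\<And>x y. x \<in> V \<Longrightarrow> y \<in> V \<Longrightarrow> J (x + y) = J x + J y"
    and J_scale: "\<And>c x. x \<in> V \<Longrightarrow> J (c *\<^sub>C x) = c * J x"
    and J_bound: "\<And>x. x \<in> V \<Longrightarrow> cmod (J x) \<le> C * nrm x"
  shows "\<exists>u\<in>V. \<forall>v\<in>V. ip v u = J v"
proof -
  define Q where "Q x = (nrm x)\<^sup>2 - 2 * Re (J x)" for x
  have Qlow: "Q x \<ge> - C\<^sup>2" if "x \<in> V" for x
    using J_bound[OF that] complex_Re_le_cmod[of "J x"] zero_le_power2[of "nrm x - C"]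
    unfolding Q_def by (simp add: power2_eq_square algebra_simps)
  define m where "m = Inf (Q ` V)"
  have bdd: "bdd_below (Q ` V)" using Qlow by (auto intro!: bdd_belowI[of _ "- C\<^sup>2"])
  have m_le: "m \<le> Q x" if "x \<in> V" for x
    unfolding m_def using bdd that by (auto intro: cInf_lower)
  have "\<exists>x\<in>V. Q x < m + 1 / real (Suc n)" for n
    using cInf_lessD[of "Q ` V" "m + 1 / real (Suc n)"] by (force simp: m_def)
  then obtain s where s: "\<And>n. s n \<in> V" "\<And>n. Q (s n) < m + 1 / real (Suc n)" by metis
  have par: "(nrm (x - y))\<^sup>2 \<le> 2 * (Q x - m) + 2 * (Q y - m)" if "x \<in> V" "y \<in> V" for x y
  proof -
    have "4 * Q ((1/2) *\<^sub>C (x + y)) = (nrm (x + y))\<^sup>2 - 4 * Re (J x + J y)"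
      using that by (simp add: Q_def J_scale J_add power_mult_distrib power_divide)
        (simp add: field_simps)
    then have "(nrm (x - y))\<^sup>2 = 2 * Q x + 2 * Q y - 4 * Q ((1/2) *\<^sub>C (x + y))"
      using that by (simp add: Q_def nrm_add_sq nrm_diff_sq)
    with m_le[of "(1/2) *\<^sub>C (x + y)"] that show ?thesis by simp
  qed
  have "cauchy s"
    unfolding cauchy_def
  proof (intro allI impI)
    fix e :: real assume e: "e > 0"
    obtain N where N: "1 / real (Suc N) < e\<^sup>2 / 4"
      using reals_Archimedean[of "e\<^sup>2 / 4"] e by (auto simp: field_simps)
    have small: "Q (s n) - m < e\<^sup>2 / 4" if "n \<ge> N" for n
      using s(2)[of n] N that frac_le[of 1 1 "real (Suc N)" "real (Suc n)"] by simp
    have "nrm (s i - s j) < e" if "i \<ge> N" "j \<ge> N" for i j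
      using par[OF s(1)[of i] s(1)[of j]] small[OF that(1)] small[OF that(2)] e
      by (intro power2_less_imp_less[of _ e]) auto
    then show "\<exists>N. \<forall>m\<ge>N. \<forall>n\<ge>N. nrm (s m - s n) < e" by blast
  qed
  then obtain u where u: "u \<in> V" "converges s u" using complete s(1) by blast
  have "ip v u = J v" if v: "v \<in> V" for v
  proof -
    define d where "d = ip v u - J v"
    have var: "0 \<le> 2 * Re (t * d) + (cmod t)\<^sup>2 * (nrm v)\<^sup>2" for t
    proof -
      have "- (1 / real (Suc n)) \<le> 2 * Re (t * (cnj (ip (s n) v) - J v)) + (cmod t)\<^sup>2 * (nrm v)\<^sup>2" for n
      proof -
        have "Re (ip (s n) (t *\<^sub>C v)) = Re (t * cnj (ip (s n) v))"
          using s(1) v by (simp add: ip_linear)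
        then have "Q (s n + t *\<^sub>C v)
            = Q (s n) + 2 * Re (t * (cnj (ip (s n) v) - J v)) + (cmod t)\<^sup>2 * (nrm v)\<^sup>2"
          using s(1) v by (simp add: Q_def nrm_add_sq J_add J_scale power_mult_distrib algebra_simps)
        then show ?thesis using m_le[of "s n + t *\<^sub>C v"] s(1)[of n] s(2)[of n] v by simp
      qed
      moreover have "(\<lambda>n. 2 * Re (t * (cnj (ip (s n) v) - J v)) + (cmod t)\<^sup>2 * (nrm v)\<^sup>2)
          \<longlonglongrightarrow> 2 * Re (t * (cnj (ip u v) - J v)) + (cmod t)\<^sup>2 * (nrm v)\<^sup>2"
        by (intro tendsto_intros converges_ip) (use u s v in auto)
      moreover have "(\<lambda>n. - (1 / real (Suc n))) \<longlonglongrightarrow> 0"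
        using tendsto_minus[OF LIMSEQ_inverse_real_of_nat] by (simp add: inverse_eq_divide)
      ultimately have "0 \<le> 2 * Re (t * (cnj (ip u v) - J v)) + (cmod t)\<^sup>2 * (nrm v)\<^sup>2"
        by (intro LIMSEQ_le[of "\<lambda>n. - (1 / real (Suc n))"]) auto
      then show ?thesis using ip_commute[of v u] u v by (simp add: d_def)
    qed
    define e where "e = 1 / ((nrm v)\<^sup>2 + 1)"
    have "(nrm v)\<^sup>2 + 1 > 0" by (intro add_nonneg_pos) auto
    then have e: "e > 0" "e * (nrm v)\<^sup>2 \<le> 1" by (simp_all add: e_def)
    have "Re (- of_real e * cnj d * d) = - e * (cmod d)\<^sup>2"
      by (simp add: cmod_power2) (simp add: power2_eq_square algebra_simps)
    moreover have "(cmod (- of_real e * cnj d))\<^sup>2 = e\<^sup>2 * (cmod d)\<^sup>2"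
      by (simp add: norm_mult power_mult_distrib)
    ultimately have "0 \<le> 2 * (- e * (cmod d)\<^sup>2) + e\<^sup>2 * (cmod d)\<^sup>2 * (nrm v)\<^sup>2"
      using var[of "- of_real e * cnj d"] by simp
    also have "\<dots> = (cmod d)\<^sup>2 * e * (e * (nrm v)\<^sup>2 - 2)"
      by (simp add: algebra_simps power2_eq_square)
    finally have "0 \<le> (cmod d)\<^sup>2 * e * (e * (nrm v)\<^sup>2 - 2)" .
    moreover have "e * (nrm v)\<^sup>2 - 2 < 0" using e(2) by linarith
    ultimately have "(cmod d)\<^sup>2 * e \<le> 0" by (simp add: zero_le_mult_iff)
    then have "d = 0" using e(1) by (simp add: mult_le_0_iff)
    then show ?thesis by (simp add: d_def)
  qed
  then show ?thesis using u(1) by blast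
qed

end


section \<open>Symmetric operators\<close>

text \<open>Such an \<open>A\<close> is linear up to null vectors, since
  \<open>\<langle>A (x + y), z\<rangle> = \<langle>x + y, A z\<rangle> = \<langle>A x + A y, z\<rangle>\<close> for all \<open>z\<close>. This suits solution operators that pick
  one of many equivalent solutions.\<close>

locale symmetric_operator = semi_inner +
  fixes A :: "'a \<Rightarrow> 'a"
  assumes A_closed [simp, intro]: "x \<in> V \<Longrightarrow> A x \<in> V"
    and A_sym: "\<lbrakk>x \<in> V; y \<in> V\<rbrakk> \<Longrightarrow> ip (A x) y = ip x (A y)"
    and A_bounded: "\<exists>K. \<forall>x\<in>V. nrm (A x) \<le> K * nrm x"
begin

lemma A_diff: "\<lbrakk>x \<in> V; y \<in> V\<rbrakk> \<Longrightarrow> nrm (A (x - y) - (A x - A y)) = 0"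
  by (rule null_if_orthogonal) (auto simp: ip_linear A_sym)

lemma converges_A:
  assumes "converges s x" "\<And>n. s n \<in> V" "x \<in> V"
  shows "converges (\<lambda>n. A (s n)) (A x)"
proof -
  obtain K where K: "\<And>x. x \<in> V \<Longrightarrow> nrm (A x) \<le> K * nrm x" using A_bounded by blast
  show ?thesis
  proof (rule converges_squeeze)
    show "nrm (A (s n) - A x) \<le> K * nrm (s n - x)" for n
      using K[of "s n - x"] nrm_cong[of "A (s n - x)" "A (s n) - A x"] A_diff[of "s n" x] assms by simp
    show "(\<lambda>n. K * nrm (s n - x)) \<longlonglongrightarrow> 0"
      using assms(1) tendsto_mult_left[of "\<lambda>n. nrm (s n - x)" 0 sequentially K]
      by (simp add: converges_def)
  qed (use assms in auto)
qed

definition shift :: "complex \<Rightarrow> 'a \<Rightarrow> 'a" where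
  "shift \<mu> x = A x - \<mu> *\<^sub>C x"

lemma shift_closed [simp, intro]: "x \<in> V \<Longrightarrow> shift \<mu> x \<in> V"
  by (simp add: shift_def)

lemma shift_adjoint: "\<lbrakk>x \<in> V; y \<in> V\<rbrakk> \<Longrightarrow> ip (shift \<mu> x) y = ip x (shift (cnj \<mu>) y)"
  by (simp add: shift_def ip_linear A_sym)

lemma shift_diff: "\<lbrakk>x \<in> V; y \<in> V\<rbrakk> \<Longrightarrow> nrm (shift \<mu> (x - y) - (shift \<mu> x - shift \<mu> y)) = 0"
  by (rule null_if_orthogonal) (auto simp: ip_linear shift_adjoint)

lemma shift_scale: "x \<in> V \<Longrightarrow> nrm (shift \<mu> (c *\<^sub>C x)) = cmod c * nrm (shift \<mu> x)"
proof -
  assume x: "x \<in> V"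
  have "nrm (shift \<mu> (c *\<^sub>C x) - c *\<^sub>C shift \<mu> x) = 0"
    by (rule null_if_orthogonal) (use x in \<open>auto simp: ip_linear shift_adjoint\<close>)
  from nrm_cong[OF _ _ this] x show ?thesis by simp
qed

lemma ip_A_real: "x \<in> V \<Longrightarrow> Im (ip (A x) x) = 0"
  using ip_commute[of "A x" x] A_sym[of x x] by (simp add: complex_eq_iff)

lemma shift_normal: "x \<in> V \<Longrightarrow> nrm (shift (cnj \<mu>) x) = nrm (shift \<mu> x)"
proof -
  assume x: "x \<in> V"
  have "(nrm (shift (cnj \<mu>) x))\<^sup>2 = (nrm (shift \<mu> x))\<^sup>2"
    using x ip_A_real[OF x] by (simp add: shift_def nrm_diff_sq ip_linear)
  then show ?thesis using x by simp
qed

lemma shift_bounded: "\<exists>K\<ge>0. \<forall>x\<in>V. nrm (shift \<mu> x) \<le> K * nrm x"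
proof -
  obtain K where K: "\<And>x. x \<in> V \<Longrightarrow> nrm (A x) \<le> K * nrm x" using A_bounded by blast
  have "nrm (shift \<mu> x) \<le> (\<bar>K\<bar> + cmod \<mu>) * nrm x" if "x \<in> V" for x
    using nrm_triangle_diff[of "A x" "\<mu> *\<^sub>C x"] K[OF that] that
      mult_right_mono[OF abs_ge_self nrm_ge0[OF that], of K] by (simp add: shift_def algebra_simps)
  then show ?thesis by (intro exI[of _ "\<bar>K\<bar> + cmod \<mu>"]) auto
qed

lemma eigenvalue_real:
  assumes "v \<in> V" "nrm v \<noteq> 0" "nrm (shift \<mu> v) = 0"
  shows "cnj \<mu> = \<mu>"
proof -
  have "ip (shift \<mu> v) v = 0" using null_ip assms by simp
  then have "ip (A v) v = \<mu> * of_real ((nrm v)\<^sup>2)"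
    using assms by (simp add: shift_def ip_linear ip_self)
  then have "Im \<mu> = 0" using ip_A_real[OF assms(1)] assms by (auto simp flip: of_real_power)
  then show ?thesis by (simp add: complex_eq_iff)
qed

text \<open>A chain \<open>(A - \<mu>) w = c v\<close>, \<open>(A - \<mu>) v = 0\<close> would give
  \<open>c \<parallel>v\<parallel>\<^sup>2 = \<langle>(A - \<mu>) w, v\<rangle> = \<langle>w, (A - \<mu>) v\<rangle> = 0\<close>.\<close>

lemma no_generalized_eigenvectors:
  assumes "v \<in> V" "w \<in> V" "nrm (shift \<mu> v) = 0" "nrm (shift \<mu> w - c *\<^sub>C v) = 0" "nrm v \<noteq> 0"
  shows "c = 0"
proof -
  have "ip (shift \<mu> w) v = ip w (shift \<mu> v)"
    using shift_adjoint[of w v \<mu>] eigenvalue_real assms by simp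
  also have "\<dots> = 0" using null_ip_right assms by simp
  finally have "ip (shift \<mu> w - c *\<^sub>C v) v = - c * of_real ((nrm v)\<^sup>2)"
    using assms by (simp add: ip_linear ip_self)
  moreover have "ip (shift \<mu> w - c *\<^sub>C v) v = 0" using null_ip assms by simp
  ultimately show ?thesis using assms by simp
qed

lemma unit_vector_with_small_shift:
  assumes "v \<in> V" "nrm (shift \<mu> v) < c * nrm v"
  shows "\<exists>w\<in>V. nrm w = 1 \<and> nrm (shift \<mu> w) < c"
proof -
  have "nrm v \<noteq> 0"
    using assms(2) nrm_ge0[OF shift_closed[OF assms(1), of \<mu>]] by auto
  then have pos: "nrm v > 0" using nrm_ge0[OF assms(1)] by linarith
  show ?thesis
    by (rule bexI[of _ "of_real (1 / nrm v) *\<^sub>C v"])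
       (use assms pos in \<open>auto simp: shift_scale norm_divide field_simps\<close>)
qed

end

locale symmetric_operator_hilbert = semi_hilbert + symmetric_operator
begin

text \<open>The inner product \<open>\<langle>(A - \<mu>)\<^sup>* x, (A - \<mu>)\<^sup>* y\<rangle>\<close> is equivalent to the given one, because
  \<open>A - \<mu>\<close> is bounded below and normal. The representation theorem for it solves \<open>(A - \<mu>) (A - \<mu>)\<^sup>* u = f\<close>.\<close>

lemma shift_surjective:
  assumes c: "c > 0" and low: "\<And>v. v \<in> V \<Longrightarrow> c * nrm v \<le> nrm (shift \<mu> v)" and f: "f \<in> V"
  shows "\<exists>u\<in>V. nrm (shift \<mu> u - f) = 0"
proof -
  define b where "b x y = ip (shift (cnj \<mu>) x) (shift (cnj \<mu>) y)" for x y
  have b_eq: "b x y = ip x (shift \<mu> (shift (cnj \<mu>) y))" if "x \<in> V" "y \<in> V" for x y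
    using shift_adjoint[of x "shift (cnj \<mu>) y" "cnj \<mu>"] that by (simp add: b_def)
  interpret B: semi_inner scale V b
  proof
    fix x y assume "x \<in> V" "y \<in> V"
    then show "b x y = cnj (b y x)" unfolding b_def by (intro ip_commute) auto
  next
    fix x assume "x \<in> V"
    then show "0 \<le> Re (b x x)" by (simp add: b_def ip_ge0)
  qed (use V_subspace in \<open>auto simp: b_eq ip_linear\<close>)
  have Bn: "B.nrm x = nrm (shift (cnj \<mu>) x)" for x
    by (simp add: B.nrm_def nrm_def b_def)
  have Blow: "c * nrm x \<le> B.nrm x" if "x \<in> V" for x
    using low[OF that] shift_normal[OF that] by (simp add: Bn)
  obtain K where K: "K \<ge> 0" "\<And>x. x \<in> V \<Longrightarrow> B.nrm x \<le> K * nrm x"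
    using shift_bounded[of "cnj \<mu>"] unfolding Bn by blast
  interpret B: semi_hilbert scale V b
  proof
    fix s assume s: "\<And>n. s n \<in> V" "B.cauchy s"
    have "cauchy s"
      unfolding cauchy_def
    proof (intro allI impI)
      fix e :: real assume "e > 0"
      then obtain N where "\<forall>m\<ge>N. \<forall>n\<ge>N. B.nrm (s m - s n) < c * e"
        using s(2) c unfolding B.cauchy_def by (meson mult_pos_pos)
      then have "nrm (s m - s n) < e" if "m \<ge> N" "n \<ge> N" for m n
        using order_le_less_trans[OF Blow[of "s m - s n"], of "c * e"] s(1) c that by simp
      then show "\<exists>N. \<forall>m\<ge>N. \<forall>n\<ge>N. nrm (s m - s n) < e" by blast
    qed
    then obtain x where x: "x \<in> V" "converges s x" using complete s(1) by blast
    have "B.converges s x"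
    proof (rule B.converges_squeeze)
      show "B.nrm (s n - x) \<le> K * nrm (s n - x)" for n using K(2) s x by simp
      show "(\<lambda>n. K * nrm (s n - x)) \<longlonglongrightarrow> 0"
        using x(2) tendsto_mult_left[of "\<lambda>n. nrm (s n - x)" 0 sequentially K] by (simp add: converges_def)
    qed (use s x in auto)
    with x(1) show "\<exists>x\<in>V. B.converges s x" by blast
  qed
  have "\<exists>u\<in>V. \<forall>v\<in>V. b v u = ip v f"
  proof (rule B.Riesz_representation)
    show "cmod (ip x f) \<le> nrm f / c * B.nrm x" if "x \<in> V" for x
    proof -
      have "nrm x \<le> B.nrm x / c" using Blow[OF that] c by (simp add: field_simps)
      then have "nrm x * nrm f \<le> B.nrm x / c * nrm f" using f by (intro mult_right_mono) auto
      then show ?thesis using Cauchy_Schwarz[OF that f] by (simp add: mult.commute)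
    qed
  qed (use f in \<open>auto simp: ip_linear\<close>)
  then obtain u where u: "u \<in> V" "\<And>v. v \<in> V \<Longrightarrow> b v u = ip v f" by blast
  have "nrm (shift \<mu> (shift (cnj \<mu>) u) - f) = 0"
  proof -
    define z where "z = shift \<mu> (shift (cnj \<mu>) u) - f"
    have "z \<in> V" using u f by (simp add: z_def)
    then have "ip z z = 0" using u f b_eq[of z u] by (subst (2) z_def) (simp add: ip_linear)
    then show ?thesis by (simp add: z_def nrm_def)
  qed
  then show ?thesis using u(1) by blast
qed

end


section \<open>Compact symmetric operators\<close>

definition (in semi_inner) compact_op :: "('a \<Rightarrow> 'a) \<Rightarrow> bool" where
  "compact_op A \<longleftrightarrow> (\<forall>s :: nat \<Rightarrow> 'a. (\<forall>n. s n \<in> V \<and> nrm (s n) \<le> 1) \<longrightarrow>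
     (\<exists>r y. strict_mono r \<and> y \<in> V \<and> converges (\<lambda>n. A (s (r n))) y))"

lemma tendsto_zero_if_less_reciprocal:
  fixes f :: "nat \<Rightarrow> real"
  assumes "\<And>n. 0 \<le> f n" "\<And>n. f n < 1 / real (Suc n)"
  shows "f \<longlonglongrightarrow> 0"
proof (rule tendsto_sandwich[OF _ _ tendsto_const LIMSEQ_inverse_real_of_nat])
  show "\<forall>\<^sub>F n in sequentially. f n \<le> inverse (real (Suc n))"
    using assms(2) less_imp_le by (metis (mono_tags) always_eventually inverse_eq_divide)
qed (use assms(1) in simp)

locale compact_symmetric_operator = symmetric_operator +
  assumes A_compact: "compact_op A"
begin

text \<open>Along a subsequence on which \<open>A s\<^sub>n\<close> converges, \<open>s\<^sub>n \<approx> A s\<^sub>n / \<mu>\<close> converges too.\<close>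

lemma approximate_eigenvectors_subconverge:
  assumes s: "\<And>n. s n \<in> V" "\<And>n. nrm (s n) = 1" and ms: "ms \<longlonglongrightarrow> \<mu>" "\<mu> \<noteq> 0"
    and small: "(\<lambda>n. nrm (shift (ms n) (s n))) \<longlonglongrightarrow> 0"
  shows "\<exists>r v. strict_mono r \<and> v \<in> V \<and> converges (\<lambda>n. s (r n)) v \<and> nrm v = 1 \<and> nrm (shift \<mu> v) = 0"
proof -
  obtain r y where r: "strict_mono r" and y: "y \<in> V" and conv: "converges (\<lambda>n. A (s (r n))) y"
    using A_compact[unfolded compact_op_def, rule_format, of s] s by auto
  define v where "v = (1 / \<mu>) *\<^sub>C y"
  have v: "v \<in> V" using y by (simp add: v_def)
  have sv: "converges (\<lambda>n. s (r n)) v"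
  proof (rule converges_null_diff)
    show "converges (\<lambda>n. (1 / \<mu>) *\<^sub>C A (s (r n))) v"
      unfolding v_def by (rule converges_scale[OF conv]) (use s y in auto)
    have le: "nrm (s n - (1 / \<mu>) *\<^sub>C A (s n)) \<le> (nrm (shift (ms n) (s n)) + cmod (ms n - \<mu>)) / cmod \<mu>" for n
    proof -
      have "s n - (1 / \<mu>) *\<^sub>C A (s n) = (- (1 / \<mu>)) *\<^sub>C (shift (ms n) (s n) + (ms n - \<mu>) *\<^sub>C s n)"
        using ms(2) by (simp add: shift_def scale_right_diff_distrib scale_left_diff_distrib scale_right_distrib)
      then have "nrm (s n - (1 / \<mu>) *\<^sub>C A (s n)) = nrm (shift (ms n) (s n) + (ms n - \<mu>) *\<^sub>C s n) / cmod \<mu>"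
        using s(1)[of n] nrm_scale[of "shift (ms n) (s n) + (ms n - \<mu>) *\<^sub>C s n" "- (1 / \<mu>)"]
        by (simp add: norm_divide)
      then show ?thesis
        using nrm_triangle[of "shift (ms n) (s n)" "(ms n - \<mu>) *\<^sub>C s n"] s by (simp add: divide_right_mono)
    qed
    have "(\<lambda>n. (nrm (shift (ms n) (s n)) + cmod (ms n - \<mu>)) / cmod \<mu>) \<longlonglongrightarrow> (0 + cmod (\<mu> - \<mu>)) / cmod \<mu>"
      by (intro tendsto_intros small ms) (use ms in simp)
    then have lim: "(\<lambda>n. (nrm (shift (ms n) (s n)) + cmod (ms n - \<mu>)) / cmod \<mu>) \<longlonglongrightarrow> 0" by simp
    have "(\<lambda>n. nrm (s n - (1 / \<mu>) *\<^sub>C A (s n))) \<longlonglongrightarrow> 0"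
      by (rule tendsto_sandwich[OF _ _ tendsto_const lim]) (use le s in auto)
    from LIMSEQ_subseq_LIMSEQ[OF this r]
    show "(\<lambda>n. nrm (s (r n) - (1 / \<mu>) *\<^sub>C A (s (r n)))) \<longlonglongrightarrow> 0" by (simp add: o_def)
  qed (use s y v in auto)
  have "(\<lambda>n. nrm (s (r n))) \<longlonglongrightarrow> nrm v" by (rule converges_nrm[OF sv]) (use s v in auto)
  then have "nrm v = 1" using s(2) by (simp add: LIMSEQ_const_iff)
  have "converges (\<lambda>n. A (s (r n))) (A v)" by (rule converges_A[OF sv]) (use s v in auto)
  then have "(\<lambda>n. nrm (A (s (r n)) - A v) + nrm (A (s (r n)) - y)) \<longlonglongrightarrow> 0 + 0"
    using conv unfolding converges_def by (intro tendsto_add)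
  moreover have "nrm (A v - y) \<le> nrm (A (s (r n)) - A v) + nrm (A (s (r n)) - y)" for n
    using nrm_triangle_le[of "A v" "A (s (r n))" y] nrm_minus_commute[of "A v" "A (s (r n))"] s v y by simp
  ultimately have "nrm (A v - y) \<le> 0" by (intro LIMSEQ_le_const) auto
  moreover have "shift \<mu> v = A v - y" using ms(2) by (simp add: shift_def v_def)
  ultimately have "nrm (shift \<mu> v) = 0" using v y by (intro antisym) auto
  then show ?thesis using r v sv \<open>nrm v = 1\<close> by blast
qed

lemma eigenvector_if_not_bounded_below:
  assumes "\<mu> \<noteq> 0" and low: "\<And>c. c > 0 \<Longrightarrow> \<exists>v\<in>V. nrm (shift \<mu> v) < c * nrm v"
  shows "\<exists>v\<in>V. nrm v = 1 \<and> nrm (shift \<mu> v) = 0"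
proof -
  have "\<exists>w\<in>V. nrm w = 1 \<and> nrm (shift \<mu> w) < 1 / real (Suc n)" for n
    using low[of "1 / real (Suc n)"] unit_vector_with_small_shift by fastforce
  then obtain s where s: "\<And>n. s n \<in> V" "\<And>n. nrm (s n) = 1" "\<And>n. nrm (shift \<mu> (s n)) < 1 / real (Suc n)"
    by metis
  have "(\<lambda>n. nrm (shift \<mu> (s n))) \<longlonglongrightarrow> 0"
    using s by (intro tendsto_zero_if_less_reciprocal) auto
  from approximate_eigenvectors_subconverge[OF s(1,2) tendsto_const assms(1) this]
  show ?thesis by blast
qed

text \<open>Eigenvalues are isolated, in a quantitative form. If the bound failed along \<open>\<mu>\<^sub>n \<rightarrow> \<mu>\<close>,
  there would be unit vectors \<open>v\<^sub>n\<close>, converging to an eigenvector \<open>v\<close> of \<open>\<mu>\<close>, with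
  \<open>\<bar>\<mu> - \<mu>\<^sub>n\<bar> \<bar>\<langle>v\<^sub>n, v\<rangle>\<bar> = \<bar>\<langle>(A - \<mu>\<^sub>n) v\<^sub>n, v\<rangle>\<bar> \<le> \<bar>\<mu> - \<mu>\<^sub>n\<bar> / 2\<close>, whereas
  \<open>\<langle>v\<^sub>n, v\<rangle>\<close> tends to 1.\<close>

lemma shift_lower_bound_near_eigenvalue:
  assumes "\<mu> \<noteq> 0" "cnj \<mu> = \<mu>"
  shows "\<exists>\<delta>>0. \<forall>\<nu>. cmod (\<nu> - \<mu>) < \<delta> \<longrightarrow> (\<forall>v\<in>V. cmod (\<nu> - \<mu>) / 2 * nrm v \<le> nrm (shift \<nu> v))"
proof (rule ccontr)
  assume "\<not> ?thesis"
  then have "\<exists>\<nu>. cmod (\<nu> - \<mu>) < 1 / real (Suc n) \<and> (\<exists>v\<in>V. nrm (shift \<nu> v) < cmod (\<nu> - \<mu>) / 2 * nrm v)" for n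
    by (metis linorder_not_le of_nat_0_less_iff zero_less_Suc zero_less_divide_1_iff)
  then have "\<exists>\<nu>. cmod (\<nu> - \<mu>) < 1 / real (Suc n) \<and> (\<exists>v\<in>V. nrm v = 1 \<and> nrm (shift \<nu> v) < cmod (\<nu> - \<mu>) / 2)" for n
    using unit_vector_with_small_shift by metis
  then obtain ms s where ms: "\<And>n. cmod (ms n - \<mu>) < 1 / real (Suc n)"
    and s: "\<And>n. s n \<in> V" "\<And>n. nrm (s n) = 1" and bad: "\<And>n. nrm (shift (ms n) (s n)) < cmod (ms n - \<mu>) / 2"
    by metis
  have lim: "(\<lambda>n. cmod (ms n - \<mu>)) \<longlonglongrightarrow> 0"
    using ms by (intro tendsto_zero_if_less_reciprocal) auto
  have "ms \<longlonglongrightarrow> \<mu>" using lim by (simp add: tendsto_norm_zero_iff LIM_zero_cancel)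
  moreover have "(\<lambda>n. nrm (shift (ms n) (s n))) \<longlonglongrightarrow> 0"
  proof (rule tendsto_sandwich[OF _ _ tendsto_const lim])
    have "nrm (shift (ms n) (s n)) \<le> cmod (ms n - \<mu>)" for n
      using bad[of n] norm_ge_zero[of "ms n - \<mu>"] by linarith
    then show "\<forall>\<^sub>F n in sequentially. nrm (shift (ms n) (s n)) \<le> cmod (ms n - \<mu>)" by simp
  qed (use s in auto)
  ultimately have "\<exists>r v. strict_mono r \<and> v \<in> V \<and> converges (\<lambda>n. s (r n)) v \<and> nrm v = 1 \<and> nrm (shift \<mu> v) = 0"
    by (rule approximate_eigenvectors_subconverge[OF s _ assms(1)])
  then obtain r v where r: "strict_mono r" and v: "v \<in> V" "nrm v = 1" "nrm (shift \<mu> v) = 0"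
    and conv: "converges (\<lambda>n. s (r n)) v"
    by blast
  have half: "cmod (ip (s n) v) \<le> 1 / 2" for n
  proof -
    have "ip (shift (ms n) (s n)) v = ip (shift \<mu> (s n)) v + (\<mu> - ms n) * ip (s n) v"
      using s v by (simp add: shift_def ip_linear algebra_simps)
    also have "ip (shift \<mu> (s n)) v = 0"
      using shift_adjoint[of "s n" v \<mu>] null_ip_right[of "s n" "shift \<mu> v"] s v assms(2) by simp
    finally have "cmod (ms n - \<mu>) * cmod (ip (s n) v) \<le> nrm (shift (ms n) (s n))"
      using Cauchy_Schwarz[of "shift (ms n) (s n)" v] s v by (simp add: norm_mult norm_minus_commute)
    then have "cmod (ms n - \<mu>) * cmod (ip (s n) v) \<le> cmod (ms n - \<mu>) * (1 / 2)"
      using bad[of n] by linarith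
    moreover have "cmod (ms n - \<mu>) > 0"
      using bad[of n] nrm_ge0[OF shift_closed[OF s(1)[of n]], of "ms n"] by linarith
    ultimately show ?thesis by (simp only: mult_le_cancel_left_pos)
  qed
  have "(\<lambda>n. cmod (ip (s (r n)) v)) \<longlonglongrightarrow> cmod (ip v v)"
    by (intro tendsto_norm converges_ip[OF conv]) (use s v in auto)
  then have "cmod (ip v v) \<le> 1 / 2" using half by (intro LIMSEQ_le_const2) auto
  then show False using v by (simp add: ip_self)
qed

text \<open>Let \<open>s\<close> be the infimum of \<open>\<parallel>(A - m) v\<parallel>\<close> over unit vectors. A minimising sequence consists
  of approximate null vectors of the nonnegative operator \<open>(A - m)\<^sup>2 - s\<^sup>2\<close>, by the
  Cauchy-Schwarz inequality for its form. This operator is the product of \<open>A - (m - s)\<close> and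
  \<open>A - (m + s)\<close>, so one of the two factors is not bounded below. As \<open>s < \<bar>m\<bar>\<close>, neither \<open>m - s\<close> nor \<open>m + s\<close> is zero.\<close>

lemma eigenvalue_near_approximate_eigenvalue:
  fixes m \<epsilon> :: real
  assumes w: "w \<in> V" "nrm w \<noteq> 0" "nrm (shift (of_real m) w) \<le> \<epsilon> * nrm w" and eps: "\<epsilon> < \<bar>m\<bar>"
  shows "\<exists>\<nu> v. \<bar>\<nu> - m\<bar> \<le> \<epsilon> \<and> v \<in> V \<and> nrm v \<noteq> 0 \<and> nrm (shift (of_real \<nu>) v) = 0"
proof -
  let ?S = "shift (of_real m)"
  define U where "U = {v\<in>V. nrm v = 1}"
  define s where "s = Inf ((\<lambda>v. nrm (?S v)) ` U)"
  have wpos: "nrm w > 0" using w by (simp add: order_less_le)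
  define w1 where "w1 = of_real (1 / nrm w) *\<^sub>C w"
  have w1: "w1 \<in> U" "nrm (?S w1) \<le> \<epsilon>"
    using w wpos by (auto simp: w1_def U_def shift_scale norm_divide field_simps)
  have bdd: "bdd_below ((\<lambda>v. nrm (?S v)) ` U)" by (auto intro!: bdd_belowI[of _ 0] simp: U_def)
  have s_le: "s \<le> nrm (?S v)" if "v \<in> U" for v
    unfolding s_def using bdd that by (auto intro: cInf_lower)
  have s0: "0 \<le> s" unfolding s_def using w1 by (intro cInf_greatest) (auto simp: U_def)
  have s_eps: "s \<le> \<epsilon>" using s_le[OF w1(1)] w1(2) by simp
  have s_hom: "s * nrm v \<le> nrm (?S v)" if "v \<in> V" for v
  proof (cases "nrm v = 0")
    case False
    then have "nrm v > 0" using that by (simp add: order_less_le)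
    then show ?thesis
      using s_le[of "of_real (1 / nrm v) *\<^sub>C v"] that
      by (auto simp: U_def shift_scale norm_divide field_simps)
  qed (use that in simp)
  have "\<exists>v\<in>U. nrm (?S v) < s + 1 / real (Suc n)" for n
    using cInf_lessD[of "(\<lambda>v. nrm (?S v)) ` U" "s + 1 / real (Suc n)"] w1 by (force simp: s_def)
  then have "\<forall>n. \<exists>v. v \<in> V \<and> nrm v = 1 \<and> nrm (?S v) < s + 1 / real (Suc n)"
    unfolding U_def by blast
  then obtain t where t: "\<And>n. t n \<in> V" "\<And>n. nrm (t n) = 1" "\<And>n. nrm (?S (t n)) < s + 1 / real (Suc n)"
    by metis
  define R where "R x = ?S (?S x) - of_real (s\<^sup>2) *\<^sub>C x" for x
  have R_closed [simp]: "x \<in> V \<Longrightarrow> R x \<in> V" for x by (simp add: R_def)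
  define q where "q x y = ip (R x) y" for x y
  have q_eq: "q x y = ip (?S x) (?S y) - of_real (s\<^sup>2) * ip x y" if "x \<in> V" "y \<in> V" for x y
    using that shift_adjoint[of "?S x" y "of_real m"] by (simp add: q_def R_def ip_linear)
  have q_eq': "q x y = ip x (R y)" if "x \<in> V" "y \<in> V" for x y
    using that shift_adjoint[of x "?S y" "of_real m"] by (simp add: q_eq R_def ip_linear)
  interpret Q: semi_inner scale V q
  proof
    fix x y assume "x \<in> V" "y \<in> V"
    then show "q x y = cnj (q y x)" using ip_commute[of x "R y"] q_eq' by (simp add: q_def)
  next
    fix x assume x: "x \<in> V"
    then have "(s * nrm x)\<^sup>2 \<le> (nrm (?S x))\<^sup>2" using s_hom s0 by (intro power_mono) auto
    then show "0 \<le> Re (q x x)" using x by (simp add: q_eq ip_self power_mult_distrib)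
  qed (use V_subspace in \<open>auto simp: q_eq' ip_linear\<close>)
  have Qn: "(Q.nrm x)\<^sup>2 = (nrm (?S x))\<^sup>2 - s\<^sup>2 * (nrm x)\<^sup>2" if "x \<in> V" for x
    using that by (simp add: Q.nrm_sq q_eq ip_self)
  obtain K where K: "K \<ge> 0" "\<And>x. x \<in> V \<Longrightarrow> nrm (?S x) \<le> K * nrm x"
    using shift_bounded by blast
  have QK: "Q.nrm x \<le> K * nrm x" if "x \<in> V" for x
  proof (rule power2_le_imp_le)
    have "(nrm (?S x))\<^sup>2 \<le> (K * nrm x)\<^sup>2" using K that by (intro power_mono) auto
    moreover have "0 \<le> s\<^sup>2 * (nrm x)\<^sup>2" by simp
    ultimately show "(Q.nrm x)\<^sup>2 \<le> (K * nrm x)\<^sup>2" using Qn[OF that] by linarith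
  qed (use K that in auto)
  have R_le: "nrm (R x) \<le> K * Q.nrm x" if "x \<in> V" for x
  proof -
    have "(nrm (R x))\<^sup>2 = cmod (q x (R x))" using that by (simp add: q_def ip_self norm_power)
    also have "\<dots> \<le> Q.nrm x * Q.nrm (R x)" using that by (intro Q.Cauchy_Schwarz) auto
    also have "\<dots> \<le> Q.nrm x * (K * nrm (R x))" using that QK by (intro mult_left_mono) auto
    finally have "nrm (R x) * nrm (R x) \<le> (K * Q.nrm x) * nrm (R x)"
      by (simp add: power2_eq_square algebra_simps)
    then show ?thesis
      using that K(1) nrm_ge0[OF R_closed[OF that]]
      by (cases "nrm (R x) = 0") (auto simp: mult_le_cancel_right simp del: nrm_ge0)
  qed
  have small: "(\<lambda>n. nrm (R (t n))) \<longlonglongrightarrow> 0"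
  proof (rule tendsto_sandwich[OF _ _ tendsto_const])
    have "Q.nrm (t n) \<le> sqrt ((s + 1 / real (Suc n))\<^sup>2 - s\<^sup>2)" for n
    proof (rule real_le_rsqrt)
      have "(nrm (?S (t n)))\<^sup>2 \<le> (s + 1 / real (Suc n))\<^sup>2"
        using t(3)[of n] t(1) by (intro power_mono) auto
      then show "(Q.nrm (t n))\<^sup>2 \<le> (s + 1 / real (Suc n))\<^sup>2 - s\<^sup>2" using Qn t by simp
    qed
    then have "nrm (R (t n)) \<le> K * sqrt ((s + 1 / real (Suc n))\<^sup>2 - s\<^sup>2)" for n
      by (rule order_trans[OF R_le[OF t(1)] mult_left_mono[OF _ K(1)]])
    then show "\<forall>\<^sub>F n in sequentially. nrm (R (t n)) \<le> K * sqrt ((s + 1 / real (Suc n))\<^sup>2 - s\<^sup>2)" by simp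
    have "(\<lambda>n. K * sqrt ((s + inverse (real (Suc n)))\<^sup>2 - s\<^sup>2)) \<longlonglongrightarrow> K * sqrt ((s + 0)\<^sup>2 - s\<^sup>2)"
      by (intro tendsto_intros LIMSEQ_inverse_real_of_nat)
    then show "(\<lambda>n. K * sqrt ((s + 1 / real (Suc n))\<^sup>2 - s\<^sup>2)) \<longlonglongrightarrow> 0" by (simp add: inverse_eq_divide)
  qed (use t in auto)
  have factor: "nrm (shift (of_real (m - s)) (shift (of_real (m + s)) x)) = nrm (R x)" if x: "x \<in> V" for x
  proof (rule nrm_cong)
    show "nrm (shift (of_real (m - s)) (shift (of_real (m + s)) x) - R x) = 0"
      by (rule null_if_orthogonal)
         (use x in \<open>auto simp: R_def shift_def ip_linear A_sym algebra_simps power2_eq_square\<close>)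
  qed (use x in auto)
  have "\<exists>\<nu>\<in>{m + s, m - s}. \<forall>c>0. \<exists>v\<in>V. nrm (shift (of_real \<nu>) v) < c * nrm v"
  proof (rule ccontr)
    assume "\<not> ?thesis"
    then obtain c d where c: "c > 0" "\<And>v. v \<in> V \<Longrightarrow> c * nrm v \<le> nrm (shift (of_real (m + s)) v)"
      and d: "d > 0" "\<And>v. v \<in> V \<Longrightarrow> d * nrm v \<le> nrm (shift (of_real (m - s)) v)"
      by (auto simp: not_less)
    have "d * c \<le> nrm (R (t n))" for n
    proof -
      have "d * c \<le> d * nrm (shift (of_real (m + s)) (t n))"
        using c(2)[of "t n"] t d(1) by (intro mult_left_mono) auto
      also have "\<dots> \<le> nrm (R (t n))" using d(2)[of "shift (of_real (m + s)) (t n)"] factor t(1) by simp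
      finally show ?thesis .
    qed
    then have "d * c \<le> 0" using small by (intro LIMSEQ_le_const) auto
    then show False using mult_pos_pos[OF d(1) c(1)] by linarith
  qed
  then obtain \<nu> where "\<nu> \<in> {m + s, m - s}"
    and low: "\<And>c. c > 0 \<Longrightarrow> \<exists>v\<in>V. nrm (shift (of_real \<nu>) v) < c * nrm v" by blast
  then have nu: "\<bar>\<nu> - m\<bar> \<le> \<epsilon>" using s0 s_eps by auto
  have "complex_of_real \<nu> \<noteq> 0" using nu eps by auto
  from eigenvector_if_not_bounded_below[OF this low] nu show ?thesis by (metis zero_neq_one)
qed

end


section \<open>Compactness in the limit and in finite dimensions\<close>

context semi_hilbert
begin

text \<open>The \<open>n\<close>-th approximation yields a subsequence along which \<open>A x\<^sub>k\<close> varies by less than \<open>1 / (n + 1)\<close>;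
  a diagonal subsequence is a Cauchy sequence.\<close>

lemma compact_op_limit:
  assumes A: "\<And>x. x \<in> V \<Longrightarrow> A x \<in> V"
    and approx: "\<And>e. e > 0 \<Longrightarrow> \<exists>B. compact_op B \<and> (\<forall>x\<in>V. B x \<in> V \<and> nrm (A x - B x) \<le> e * nrm x)"
  shows "compact_op A"
  unfolding compact_op_def
proof (intro allI impI)
  fix x :: "nat \<Rightarrow> 'a" assume x: "\<forall>n. x n \<in> V \<and> nrm (x n) \<le> 1"
  define P where "P n s \<longleftrightarrow> (\<exists>N. \<forall>i\<ge>N. \<forall>j\<ge>N. nrm (A (x (s i)) - A (x (s j))) < 1 / real (Suc n))"
    for n :: nat and s :: "nat \<Rightarrow> nat"
  interpret subseqs P
  proof
    fix n :: nat and s :: "nat \<Rightarrow> nat"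
    assume "strict_mono s"
    define e where "e = 1 / real (Suc n)"
    have e: "e > 0" by (simp add: e_def)
    obtain B where B: "compact_op B" "\<And>x. x \<in> V \<Longrightarrow> B x \<in> V" "\<And>x. x \<in> V \<Longrightarrow> nrm (A x - B x) \<le> e / 3 * nrm x"
      using approx[of "e / 3"] e by auto
    have "\<exists>r y. strict_mono r \<and> y \<in> V \<and> converges (\<lambda>n. B (x (s (r n)))) y"
      using B(1)[unfolded compact_op_def, rule_format, of "\<lambda>n. x (s n)"] x by blast
    then obtain r y where r: "strict_mono r" "y \<in> V" "converges (\<lambda>n. B (x (s (r n)))) y" by blast
    then have "cauchy (\<lambda>n. B (x (s (r n))))" using x B(2) by (intro converges_imp_cauchy[of _ y]) auto
    then obtain N where N: "\<And>i j. i \<ge> N \<Longrightarrow> j \<ge> N \<Longrightarrow> nrm (B (x (s (r i))) - B (x (s (r j)))) < e / 3"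
      using e unfolding cauchy_def by (meson divide_pos_pos zero_less_numeral)
    have close: "nrm (A (x k) - B (x k)) \<le> e / 3" for k
      using B(3)[of "x k"] x e mult_left_mono[of "nrm (x k)" 1 "e / 3"] by (auto intro: order_trans)
    have "nrm (A (x (s (r i))) - A (x (s (r j)))) < e" if "i \<ge> N" "j \<ge> N" for i j
    proof -
      let ?a = "x (s (r i))" and ?b = "x (s (r j))"
      have "nrm (A ?a - A ?b) \<le> nrm (A ?a - B ?a) + nrm (B ?a - A ?b)"
        using x A B(2) by (intro nrm_triangle_le) auto
      also have "nrm (B ?a - A ?b) \<le> nrm (B ?a - B ?b) + nrm (B ?b - A ?b)"
        using x A B(2) by (intro nrm_triangle_le) auto
      also have "nrm (B ?b - A ?b) = nrm (A ?b - B ?b)" using x A B(2) by (intro nrm_minus_commute) auto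
      finally show ?thesis using close[of "s (r i)"] close[of "s (r j)"] N[OF that] by linarith
    qed
    then show "\<exists>r'. strict_mono r' \<and> P n (s \<circ> r')"
      using r(1) unfolding P_def e_def o_def by blast
  qed
  have "P n diagseq" for n
  proof -
    have "P n (diagseq \<circ> (+) (Suc n))"
    proof (rule diagseq_holds)
      fix n r s assume rs: "strict_mono (r :: nat \<Rightarrow> nat)" "P n s"
      then obtain N where "\<forall>i\<ge>N. \<forall>j\<ge>N. nrm (A (x (s i)) - A (x (s j))) < 1 / real (Suc n)"
        unfolding P_def by blast
      then show "P n (s \<circ> r)"
        using seq_suble[OF rs(1)] unfolding P_def o_def by (meson order_trans)
    qed
    then obtain N where N: "\<And>i j. i \<ge> N \<Longrightarrow> j \<ge> N \<Longrightarrow>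
        nrm (A (x (diagseq (Suc n + i))) - A (x (diagseq (Suc n + j)))) < 1 / real (Suc n)"
      unfolding P_def o_def by blast
    have "nrm (A (x (diagseq i)) - A (x (diagseq j))) < 1 / real (Suc n)"
      if "i \<ge> N + Suc n" "j \<ge> N + Suc n" for i j
      using N[of "i - Suc n" "j - Suc n"] that by (simp add: le_diff_conv2 del: add_Suc)
    then show ?thesis unfolding P_def by blast
  qed
  moreover have "\<exists>n. 1 / real (Suc n) < e" if "e > 0" for e :: real
    using reals_Archimedean[OF that] by (simp add: inverse_eq_divide)
  ultimately have "cauchy (\<lambda>n. A (x (diagseq n)))"
    unfolding cauchy_def P_def by (meson less_trans)
  then obtain y where "y \<in> V" "converges (\<lambda>n. A (x (diagseq n))) y"
    using complete[of "\<lambda>n. A (x (diagseq n))"] x A by blast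
  then show "\<exists>r y. strict_mono r \<and> y \<in> V \<and> converges (\<lambda>n. A (x (r n))) y"
    using subseq_diagseq by blast
qed

end

context semi_inner
begin

text \<open>Finitely many linear functionals \<open>N \<cdot> p\<close> are assumed to determine the vectors of \<open>U\<close> up to null vectors.
  Split off a unit vector \<open>b\<close>. On the orthogonal complement of \<open>b\<close> in \<open>U\<close>, the functionals that remain after
  elimination of one \<open>p\<close> with \<open>N b p \<noteq> 0\<close> still determine the vectors: if they vanish at \<open>v\<close>, then \<open>v\<close> is a
  multiple of \<open>b\<close>, hence null. The coefficients \<open>\<langle>s\<^sub>n, b\<rangle>\<close> are bounded, so the induction may proceed along a
  subsequence on which they converge.\<close>

lemma bounded_sequence_subconverges:
  fixes s :: "nat \<Rightarrow> 'a"
  assumes "finite P" "subspace U" "U \<subseteq> V"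
    and "\<And>x y p. \<lbrakk>x \<in> U; y \<in> U; p \<in> P\<rbrakk> \<Longrightarrow> N (x + y) p = N x p + N y p"
    and "\<And>c x p. \<lbrakk>x \<in> U; p \<in> P\<rbrakk> \<Longrightarrow> N (c *\<^sub>C x) p = (c :: complex) * N x p"
    and "\<And>x. \<lbrakk>x \<in> U; \<And>p. p \<in> P \<Longrightarrow> N x p = 0\<rbrakk> \<Longrightarrow> nrm x = 0"
    and "\<And>n. s n \<in> U" "\<And>n. nrm (s n) \<le> K"
  shows "\<exists>r y. strict_mono r \<and> y \<in> U \<and> converges (\<lambda>n. s (r n)) y"
  using assms
proof (induction "card P" arbitrary: P U N s K rule: less_induct)
  case less
  note U = less.prems(2) and N_add = less.prems(4) and N_scale = less.prems(5)
    and N_null = less.prems(6) and s = less.prems(7,8)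
  have UV: "x \<in> V" if "x \<in> U" for x using that less.prems(3) by blast
  show ?case
  proof (cases "\<forall>x\<in>U. nrm x = 0")
    case True
    then have "converges (\<lambda>n. s (id n)) (s 0)"
      using subspace_diff[OF U s(1) s(1)] by (simp add: converges_def)
    then show ?thesis using s(1)[of 0] strict_mono_id by blast
  next
    case False
    then obtain x where x: "x \<in> U" "nrm x \<noteq> 0" by blast
    define b where "b = of_real (1 / nrm x) *\<^sub>C x"
    have b: "b \<in> U" "nrm b = 1"
      using subspace_scale[OF U x(1)] x UV by (auto simp: b_def norm_divide)
    have bb: "ip b b = 1" using ip_self b UV by simp
    obtain p where p: "p \<in> P" "N b p \<noteq> 0" using N_null[OF b(1)] b(2) by fastforce
    define U' where "U' = {v \<in> U. ip v b = 0}"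
    define N' where "N' v q = N v q + (- (N v p / N b p)) * N b q" for v q
    define a where "a n = ip (s n) b" for n
    have a_le: "cmod (a n) \<le> K" for n
      using Cauchy_Schwarz[of "s n" b] s b UV order_trans[OF _ s(2)[of n]] by (simp add: a_def)
    then have "bounded (range a)" by (intro boundedI[of _ K]) auto
    then obtain c r where r: "strict_mono r" and c: "(\<lambda>n. a (r n)) \<longlonglongrightarrow> c"
      using bounded_imp_convergent_subsequence[of a] by (auto simp: o_def)
    define t where "t n = s (r n) - a (r n) *\<^sub>C b" for n
    have tU: "t n \<in> U" for n unfolding t_def by (intro subspace_diff[OF U] subspace_scale[OF U] s b)
    have "\<exists>r' y. strict_mono r' \<and> y \<in> U' \<and> converges (\<lambda>n. t (r' n)) y"
    proof (rule less.hyps[of "P - {p}" U' N' t "K + K"])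
      show "card (P - {p}) < card P" "finite (P - {p})"
        using card_Diff1_less[OF less.prems(1) p(1)] less.prems(1) by simp_all
      show "subspace U'"
        unfolding subspace_def U'_def
        using subspace_0[OF U] subspace_add[OF U] subspace_scale[OF U] b UV by (auto simp: ip_linear)
      show "U' \<subseteq> V" using UV by (auto simp: U'_def)
      show "t n \<in> U'" for n
        using tU s b bb UV by (simp add: U'_def) (simp add: t_def ip_linear a_def)
      show "nrm (t n) \<le> K + K" for n
        unfolding t_def
        using nrm_triangle_diff[of "s (r n)" "a (r n) *\<^sub>C b"] s(2)[of "r n"] a_le[of "r n"] s(1) b UV by simp
      show "N' (x + y) q = N' x q + N' y q" if "x \<in> U'" "y \<in> U'" "q \<in> P - {p}" for x y q
        using that p N_add by (simp add: U'_def N'_def add_divide_distrib ring_distribs)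
      show "N' (d *\<^sub>C x) q = d * N' x q" if "x \<in> U'" "q \<in> P - {p}" for d x q
        using that p N_scale by (simp add: U'_def N'_def ring_distribs)
      show "nrm v = 0" if v: "v \<in> U'" and zero: "\<And>q. q \<in> P - {p} \<Longrightarrow> N' v q = 0" for v
      proof -
        define k where "k = - (N v p / N b p)"
        have vU: "v \<in> U" "ip v b = 0" using v by (auto simp: U'_def)
        have kb: "k *\<^sub>C b \<in> U" by (rule subspace_scale[OF U b(1)])
        have "nrm (v + k *\<^sub>C b) = 0"
        proof (rule N_null[OF subspace_add[OF U vU(1) kb]])
          fix q assume q: "q \<in> P"
          have "N (v + k *\<^sub>C b) q = N v q + k * N b q"
            using N_add[OF vU(1) kb q] N_scale[OF b(1) q] by simp
          then show "N (v + k *\<^sub>C b) q = 0"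
            using zero[of q] q p(2) by (cases "q = p") (auto simp: N'_def k_def)
        qed
        then have "ip (v + k *\<^sub>C b) b = 0" using null_ip vU b kb UV by simp
        then have "k = 0" using vU b bb UV by (simp add: ip_linear)
        then show ?thesis using \<open>nrm (v + k *\<^sub>C b) = 0\<close> by simp
      qed
    qed
    then obtain r' y where r': "strict_mono r'" and y: "y \<in> U'" "converges (\<lambda>n. t (r' n)) y" by blast
    have "converges (\<lambda>n. a (r (r' n)) *\<^sub>C b) (c *\<^sub>C b)"
    proof (rule converges_squeeze)
      show "nrm (a (r (r' n)) *\<^sub>C b - c *\<^sub>C b) \<le> cmod (a (r (r' n)) - c)" for n
        using b UV by (simp flip: scale_left_diff_distrib)
      show "(\<lambda>n. cmod (a (r (r' n)) - c)) \<longlonglongrightarrow> 0"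
        using LIMSEQ_subseq_LIMSEQ[OF c r'] by (simp add: o_def tendsto_norm_zero LIM_zero)
    qed (use b UV in auto)
    from converges_add[OF y(2) this]
    have "converges (\<lambda>n. t (r' n) + a (r (r' n)) *\<^sub>C b) (y + c *\<^sub>C b)"
      using tU y(1) b UV by (simp add: U'_def)
    then have "converges (\<lambda>n. s ((r \<circ> r') n)) (y + c *\<^sub>C b)" by (simp add: t_def)
    moreover have "y + c *\<^sub>C b \<in> U"
      using y(1) by (intro subspace_add[OF U] subspace_scale[OF U] b) (simp add: U'_def)
    ultimately show ?thesis using strict_mono_o[OF r r'] by blast
  qed
qed

end

section \<open>The Hilbert space of square integrable functions\<close>

locale bounded_domain =
  fixes D :: "(real^2) set"
  assumes D_open: "open D" and D_bounded: "bounded D"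
begin

abbreviation M :: "(real^2) measure" where "M \<equiv> lebesgue_on D"

lemma D_sets [simp, measurable]: "D \<in> sets lebesgue"
  using D_open by simp

sublocale M: finite_measure M
  by (rule finite_measure_lebesgue_on) (use D_open D_bounded lmeasurable_open in blast)

lemma L2_measurable [measurable_dest]: "f \<in> L2 D \<Longrightarrow> f \<in> borel_measurable M"
  by (simp add: L2_def)

lemma L2_integrable_sq: "f \<in> L2 D \<Longrightarrow> integrable M (\<lambda>x. (cmod (f x))\<^sup>2)"
  by (simp add: L2_def)

lemma L2_I: "\<lbrakk>f \<in> borel_measurable M; integrable M (\<lambda>x. (cmod (f x))\<^sup>2)\<rbrakk> \<Longrightarrow> f \<in> L2 D"
  by (simp add: L2_def)

lemma L2_bounded:
  assumes [measurable]: "f \<in> borel_measurable M" and "\<And>x. x \<in> D \<Longrightarrow> cmod (f x) \<le> B"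
  shows "f \<in> L2 D"
proof (rule L2_I)
  show "integrable M (\<lambda>x. (cmod (f x))\<^sup>2)"
    by (rule M.integrable_const_bound[where B = "B\<^sup>2"]) (use assms in \<open>auto intro!: AE_I2 power_mono\<close>)
qed fact

lemma L2_cmul: "f \<in> L2 D \<Longrightarrow> (\<lambda>x. c * f x) \<in> L2 D"
  by (auto simp: L2_def norm_mult power_mult_distrib)

lemma borel_measurable_cnj [measurable (raw)]:
  "f \<in> borel_measurable N \<Longrightarrow> (\<lambda>x. cnj (f x)) \<in> borel_measurable N"
  by (rule measurable_compose[where g = cnj, OF _ borel_measurable_continuous_onI])
     (auto intro: continuous_on_cnj)

lemma L2_cnj: "f \<in> L2 D \<Longrightarrow> (\<lambda>x. cnj (f x)) \<in> L2 D"
  by (auto simp: L2_def)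

lemma L2_add:
  assumes "f \<in> L2 D" "g \<in> L2 D"
  shows "(\<lambda>x. f x + g x) \<in> L2 D"
proof (rule L2_I)
  have [measurable]: "f \<in> borel_measurable M" "g \<in> borel_measurable M"
    using assms by (auto simp: L2_def)
  show "(\<lambda>x. f x + g x) \<in> borel_measurable M" by simp
  have "(cmod (f x + g x))\<^sup>2 \<le> 2 * (cmod (f x))\<^sup>2 + 2 * (cmod (g x))\<^sup>2" for x
  proof -
    have "(cmod (f x + g x))\<^sup>2 \<le> (cmod (f x) + cmod (g x))\<^sup>2"
      by (intro power_mono norm_triangle_ineq) auto
    also have "\<dots> \<le> 2 * (cmod (f x))\<^sup>2 + 2 * (cmod (g x))\<^sup>2"
      using sum_squares_bound[of "cmod (f x)" "cmod (g x)"] by (simp add: power2_sum)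
    finally show ?thesis .
  qed
  then have le: "AE x in M. norm ((cmod (f x + g x))\<^sup>2) \<le> norm (2 * (cmod (f x))\<^sup>2 + 2 * (cmod (g x))\<^sup>2)"
    by (simp add: order_trans[OF _ abs_ge_self])
  show "integrable M (\<lambda>x. (cmod (f x + g x))\<^sup>2)"
  proof (rule Bochner_Integration.integrable_bound[OF _ _ le])
    show "integrable M (\<lambda>x. 2 * (cmod (f x))\<^sup>2 + 2 * (cmod (g x))\<^sup>2)"
      by (intro Bochner_Integration.integrable_add integrable_mult_right L2_integrable_sq assms)
  qed measurable
qed

lemma L2_zero: "(\<lambda>x. 0) \<in> L2 D"
  by (rule L2_bounded[of _ 0]) auto

lemma L2_diff: "f \<in> L2 D \<Longrightarrow> g \<in> L2 D \<Longrightarrow> (\<lambda>x. f x - g x) \<in> L2 D"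
  using L2_add[of f "\<lambda>x. (-1) * g x"] L2_cmul[of g "-1"] by simp

lemma L2_mult_integrable:
  assumes "f \<in> L2 D" "g \<in> L2 D"
  shows "integrable M (\<lambda>x. f x * g x)"
proof (rule Bochner_Integration.integrable_bound[of M "\<lambda>x. (cmod (f x))\<^sup>2 + (cmod (g x))\<^sup>2"])
  show "(\<lambda>x. f x * g x) \<in> borel_measurable M"
    using assms by (intro borel_measurable_times) (auto simp: L2_def)
  have "cmod (f x) * cmod (g x) \<le> (cmod (f x))\<^sup>2 + (cmod (g x))\<^sup>2" for x
    using sum_squares_bound[of "cmod (f x)" "cmod (g x)"]
      mult_nonneg_nonneg[OF norm_ge_zero[of "f x"] norm_ge_zero[of "g x"]] by linarith
  then show "AE x in M. norm (f x * g x) \<le> norm ((cmod (f x))\<^sup>2 + (cmod (g x))\<^sup>2)"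
    by (auto simp: norm_mult)
qed (use assms L2_integrable_sq in auto)

definition ip :: "(real^2 \<Rightarrow> complex) \<Rightarrow> (real^2 \<Rightarrow> complex) \<Rightarrow> complex" where
  "ip f g = (LINT x|M. f x * cnj (g x))"

lemma L2_subspace: "f \<in> L2 D \<Longrightarrow> g \<in> L2 D \<Longrightarrow> (\<lambda>x. c * f x + g x) \<in> L2 D"
  using L2_add L2_cmul by blast

lemma l2_norm_nonneg [simp]: "0 \<le> l2_norm D f"
  by (simp add: l2_norm_def)

lemma ip_self_eq: "ip f f = of_real ((l2_norm D f)\<^sup>2)"
proof -
  have "f x * cnj (f x) = of_real ((cmod (f x))\<^sup>2)" for x by (simp only: complex_norm_square)
  then show ?thesis by (simp add: ip_def l2_norm_def flip: of_real_power)
qed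

sublocale L2: semi_inner "\<lambda>c f x. c * f x" "L2 D" ip
proof -
  interpret vector_space "\<lambda>(c::complex) (f :: real^2 \<Rightarrow> complex) x. c * f x"
    by unfold_locales (auto simp: fun_eq_iff algebra_simps)
  show "semi_inner (\<lambda>c f x. c * f x) (L2 D) ip"
  proof
    show "local.subspace (L2 D)"
      unfolding subspace_def using L2_zero L2_add L2_cmul by (auto simp: plus_fun_def zero_fun_def)
  next
    fix f g h assume "f \<in> L2 D" "g \<in> L2 D" "h \<in> L2 D"
    then show "ip (f + g) h = ip f h + ip g h"
      using L2_mult_integrable[of f "\<lambda>x. cnj (h x)"] L2_mult_integrable[of g "\<lambda>x. cnj (h x)"] L2_cnj[of h]
      by (simp add: ip_def plus_fun_def ring_distribs)
  next
    fix f g and c :: complex assume "f \<in> L2 D" "g \<in> L2 D"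
    then show "ip (\<lambda>x. c * f x) g = c * ip f g"
      by (simp add: ip_def mult.assoc)
  next
    fix f g assume "f \<in> L2 D" "g \<in> L2 D"
    have "cnj (ip g f) = (LINT x|M. cnj (g x * cnj (f x)))" unfolding ip_def by (rule Bochner_Integration.integral_cnj[symmetric])
    then show "ip f g = cnj (ip g f)" by (simp add: ip_def mult.commute)
  next
    fix f assume "f \<in> L2 D"
    show "0 \<le> Re (ip f f)" by (simp add: ip_self_eq)
  qed
qed

lemma nrm_eq [simp]: "L2.nrm f = l2_norm D f"
  by (simp add: L2.nrm_def ip_self_eq)

lemma l2_norm_eq_0_iff: "f \<in> L2 D \<Longrightarrow> l2_norm D f = 0 \<longleftrightarrow> (AE x in M. f x = 0)"
  unfolding l2_norm_def using integral_nonneg_eq_0_iff_AE[of M "\<lambda>x. (cmod (f x))\<^sup>2"]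
  by (simp add: L2_integrable_sq)

lemma l2_eq_iff: "f \<in> L2 D \<Longrightarrow> g \<in> L2 D \<Longrightarrow> l2_eq D f g \<longleftrightarrow> l2_norm D (\<lambda>x. f x - g x) = 0"
  by (simp add: l2_norm_eq_0_iff L2_diff l2_eq_def)

lemma l2_norm_cong_AE:
  assumes "AE x in M. f x = g x" "f \<in> L2 D" "g \<in> L2 D"
  shows "l2_norm D f = l2_norm D g"
  unfolding l2_norm_def using assms
  by (intro arg_cong[of _ _ sqrt] integral_cong_AE) (auto simp: L2_def)

lemma L1_le_l2_norm:
  assumes "f \<in> L2 D"
  shows "integrable M f" "(LINT x|M. cmod (f x)) \<le> l2_norm D f * l2_norm D (\<lambda>_. 1)"
proof -
  have one: "(\<lambda>_. 1) \<in> L2 D" by (rule L2_bounded[of _ 1]) auto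
  show "integrable M f" using L2_mult_integrable[OF assms one] by simp
  have abs: "(\<lambda>x. of_real (cmod (f x))) \<in> L2 D"
    using assms by (auto simp: L2_def)
  have "(LINT x|M. cmod (f x)) = cmod (ip (\<lambda>x. of_real (cmod (f x))) (\<lambda>_. 1))"
    by (simp add: ip_def)
  also have "\<dots> \<le> L2.nrm (\<lambda>x. of_real (cmod (f x))) * L2.nrm (\<lambda>_. 1)"
    using L2.Cauchy_Schwarz abs one by blast
  also have "\<dots> = l2_norm D f * l2_norm D (\<lambda>_. 1)" by (simp add: l2_norm_def)
  finally show "(LINT x|M. cmod (f x)) \<le> l2_norm D f * l2_norm D (\<lambda>_. 1)" .
qed

text \<open>Since \<open>D\<close> has finite measure, an \<open>L\<^sup>2\<close> Cauchy sequence is an \<open>L\<^sup>1\<close> Cauchy sequence and has a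
  subsequence that converges almost everywhere; its limit is the \<open>L\<^sup>2\<close> limit by Fatou's lemma.\<close>

lemma L2_complete:
  assumes s: "\<And>n. s n \<in> L2 D" and C: "L2.cauchy s"
  shows "\<exists>f\<in>L2 D. L2.converges s f"
proof -
  have [measurable]: "s n \<in> borel_measurable M" for n using s by (simp add: L2_def)
  have cau: "\<exists>N. \<forall>i\<ge>N. \<forall>j\<ge>N. l2_norm D (\<lambda>x. s i x - s j x) < e" if "e > 0" for e
    using C that unfolding L2.cauchy_def nrm_eq by (simp add: fun_diff_def)
  define K where "K = l2_norm D (\<lambda>_. 1) + 1"
  have K: "K > 0" using l2_norm_nonneg[of "\<lambda>_. 1"] by (simp add: K_def del: l2_norm_nonneg)
  have "\<exists>N. \<forall>i\<ge>N. \<forall>j\<ge>N. (LINT x|M. norm (s i x - s j x)) < e" if "e > 0" for e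
  proof -
    have "e / K > 0" using that K by simp
    from cau[OF this] obtain N
      where N: "\<And>i j. i \<ge> N \<Longrightarrow> j \<ge> N \<Longrightarrow> l2_norm D (\<lambda>x. s i x - s j x) < e / K"
      by blast
    have "(LINT x|M. norm (s i x - s j x)) < e" if "i \<ge> N" "j \<ge> N" for i j
    proof -
      have "(LINT x|M. norm (s i x - s j x)) \<le> l2_norm D (\<lambda>x. s i x - s j x) * l2_norm D (\<lambda>_. 1)"
        by (rule L1_le_l2_norm) (use s in \<open>intro L2_diff\<close>)
      also have "\<dots> \<le> l2_norm D (\<lambda>x. s i x - s j x) * K"
        by (intro mult_left_mono) (auto simp: K_def)
      also have "\<dots> < e" using N[OF that] K by (simp add: field_simps)
      finally show ?thesis .
    qed
    then show ?thesis by blast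
  qed
  then obtain r where r: "strict_mono r" and ae: "AE x in M. Cauchy (\<lambda>i. s (r i) x)"
    using cauchy_L1_AE_cauchy_subseq[of M s] L1_le_l2_norm(1)[OF s] by blast
  define f where "f x = lim (\<lambda>i. s (r i) x)" for x
  have f_meas [measurable]: "f \<in> borel_measurable M"
    unfolding f_def by (rule borel_measurable_lim_metric) simp
  have lim: "AE x in M. (\<lambda>i. s (r i) x) \<longlonglongrightarrow> f x"
    using ae unfolding f_def by eventually_elim (simp add: Cauchy_convergent_iff convergent_LIMSEQ_iff)
  have close: "(\<lambda>x. s n x - f x) \<in> L2 D \<and> l2_norm D (\<lambda>x. s n x - f x) \<le> e"
    if N: "\<And>j. j \<ge> N \<Longrightarrow> l2_norm D (\<lambda>x. s n x - s j x) < e" for n N e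
  proof -
    have e: "e > 0" using N[of N] l2_norm_nonneg order_le_less_trans by blast
    have "(\<integral>\<^sup>+x. ennreal ((cmod (s n x - f x))\<^sup>2) \<partial>M)
        = (\<integral>\<^sup>+x. liminf (\<lambda>j. ennreal ((cmod (s n x - s (r j) x))\<^sup>2)) \<partial>M)"
    proof (rule nn_integral_cong_AE)
      show "AE x in M. ennreal ((cmod (s n x - f x))\<^sup>2) = liminf (\<lambda>j. ennreal ((cmod (s n x - s (r j) x))\<^sup>2))"
        using lim
      proof eventually_elim
        case (elim x)
        have "(\<lambda>j. ennreal ((cmod (s n x - s (r j) x))\<^sup>2)) \<longlonglongrightarrow> ennreal ((cmod (s n x - f x))\<^sup>2)"
          by (intro tendsto_ennrealI tendsto_intros elim)
        from lim_imp_Liminf[OF _ this] show ?case by simp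
      qed
    qed
    also have "\<dots> \<le> liminf (\<lambda>j. \<integral>\<^sup>+x. ennreal ((cmod (s n x - s (r j) x))\<^sup>2) \<partial>M)"
      by (rule nn_integral_liminf) simp
    also have "\<dots> \<le> liminf (\<lambda>j. ennreal (e\<^sup>2))"
    proof (rule Liminf_mono)
      have "(\<integral>\<^sup>+x. ennreal ((cmod (s n x - s (r j) x))\<^sup>2) \<partial>M) \<le> ennreal (e\<^sup>2)" if "j \<ge> N" for j
      proof -
        have "r j \<ge> N" using seq_suble[OF r, of j] that by simp
        from N[OF this] have "(l2_norm D (\<lambda>x. s n x - s (r j) x))\<^sup>2 \<le> e\<^sup>2"
          by (intro power_mono) auto
        then have "(LINT x|M. (cmod (s n x - s (r j) x))\<^sup>2) \<le> e\<^sup>2" by (simp add: l2_norm_def)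
        then show ?thesis
          using nn_integral_eq_integral[OF L2_integrable_sq[OF L2_diff[OF s[of n] s[of "r j"]]]]
          by (simp add: ennreal_leI)
      qed
      then show "\<forall>\<^sub>F j in sequentially. (\<integral>\<^sup>+x. ennreal ((cmod (s n x - s (r j) x))\<^sup>2) \<partial>M) \<le> ennreal (e\<^sup>2)"
        by (auto simp: eventually_sequentially)
    qed
    also have "\<dots> = ennreal (e\<^sup>2)" by (simp add: Liminf_const)
    finally have le: "(\<integral>\<^sup>+x. ennreal ((cmod (s n x - f x))\<^sup>2) \<partial>M) \<le> ennreal (e\<^sup>2)" .
    then have int: "integrable M (\<lambda>x. (cmod (s n x - f x))\<^sup>2)"
      by (intro integrableI_bounded) (auto intro: order_le_less_trans)
    then have "(LINT x|M. (cmod (s n x - f x))\<^sup>2) \<le> e\<^sup>2"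
      using le nn_integral_eq_integral[OF int] by simp
    then have "l2_norm D (\<lambda>x. s n x - f x) \<le> e"
      unfolding l2_norm_def using e by (intro real_le_lsqrt) auto
    with int show ?thesis by (auto intro: L2_I)
  qed
  have f: "f \<in> L2 D"
  proof -
    obtain N where "\<forall>i\<ge>N. \<forall>j\<ge>N. l2_norm D (\<lambda>x. s i x - s j x) < 1" using cau[of 1] by auto
    then have "(\<lambda>x. s N x - f x) \<in> L2 D" using close[of N N 1] by blast
    from L2_diff[OF s[of N] this] show ?thesis by simp
  qed
  have "L2.converges s f"
    unfolding L2.converges_def nrm_eq
  proof (rule LIMSEQ_I)
    fix e :: real assume "e > 0"
    then obtain N where N: "\<forall>i\<ge>N. \<forall>j\<ge>N. l2_norm D (\<lambda>x. s i x - s j x) < e / 2" using cau[of "e / 2"] by auto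
    have "l2_norm D (s n - f) < e" if "n \<ge> N" for n
      using close[of N n "e / 2"] N that \<open>e > 0\<close> by (simp add: fun_diff_def)
    then show "\<exists>no. \<forall>n\<ge>no. norm (l2_norm D (s n - f) - 0) < e" by auto
  qed
  with f show ?thesis by blast
qed

sublocale L2: semi_hilbert "\<lambda>c f x. c * f x" "L2 D" ip
  by unfold_locales (rule L2_complete)

end

section \<open>Smooth functions\<close>

lemma partial_eq: "(f has_derivative f') (at x) \<Longrightarrow> partial i f x = f' (axis i 1)"
  unfolding partial_def using frechet_derivative_at by metis

lemma has_derivative_frechet: "f differentiable at x \<Longrightarrow> (f has_derivative frechet_derivative f (at x)) (at x)"
  by (simp add: frechet_derivative_works)

lemma C_k_SucD: "C_k (Suc k) f \<Longrightarrow> C_k k f"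
proof (induction k arbitrary: f)
  case 0
  then show ?case
    by (auto simp: continuous_on_eq_continuous_at intro: differentiable_imp_continuous_within)
qed auto

lemma C_k_const: "C_k k (\<lambda>x. c)"
proof (induction k arbitrary: c)
  case (Suc k)
  have "partial i (\<lambda>x. c) = (\<lambda>x. 0)" for i by (rule ext) (subst partial_eq, auto)
  with Suc show ?case by auto
qed auto

lemma C_k_linear: "bounded_linear f \<Longrightarrow> C_k k f"
proof (cases k)
  case (Suc j)
  assume f: "bounded_linear f"
  have "partial i f = (\<lambda>x. f (axis i 1))" for i
    by (rule ext) (rule partial_eq, rule bounded_linear_imp_has_derivative, rule f)
  then show ?thesis using Suc f C_k_const by (auto simp: bounded_linear_imp_differentiable)
qed (auto simp: linear_continuous_on)

lemma C_k_add: "C_k k f \<Longrightarrow> C_k k g \<Longrightarrow> C_k k (\<lambda>x. f x + g x)"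
proof (induction k arbitrary: f g)
  case (Suc k)
  then have d: "f differentiable at x" "g differentiable at x" for x by auto
  have "partial i (\<lambda>x. f x + g x) = (\<lambda>x. partial i f x + partial i g x)" for i
    by (rule ext, subst partial_eq, rule has_derivative_add[OF has_derivative_frechet[OF d(1)] has_derivative_frechet[OF d(2)]])
       (simp add: partial_def)
  with Suc d show ?case by (auto intro: differentiable_add)
qed (auto intro: continuous_on_add)

lemma C_k_mult: "C_k k f \<Longrightarrow> C_k k g \<Longrightarrow> C_k k (\<lambda>x. f x * g x)"
proof (induction k arbitrary: f g)
  case (Suc k)
  then have d: "f differentiable at x" "g differentiable at x" for x by auto
  have eq: "partial i (\<lambda>x. f x * g x) = (\<lambda>x. f x * partial i g x + partial i f x * g x)" for i
    by (rule ext, subst partial_eq, rule has_derivative_mult[OF has_derivative_frechet[OF d(1)] has_derivative_frechet[OF d(2)]])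
       (simp add: partial_def)
  have "C_k k (partial i (\<lambda>x. f x * g x))" for i
    unfolding eq using Suc C_k_SucD by (intro C_k_add Suc.IH) auto
  with d show ?case by (auto intro: differentiable_mult)
qed (auto intro: continuous_on_mult)

lemma C_k_cnj: "C_k k f \<Longrightarrow> C_k k (\<lambda>x. cnj (f x))"
proof (induction k arbitrary: f)
  case (Suc k)
  then have d: "f differentiable at x" for x by auto
  have D: "((\<lambda>x. cnj (f x)) has_derivative (\<lambda>v. cnj (frechet_derivative f (at x) v))) (at x)" for x
    by (rule bounded_linear.has_derivative[OF bounded_linear_cnj has_derivative_frechet[OF d]])
  have "partial i (\<lambda>x. cnj (f x)) = (\<lambda>x. cnj (partial i f x))" for i
    by (rule ext, subst partial_eq, rule D) (simp add: partial_def)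
  with Suc D show ?case unfolding C_k.simps differentiable_def by auto
qed (auto intro: continuous_on_cnj)

definition smooth :: "(real^2 \<Rightarrow> complex) \<Rightarrow> bool" where
  "smooth f \<longleftrightarrow> (\<forall>k. C_k k f)"

lemma smooth_differentiable: "smooth f \<Longrightarrow> f differentiable at x"
  unfolding smooth_def by (metis C_k.simps(2))

lemma smooth_continuous: "smooth f \<Longrightarrow> continuous_on S f"
  unfolding smooth_def by (metis C_k.simps(1) continuous_on_subset subset_UNIV)

lemma smooth_partial: "smooth f \<Longrightarrow> smooth (partial i f)"
  unfolding smooth_def by (metis C_k.simps(2))

lemma smooth_const: "smooth (\<lambda>x. c)" and smooth_linear: "bounded_linear f \<Longrightarrow> smooth f"
  by (simp_all add: smooth_def C_k_const C_k_linear)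

lemma smooth_add: "smooth f \<Longrightarrow> smooth g \<Longrightarrow> smooth (\<lambda>x. f x + g x)"
  and smooth_mult: "smooth f \<Longrightarrow> smooth g \<Longrightarrow> smooth (\<lambda>x. f x * g x)"
  and smooth_cnj: "smooth f \<Longrightarrow> smooth (\<lambda>x. cnj (f x))"
  by (simp_all add: smooth_def C_k_add C_k_mult C_k_cnj)

lemma smooth_diff: "smooth f \<Longrightarrow> smooth g \<Longrightarrow> smooth (\<lambda>x. f x - g x)"
  using smooth_add[of f "\<lambda>x. (-1) * g x"] smooth_mult[OF smooth_const[of "-1"], of g] by simp

lemma smooth_power: "smooth f \<Longrightarrow> smooth (\<lambda>x. f x ^ n)"
  by (induction n) (auto intro: smooth_const smooth_mult)

lemma smooth_prod: "(\<And>i. i \<in> I \<Longrightarrow> smooth (f i)) \<Longrightarrow> smooth (\<lambda>x. \<Prod>i\<in>I. f i x)"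
  by (induction I rule: infinite_finite_induct) (auto intro: smooth_const smooth_mult)

lemma smooth_coordinate: "smooth (\<lambda>x. of_real (x $ i))"
  by (rule smooth_linear) (intro bounded_linear_compose[OF bounded_linear_of_real] bounded_linear_vec_nth)

lemma partial_mult: "smooth f \<Longrightarrow> smooth g \<Longrightarrow>
    partial i (\<lambda>x. f x * g x) x = f x * partial i g x + partial i f x * g x"
  using partial_eq[OF has_derivative_mult[OF has_derivative_frechet has_derivative_frechet], of f x g i]
  by (simp add: smooth_differentiable partial_def)

lemma partial_const: "partial i (\<lambda>x. c) x = 0"
  by (subst partial_eq) auto

lemma partial_cnj:
  assumes "smooth f"
  shows "partial i (\<lambda>x. cnj (f x)) x = cnj (partial i f x)"
  using partial_eq[OF bounded_linear.has_derivative[OF bounded_linear_cnj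
      has_derivative_frechet[OF smooth_differentiable[OF assms]]], of i x]
  by (simp add: partial_def)

lemma partial_coordinate: "partial i (\<lambda>x. of_real (x $ j)) x = (if i = j then 1 else 0)"
proof -
  have "bounded_linear (\<lambda>x :: real^2. complex_of_real (x $ j))"
    by (intro bounded_linear_compose[OF bounded_linear_of_real] bounded_linear_vec_nth)
  from partial_eq[OF bounded_linear_imp_has_derivative[OF this], of i x]
  show ?thesis by (simp add: axis_def)
qed


section \<open>Bump functions and the fundamental lemma of the calculus of variations\<close>

text \<open>The functions \<open>t\<^sup>-\<^sup>m exp (- 1 / t)\<close> arise from \<open>m = 0\<close> by differentiation; together they are
  closed under differentiation, up to linear combinations.\<close>

definition flat :: "nat \<Rightarrow> real \<Rightarrow> real" where
  "flat m t = (if t > 0 then exp (- (1 / t)) / t ^ m else 0)"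

text \<open>The bound, from \<open>exp s \<ge> (s / n)\<^sup>n\<close> with \<open>s = 1 / t\<close> and \<open>n = m + 2\<close>, makes the derivative at 0 vanish.\<close>

lemma flat_le: "\<bar>flat m t\<bar> \<le> real (m + 2) ^ (m + 2) * t\<^sup>2"
proof (cases "t > 0")
  case True
  define n where "n = m + 2"
  have n: "n > 0" by (simp add: n_def)
  have "(1 / t / real n) ^ n \<le> (1 + 1 / t / real n) ^ n" using True by (intro power_mono) auto
  also have "\<dots> \<le> exp (1 / t)"
    by (rule exp_ge_one_plus_x_over_n_power_n) (use True n in \<open>auto intro: order_trans[of _ 0]\<close>)
  finally have "1 \<le> exp (1 / t) * (real n ^ n * t ^ n)"
    using True n by (simp add: power_divide field_simps)
  then have "exp (- (1 / t)) \<le> real n ^ n * t ^ n"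
    by (simp add: exp_minus field_simps)
  moreover have "t ^ n = t\<^sup>2 * t ^ m" by (simp only: n_def power_add mult.commute)
  ultimately have "exp (- (1 / t)) \<le> (real n ^ n * t\<^sup>2) * t ^ m" by (simp only: mult.assoc)
  then have "exp (- (1 / t)) / t ^ m \<le> real n ^ n * t\<^sup>2"
    using True by (simp add: pos_divide_le_eq)
  then show ?thesis using True by (simp add: flat_def n_def)
qed (simp add: flat_def)

lemma flat_has_derivative:
  "(flat m has_field_derivative flat (m + 2) t - real m * flat (m + 1) t) (at t)"
proof -
  consider "t > 0" | "t < 0" | "t = 0" by linarith
  then show ?thesis
  proof cases
    case 1
    have "((\<lambda>t. exp (- (1 / t)) / t ^ m) has_field_derivative flat (m + 2) t - real m * flat (m + 1) t) (at t)"
    proof (cases m)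
      case 0
      then show ?thesis using 1
        by (auto intro!: derivative_eq_intros simp: flat_def power2_eq_square field_simps)
    next
      case (Suc k)
      then show ?thesis using 1
        by (auto intro!: derivative_eq_intros simp: flat_def power2_eq_square field_simps)
           (cases k, auto)
    qed
    then show ?thesis
      by (rule has_field_derivative_transform_within_open[where S = "{0<..}"]) (use 1 in \<open>auto simp: flat_def\<close>)
  next
    case 2
    have "((\<lambda>t. 0) has_field_derivative flat (m + 2) t - real m * flat (m + 1) t) (at t)"
      using 2 by (simp add: flat_def)
    then show ?thesis
      by (rule has_field_derivative_transform_within_open[where S = "{..<0}"]) (use 2 in \<open>auto simp: flat_def\<close>)
  next
    case 3
    define K where "K = real (m + 2) ^ (m + 2)"
    have "((\<lambda>h. (flat m (0 + h) - flat m 0) / h) \<longlongrightarrow> 0) (at 0)"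
    proof (rule Lim_null_comparison)
      show "\<forall>\<^sub>F h in at 0. norm ((flat m (0 + h) - flat m 0) / h) \<le> K * \<bar>h\<bar>"
        unfolding eventually_at_filter
      proof (intro always_eventually allI impI)
        fix h :: real assume "h \<noteq> 0"
        then show "norm ((flat m (0 + h) - flat m 0) / h) \<le> K * \<bar>h\<bar>"
          using flat_le[of m h] unfolding K_def
          by (simp add: flat_def[of _ 0] divide_le_eq power2_eq_square mult_ac abs_mult_self_eq)
      qed
      have "((\<lambda>h. K * \<bar>h\<bar>) \<longlongrightarrow> K * \<bar>0 :: real\<bar>) (at 0)" by (intro tendsto_intros)
      then show "((\<lambda>h. K * \<bar>h\<bar>) \<longlongrightarrow> 0) (at (0 :: real))" by simp
    qed
    then show ?thesis using 3 by (simp add: DERIV_def flat_def[of _ 0])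
  qed
qed

lemma C_k_flat: "C_k k (\<lambda>x :: real^2. of_real (flat m (r - (norm (x - c))\<^sup>2)))"
proof (induction k arbitrary: m)
  case (0 m)
  have "continuous_on UNIV (flat m)"
    using flat_has_derivative DERIV_isCont by (blast intro: continuous_at_imp_continuous_on)
  then have "continuous_on UNIV (\<lambda>x :: real^2. flat m (r - (norm (x - c))\<^sup>2))"
    by (rule continuous_on_compose2) (auto intro!: continuous_intros)
  then show ?case by (auto intro: continuous_on_of_real)
next
  case (Suc k m)
  define q where "q x = r - (norm (x - c))\<^sup>2" for x :: "real^2"
  define d where "d x = flat (m + 2) (q x) - real m * flat (m + 1) (q x)" for x
  have qd: "(q has_derivative (\<lambda>v. - 2 * ((x - c) \<bullet> v))) (at x)" for x
    unfolding q_def power2_norm_eq_inner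
    by (auto intro!: derivative_eq_intros simp: inner_commute algebra_simps)
  have "((\<lambda>x. flat m (q x)) has_derivative (\<lambda>v. d x * (- 2 * ((x - c) \<bullet> v)))) (at x)" for x
    using has_derivative_compose[OF qd[of x] flat_has_derivative[of m "q x", unfolded has_field_derivative_def]]
    by (simp add: d_def)
  then have D: "((\<lambda>x. complex_of_real (flat m (q x))) has_derivative
      (\<lambda>v. of_real (d x * (- 2 * ((x - c) \<bullet> v))))) (at x)" for x
    by (rule bounded_linear.has_derivative[OF bounded_linear_of_real])
  have "partial i (\<lambda>x. complex_of_real (flat m (q x))) = (\<lambda>x.
      (of_real (flat (m + 2) (q x)) + of_real (- real m) * of_real (flat (m + 1) (q x)))
      * (of_real (- 2) * (of_real (x $ i) + of_real (- (c $ i)))))" for i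
    by (rule ext, subst partial_eq[OF D]) (simp add: d_def inner_axis algebra_simps)
  moreover have "C_k k (\<lambda>x.
      (of_real (flat (m + 2) (q x)) + of_real (- real m) * of_real (flat (m + 1) (q x)))
      * (of_real (- 2) * (of_real (x $ i) + of_real (- (c $ i)))))" for i
    using smooth_coordinate[unfolded smooth_def]
    by (intro C_k_mult C_k_add C_k_const Suc[folded q_def]) auto
  ultimately have "C_k (Suc k) (\<lambda>x. of_real (flat m (q x)))"
    using D unfolding C_k.simps differentiable_def by metis
  then show ?case by (simp add: q_def)
qed

definition bump :: "real^2 \<Rightarrow> real \<Rightarrow> real^2 \<Rightarrow> real" where
  "bump c r x = flat 0 (r\<^sup>2 - (norm (x - c))\<^sup>2)"

lemma smooth_bump: "smooth (\<lambda>x. of_real (bump c r x))"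
  by (simp add: smooth_def bump_def C_k_flat)

lemma bump_bounds: "0 \<le> bump c r x" "bump c r x \<le> 1"
  by (auto simp: bump_def flat_def)

lemma bump_pos_iff: "r > 0 \<Longrightarrow> bump c r x > 0 \<longleftrightarrow> x \<in> ball c r"
proof -
  assume r: "r > 0"
  have "(norm (x - c))\<^sup>2 < r\<^sup>2 \<longleftrightarrow> norm (x - c) < r"
    using power2_less_imp_less[of "norm (x - c)" r] power_strict_mono[of "norm (x - c)" r 2] r by auto
  then show ?thesis by (simp add: bump_def flat_def dist_norm norm_minus_commute[of c])
qed

lemma test_functions_iff:
  "\<phi> \<in> test_functions D \<longleftrightarrow> smooth \<phi> \<and> compact (closure {x. \<phi> x \<noteq> 0}) \<and> closure {x. \<phi> x \<noteq> 0} \<subseteq> D"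
  by (simp add: test_functions_def smooth_def)

lemma zero_outside_support: "x \<notin> closure {x. \<phi> x \<noteq> 0} \<Longrightarrow> \<phi> x = 0"
  using closure_subset[of "{x. \<phi> x \<noteq> 0}"] by auto

lemma test_functionI:
  assumes "smooth \<phi>" "compact K" "K \<subseteq> D" "\<And>x. x \<notin> K \<Longrightarrow> \<phi> x = 0"
  shows "\<phi> \<in> test_functions D"
proof -
  have "closure {x. \<phi> x \<noteq> 0} \<subseteq> K"
    using assms by (intro closure_minimal compact_imp_closed) auto
  moreover from this have "compact (closure {x. \<phi> x \<noteq> 0})"
    using assms(2) by (metis closed_closure compact_Int_closed inf.absorb_iff2)
  ultimately show ?thesis using assms by (auto simp: test_functions_iff)
qed

lemma test_function_smooth: "\<phi> \<in> test_functions D \<Longrightarrow> smooth \<phi>"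
  by (simp add: test_functions_iff)

lemma test_function_combination:
  assumes "\<phi> \<in> test_functions D" "\<psi> \<in> test_functions D"
  shows "(\<lambda>x. c * \<phi> x + \<psi> x) \<in> test_functions D"
proof (rule test_functionI)
  show "smooth (\<lambda>x. c * \<phi> x + \<psi> x)"
    using assms by (intro smooth_add smooth_mult smooth_const) (simp_all only: test_functions_iff)
  show "compact (closure {x. \<phi> x \<noteq> 0} \<union> closure {x. \<psi> x \<noteq> 0})"
    using assms unfolding test_functions_iff by (simp add: compact_Un)
  show "closure {x. \<phi> x \<noteq> 0} \<union> closure {x. \<psi> x \<noteq> 0} \<subseteq> D"
    using assms unfolding test_functions_iff by (simp add: compact_Un)
  fix x assume "x \<notin> closure {x. \<phi> x \<noteq> 0} \<union> closure {x. \<psi> x \<noteq> 0}"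
  then show "c * \<phi> x + \<psi> x = 0"
    using zero_outside_support[of x \<phi>] zero_outside_support[of x \<psi>] by simp
qed

lemma test_function_mult:
  assumes "\<phi> \<in> test_functions D" "smooth g"
  shows "(\<lambda>x. \<phi> x * g x) \<in> test_functions D"
proof (rule test_functionI)
  show "smooth (\<lambda>x. \<phi> x * g x)"
    using assms by (intro smooth_mult) (simp_all only: test_functions_iff)
  fix x assume "x \<notin> closure {x. \<phi> x \<noteq> 0}"
  then show "\<phi> x * g x = 0" using zero_outside_support[of x \<phi>] by simp
qed (use assms in \<open>simp_all add: test_functions_iff\<close>)

lemma test_function_cnj:
  assumes "\<phi> \<in> test_functions D"
  shows "(\<lambda>x. cnj (\<phi> x)) \<in> test_functions D"
  using assms by (simp add: test_functions_iff smooth_cnj)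

lemma test_function_zero: "(\<lambda>x. 0) \<in> test_functions D"
  by (rule test_functionI[of _ "{}"]) (auto intro: smooth_const)

lemma partial_eq_0_outside_support:
  assumes "x \<notin> closure {x. \<phi> x \<noteq> 0}"
  shows "partial i \<phi> x = 0"
proof -
  have "((\<lambda>x. 0) has_derivative (\<lambda>x. 0)) (at x)" by simp
  then have "(\<phi> has_derivative (\<lambda>x. 0)) (at x)"
  proof (rule has_derivative_transform_within_open)
    show "0 = \<phi> y" if "y \<in> - closure {x. \<phi> x \<noteq> 0}" for y
      using zero_outside_support[of y \<phi>] that by simp
  qed (use assms in auto)
  from partial_eq[OF this] show ?thesis by simp
qed

lemma partial_test_function:
  assumes "\<phi> \<in> test_functions D"
  shows "partial i \<phi> \<in> test_functions D"
  by (rule test_functionI[of _ "closure {x. \<phi> x \<noteq> 0}"])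
     (use assms in \<open>auto simp: test_functions_iff smooth_partial partial_eq_0_outside_support\<close>)

lemma test_function_bounded:
  assumes "\<phi> \<in> test_functions D"
  shows "\<exists>B. \<forall>x. cmod (\<phi> x) \<le> B"
proof -
  let ?K = "closure {x. \<phi> x \<noteq> 0}"
  have "compact (\<phi> ` ?K)"
    using assms by (intro compact_continuous_image smooth_continuous) (auto simp: test_functions_iff)
  then obtain B where B: "\<And>x. x \<in> ?K \<Longrightarrow> cmod (\<phi> x) \<le> B"
    using compact_imp_bounded[of "\<phi> ` ?K"] unfolding bounded_iff by blast
  have "cmod (\<phi> x) \<le> max B 0" for x
    using B[of x] closure_subset[of "{x. \<phi> x \<noteq> 0}"] by (cases "\<phi> x = 0") auto
  then show ?thesis by blast
qed

text \<open>Let \<open>b\<^sub>k\<close> be bump functions for countably many balls that cover \<open>U\<close> and whose closures lie in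
  \<open>U\<close>. Then \<open>1 - (\<Prod>k<n. (1 - b\<^sub>k)\<^sup>n)\<close> is supported in finitely many of these closed balls, vanishes off
  \<open>U\<close>, and tends to 1 at every point where some \<open>b\<^sub>k\<close> is positive.\<close>

lemma indicator_limit_of_test_functions:
  fixes U :: "(real^2) set"
  assumes "open U" "U \<subseteq> D"
  shows "\<exists>\<phi>. (\<forall>n. \<phi> n \<in> test_functions D) \<and> (\<forall>n x. cmod (\<phi> n x) \<le> 1) \<and>
    (\<forall>x. (\<lambda>n. \<phi> n x) \<longlonglongrightarrow> of_real (indicator U x))"
proof (cases "U = {}")
  case True
  then show ?thesis by (intro exI[of _ "\<lambda>n x. 0"]) (auto simp: test_function_zero)
next
  case False
  define F where "F = {ball c r | c r. r > 0 \<and> cball c r \<subseteq> U}"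
  have "\<And>S. S \<in> F \<Longrightarrow> open S" by (auto simp: F_def)
  from Lindelof[OF this] obtain F' where F': "F' \<subseteq> F" "countable F'" "\<Union>F' = \<Union>F" by blast
  have UF: "\<Union>F = U"
  proof
    show "\<Union>F \<subseteq> U"
      unfolding F_def by (rule Union_least) (use ball_subset_cball in \<open>auto intro: order_trans\<close>)
    show "U \<subseteq> \<Union>F"
    proof
      fix x assume "x \<in> U"
      then obtain e where "e > 0" "cball x e \<subseteq> U" using assms(1) open_contains_cball by blast
      then show "x \<in> \<Union>F" unfolding F_def by (auto intro!: exI[of _ "ball x e"] centre_in_ball[THEN iffD2])
    qed
  qed
  have "F' \<noteq> {}" using False F'(3) UF by auto
  then have mem: "from_nat_into F' k \<in> F" for k
    by (rule subsetD[OF F'(1) from_nat_into])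
  have "\<forall>k. \<exists>c r. from_nat_into F' k = ball c r \<and> r > 0 \<and> cball c r \<subseteq> U"
    using mem unfolding F_def by blast
  then obtain c r where cr: "\<And>k. from_nat_into F' k = ball (c k) (r k)" "\<And>k. r k > 0"
    "\<And>k. cball (c k) (r k) \<subseteq> U" by metis
  have cover: "\<exists>k. x \<in> ball (c k) (r k)" if "x \<in> U" for x
  proof -
    have "x \<in> \<Union>F'" using that by (simp only: UF F'(3))
    then obtain S where S: "S \<in> F'" "x \<in> S" by (rule UnionE)
    obtain k where "from_nat_into F' k = S" using from_nat_into_surj[OF F'(2) S(1)] by (rule exE)
    with S(2) cr(1)[of k] show ?thesis by auto
  qed
  define b where "b k = bump (c k) (r k)" for k
  have b: "0 \<le> b k x" "b k x \<le> 1" for k x by (simp_all add: b_def bump_bounds)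
  have b_pos: "b k x > 0 \<longleftrightarrow> x \<in> ball (c k) (r k)" for k x
    using bump_pos_iff[OF cr(2)] by (simp add: b_def)
  define p where "p n x = (\<Prod>k<n. (1 - b k x) ^ n)" for n :: nat and x
  have p01: "0 \<le> p n x" "p n x \<le> 1" for n x
    unfolding p_def using b by (auto intro!: prod_nonneg prod_le_1 power_le_one)
  define \<phi> where "\<phi> n x = complex_of_real (1 - p n x)" for n x
  have b0: "b k x = 0" if "x \<notin> ball (c k) (r k)" for k x
    using b_pos[of k x] b(1)[of k x] that by simp
  have "\<phi> n \<in> test_functions D" for n
  proof (rule test_functionI)
    have "smooth (\<lambda>x. 1 - (\<Prod>k<n. (1 - complex_of_real (b k x)) ^ n))"
      unfolding b_def by (intro smooth_diff smooth_const smooth_prod smooth_power smooth_bump)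
    moreover have "\<phi> n = (\<lambda>x. 1 - (\<Prod>k<n. (1 - complex_of_real (b k x)) ^ n))"
      by (rule ext) (simp add: \<phi>_def p_def)
    ultimately show "smooth (\<phi> n)" by simp
    show "compact (\<Union>k<n. cball (c k) (r k))" by (intro compact_UN) auto
    show "(\<Union>k<n. cball (c k) (r k)) \<subseteq> D" using cr(3) assms(2) by blast
    fix x assume "x \<notin> (\<Union>k<n. cball (c k) (r k))"
    then have "x \<notin> ball (c k) (r k)" if "k < n" for k using that ball_subset_cball by blast
    then have "b k x = 0" if "k < n" for k using b0 that by blast
    then show "\<phi> n x = 0" by (simp add: \<phi>_def p_def)
  qed
  moreover have "cmod (\<phi> n x) \<le> 1" for n x
    using p01[of n x] unfolding \<phi>_def norm_of_real by linarith
  moreover have "(\<lambda>n. \<phi> n x) \<longlonglongrightarrow> of_real (indicator U x)" for x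
  proof (cases "x \<in> U")
    case True
    then obtain k where k: "x \<in> ball (c k) (r k)" using cover by blast
    have le: "p n x \<le> (1 - b k x) ^ n" if "n > k" for n
    proof -
      have "p n x = (1 - b k x) ^ n * (\<Prod>j\<in>{..<n} - {k}. (1 - b j x) ^ n)"
        unfolding p_def using that by (subst prod.remove[of _ k]) auto
      also have "\<dots> \<le> (1 - b k x) ^ n * 1"
        using b by (intro mult_left_mono prod_le_1) (auto intro!: power_le_one)
      finally show ?thesis by simp
    qed
    have lim: "(\<lambda>n. (1 - b k x) ^ n) \<longlonglongrightarrow> 0"
      using b_pos[of k x] k b by (intro LIMSEQ_realpow_zero) auto
    have "(\<lambda>n. p n x) \<longlonglongrightarrow> 0"
      by (rule tendsto_sandwich[OF _ _ tendsto_const lim])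
         (use p01 le in \<open>auto intro!: eventually_sequentiallyI[of "Suc k"]\<close>)
    then have "(\<lambda>n. complex_of_real (1 - p n x)) \<longlonglongrightarrow> of_real (1 - 0)" by (intro tendsto_intros)
    then show ?thesis using True by (simp add: \<phi>_def)
  next
    case False
    have "x \<notin> ball (c k) (r k)" for k using False cr(3)[of k] ball_subset_cball by blast
    then show ?thesis using False b0 by (simp add: \<phi>_def p_def)
  qed
  ultimately show ?thesis by blast
qed

context bounded_domain
begin

lemma test_function_L2: "\<phi> \<in> test_functions D \<Longrightarrow> \<phi> \<in> L2 D"
proof -
  assume phi: "\<phi> \<in> test_functions D"
  then obtain B where "\<And>x. cmod (\<phi> x) \<le> B" using test_function_bounded by blast
  moreover have "\<phi> \<in> borel_measurable M"
    using phi by (intro continuous_imp_measurable_on_sets_lebesgue smooth_continuous)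
                 (auto simp: test_functions_iff)
  ultimately show ?thesis using L2_bounded by blast
qed

text \<open>It suffices that the integral of \<open>g\<close> over every measurable set vanishes. Indicators of open sets
  are bounded limits of test functions, and up to null sets every measurable set is the intersection of a decreasing
  sequence of open sets, so that dominated convergence applies twice.\<close>

lemma fundamental_lemma:
  assumes g: "g \<in> L2 D" and zero: "\<And>\<phi>. \<phi> \<in> test_functions D \<Longrightarrow> (LINT x|M. g x * \<phi> x) = 0"
  shows "AE x in M. g x = 0"
proof (rule M.density_zero)
  show int: "integrable M g" using L1_le_l2_norm g by blast
  have [measurable]: "g \<in> borel_measurable M" using g by (rule L2_measurable)
  have dom: "(LINT x|M. g x * f x) = 0"
    if "\<And>n. (LINT x|M. g x * \<phi> n x) = 0" "\<And>n. \<phi> n \<in> borel_measurable M" "f \<in> borel_measurable M"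
      "\<And>n x. cmod (\<phi> n x) \<le> 1" "AE x in M. (\<lambda>n. \<phi> n x) \<longlonglongrightarrow> f x" for \<phi> f
  proof -
    have [measurable]: "\<phi> n \<in> borel_measurable M" "f \<in> borel_measurable M" for n using that by auto
    have "(\<lambda>n. LINT x|M. g x * \<phi> n x) \<longlonglongrightarrow> (LINT x|M. g x * f x)"
    proof (rule integral_dominated_convergence)
      show "integrable M (\<lambda>x. cmod (g x))" using int by simp
      show "AE x in M. (\<lambda>n. g x * \<phi> n x) \<longlonglongrightarrow> g x * f x"
        using that(5) by eventually_elim (intro tendsto_intros)
      show "AE x in M. norm (g x * \<phi> n x) \<le> cmod (g x)" for n
        using that(4) by (auto simp: norm_mult intro!: mult_right_le_one_le AE_I2)
    qed measurable
    then show ?thesis using that(1) by (simp add: LIMSEQ_const_iff)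
  qed
  have meas_open: "(\<lambda>x. complex_of_real (indicator U x)) \<in> borel_measurable M" if "U \<in> sets lebesgue" for U
    by (rule measurable_restrict_space1) (use that in measurable)
  have open_zero: "(LINT x|M. g x * of_real (indicator U x)) = 0" if U: "open U" "U \<subseteq> D" for U
  proof -
    obtain \<phi> where phi: "\<And>n. \<phi> n \<in> test_functions D" "\<And>n x. cmod (\<phi> n x) \<le> 1"
      "\<And>x. (\<lambda>n. \<phi> n x) \<longlonglongrightarrow> of_real (indicator U x)"
      using indicator_limit_of_test_functions[OF U] by blast
    show ?thesis
    proof (rule dom[of \<phi>])
      show "(\<lambda>x. complex_of_real (indicator U x)) \<in> borel_measurable M"
        by (rule meas_open) (use U in simp)
    qed (rule zero L2_measurable test_function_L2 phi AE_I2)+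
  qed
  fix A assume A: "A \<in> sets M"
  then have A': "A \<in> sets lebesgue" "A \<subseteq> D" by (auto simp: sets_restrict_space)
  obtain C T where C: "gdelta C" "T \<in> null_sets lebesgue" "A \<union> T = C" using lebesgue_set_almost_gdelta[OF A'(1)] by metis
  obtain F :: "nat \<Rightarrow> (real^2) set" where F: "\<And>n. open (F n)" "C = (\<Inter>n. F n)"
    using C(1) by (auto elim: gdelta.cases)
  define U where "U n = D \<inter> (\<Inter>k\<le>n. F k)" for n
  have U: "open (U n)" "U n \<subseteq> D" for n unfolding U_def using F D_open by auto
  have "(LINT x|M. g x * of_real (indicator A x)) = 0"
  proof (rule dom[of "\<lambda>n x. of_real (indicator (U n) x)"])
    show "AE x in M. (\<lambda>n. complex_of_real (indicator (U n) x)) \<longlonglongrightarrow> of_real (indicator A x)"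
    proof -
      have "AE x in lebesgue. x \<notin> T" using C(2) by (rule AE_not_in)
      then have "AE x in M. x \<notin> T" by (subst AE_restrict_space_iff) auto
      then show ?thesis
      proof (rule AE_mp, intro AE_I2 impI)
        fix x assume x: "x \<in> space M" "x \<notin> T"
        show "(\<lambda>n. complex_of_real (indicator (U n) x)) \<longlonglongrightarrow> of_real (indicator A x)"
        proof (cases "x \<in> A")
          case True
          then have "x \<in> U n" for n using C(3) F(2) A' by (auto simp: U_def)
          with True show ?thesis by simp
        next
          case False
          then have "x \<notin> C" using x C(3) by auto
          then obtain k where "x \<notin> F k" using F(2) by auto
          then have "\<forall>n\<ge>k. complex_of_real (indicator (U n) x) = 0" by (auto simp: U_def indicator_def)
          then show ?thesis using False by (intro tendsto_eventually) (auto simp: eventually_sequentially)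
        qed
      qed
    qed
  qed (use U open_zero meas_open A' in \<open>auto simp: indicator_def\<close>)
  then show "set_lebesgue_integral M A g = 0"
    by (simp add: set_lebesgue_integral_def scaleR_conv_of_real mult.commute)
qed

end

section \<open>Weak gradients\<close>

lemma smooth_difference_bound:
  assumes "smooth \<psi>" and B: "\<And>x. cmod (partial i \<psi> x) \<le> B"
  shows "cmod (\<psi> (x + t *\<^sub>R axis i 1) - \<psi> x) \<le> B * \<bar>t\<bar>"
proof -
  define g where "g s = \<psi> (x + s *\<^sub>R axis i 1)" for s
  have d: "(g has_derivative (\<lambda>s. s *\<^sub>R partial i \<psi> (x + a *\<^sub>R axis i 1))) (at a)" for a
  proof -
    have D: "(\<psi> has_derivative frechet_derivative \<psi> (at (x + a *\<^sub>R axis i 1))) (at (x + a *\<^sub>R axis i 1))"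
      using assms(1) by (intro has_derivative_frechet smooth_differentiable)
    have "((\<lambda>s. x + s *\<^sub>R axis i 1) has_derivative (\<lambda>s. s *\<^sub>R axis i 1)) (at a)"
      by (auto intro!: derivative_eq_intros)
    from has_derivative_compose[OF this D]
    show ?thesis
      unfolding g_def partial_def linear_cmul[OF has_derivative_linear[OF D]] .
  qed
  have "norm (g t - g 0) \<le> B * norm (t - 0)"
  proof (rule differentiable_bound)
    show "onorm (\<lambda>s. s *\<^sub>R partial i \<psi> (x + a *\<^sub>R axis i 1)) \<le> B" for a
      using B by (intro onorm_le) (auto simp: mult.commute[of B] intro: mult_left_mono)
    show "(g has_derivative (\<lambda>s. s *\<^sub>R partial i \<psi> (x + a *\<^sub>R axis i 1))) (at a within UNIV)" for a
      using d by simp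
  qed auto
  then show ?thesis by (simp add: g_def)
qed

lemma lborel_integral_translation:
  fixes f :: "'a::euclidean_space \<Rightarrow> complex"
  assumes "f \<in> borel_measurable borel"
  shows "(LINT x|lborel. f (x + a)) = (LINT x|lborel. f x)"
proof -
  have "(LINT x|lborel. f x) = (LINT x|distr lborel borel ((+) a). f x)"
    by (simp add: lborel_distr_plus)
  also have "\<dots> = (LINT x|lborel. f (a + x))"
    by (rule integral_distr) (use assms in auto)
  finally show ?thesis by (simp add: add.commute)
qed

context bounded_domain
begin

text \<open>Functions that vanish off \<open>D\<close> may be integrated over the whole plane, where translation invariance holds.\<close>

lemma LINT_eq_lborel:
  fixes f :: "real^2 \<Rightarrow> complex"
  assumes "continuous_on UNIV f" "\<And>x. x \<notin> D \<Longrightarrow> f x = 0"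
  shows "(LINT x|M. f x) = (LINT x|lborel. f x)"
proof -
  have "(LINT x|M. f x) = (LINT x|lebesgue. indicator D x *\<^sub>R f x)"
    by (rule integral_restrict_space) simp
  also have "\<dots> = (LINT x|lebesgue. f x)"
    by (rule Bochner_Integration.integral_cong) (auto simp: indicator_def assms(2))
  also have "\<dots> = (LINT x|lborel. f x)"
    by (rule integral_completion) (use borel_measurable_continuous_onI[OF assms(1)] in simp)
  finally show ?thesis .
qed

lemma test_function_outside: "\<phi> \<in> test_functions D \<Longrightarrow> x \<notin> D \<Longrightarrow> \<phi> x = 0"
  using zero_outside_support[of x \<phi>] by (auto simp: test_functions_iff)

text \<open>The integral of \<open>\<psi> (x + t e\<^sub>i)\<close> does not depend on \<open>t\<close>; differentiate at \<open>t = 0\<close>.\<close>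

lemma integral_partial_eq_0:
  assumes psi: "\<psi> \<in> test_functions D"
  shows "(LINT x|M. partial i \<psi> x) = 0"
proof -
  have sm: "smooth \<psi>" "smooth (partial i \<psi>)"
    using psi by (auto simp: test_functions_iff smooth_partial)
  note [measurable] = borel_measurable_continuous_onI[OF smooth_continuous[OF sm(1)]]
    borel_measurable_continuous_onI[OF smooth_continuous[OF sm(2)]]
  define e :: "real^2" where "e = axis i 1"
  obtain B where B: "\<And>x. cmod (partial i \<psi> x) \<le> B"
    using test_function_bounded[OF partial_test_function[OF psi]] by blast
  have "B \<ge> 0" using B[of 0] norm_ge_zero order_trans by blast
  obtain R where R: "\<And>x. x \<in> D \<Longrightarrow> norm x \<le> R" using D_bounded unfolding bounded_iff by blast
  define q where "q n x = (\<psi> (x + (1 / real (Suc n)) *\<^sub>R e) - \<psi> x) / of_real (1 / real (Suc n))" for n x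
  have [measurable]: "q n \<in> borel_measurable borel" for n unfolding q_def by measurable
  have psi_int: "integrable lborel \<psi>"
  proof -
    have "integrable lebesgue (\<lambda>x. indicator D x *\<^sub>R \<psi> x)"
      using L1_le_l2_norm(1)[OF test_function_L2[OF psi]] by (simp add: integrable_restrict_space)
    also have "(\<lambda>x. indicator D x *\<^sub>R \<psi> x) = \<psi>"
      using test_function_outside[OF psi] by (auto simp: fun_eq_iff indicator_def)
    finally show ?thesis by (subst (asm) integrable_completion) simp_all
  qed
  have q0: "(LINT x|lborel. q n x) = 0" for n
  proof -
    let ?a = "(1 / real (Suc n)) *\<^sub>R e"
    have "integrable (distr lborel borel ((+) ?a)) \<psi>" using psi_int by (simp add: lborel_distr_plus)
    then have "integrable lborel (\<lambda>x. \<psi> (?a + x))" by (rule integrable_distr[rotated]) simp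
    then have "integrable lborel (\<lambda>x. \<psi> (x + ?a))" by (simp add: add.commute)
    then show ?thesis using psi_int lborel_integral_translation[of \<psi> ?a]
      unfolding q_def by simp
  qed
  have "(\<lambda>n. LINT x|lborel. q n x) \<longlonglongrightarrow> (LINT x|lborel. partial i \<psi> x)"
  proof (rule integral_dominated_convergence)
    show "integrable lborel (\<lambda>x :: real^2. B * indicat_real (cball 0 (R + 1)) x)"
      using emeasure_lborel_cball_finite[of "0 :: real^2" "R + 1"]
      by (intro integrable_mult_right integrable_real_indicator) auto
    show "AE x in lborel. norm (q n x) \<le> B * indicat_real (cball 0 (R + 1)) x" for n
    proof (rule AE_I2)
      fix x :: "real^2"
      show "norm (q n x) \<le> B * indicat_real (cball 0 (R + 1)) x"
      proof (cases "x \<in> cball 0 (R + 1)")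
        case True
        define t where "t = 1 / real (Suc n)"
        have "t > 0" by (simp add: t_def)
        have "cmod (\<psi> (x + t *\<^sub>R e) - \<psi> x) \<le> B * \<bar>t\<bar>"
          unfolding e_def by (rule smooth_difference_bound[OF sm(1) B])
        moreover have "norm (q n x) = cmod (\<psi> (x + t *\<^sub>R e) - \<psi> x) / \<bar>t\<bar>"
          unfolding q_def t_def[symmetric] norm_divide norm_of_real ..
        ultimately have "norm (q n x) \<le> B" using \<open>t > 0\<close> by (simp add: pos_divide_le_eq)
        then show ?thesis using True by simp
      next
        case False
        have "norm (x + (1 / real (Suc n)) *\<^sub>R e) > R"
        proof -
          define w where "w = (1 / real (Suc n)) *\<^sub>R e"
          have "norm w \<le> 1" by (simp add: w_def e_def norm_axis_1)
          moreover have "norm x > R + 1" using False by simp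
          ultimately show ?thesis
            using norm_triangle_ineq4[of "x + w" w] unfolding w_def[symmetric] by simp
        qed
        then have "x + (1 / real (Suc n)) *\<^sub>R e \<notin> D" "x \<notin> D" using R False by force+
        then show ?thesis using test_function_outside[OF psi] False by (simp add: q_def)
      qed
    qed
    show "AE x in lborel. (\<lambda>n. q n x) \<longlonglongrightarrow> partial i \<psi> x"
    proof (rule AE_I2)
      fix x :: "real^2"
      have D: "(\<psi> has_derivative frechet_derivative \<psi> (at x)) (at x)"
        using sm(1) by (intro has_derivative_frechet smooth_differentiable)
      have "((\<lambda>s. x + s *\<^sub>R e) has_derivative (\<lambda>s. s *\<^sub>R e)) (at 0)"
        by (auto intro!: derivative_eq_intros)
      from has_derivative_compose[OF this, of \<psi> "frechet_derivative \<psi> (at x)"] D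
      have "((\<lambda>s. \<psi> (x + s *\<^sub>R e)) has_derivative (\<lambda>s. s *\<^sub>R partial i \<psi> x)) (at 0)"
        by (simp add: partial_def e_def linear_cmul[OF has_derivative_linear[OF D]])
      then have lim: "((\<lambda>s. norm (\<psi> (x + s *\<^sub>R e) - \<psi> x - s *\<^sub>R partial i \<psi> x) / norm s) \<longlongrightarrow> 0) (at 0)"
        by (simp add: has_derivative_at)
      have "((\<lambda>s. (\<psi> (x + s *\<^sub>R e) - \<psi> x) /\<^sub>R s) \<longlongrightarrow> partial i \<psi> x) (at 0)"
      proof (rule LIM_zero_cancel, rule Lim_null_comparison[OF _ lim])
        have eq: "(\<psi> (x + s *\<^sub>R e) - \<psi> x) /\<^sub>R s - partial i \<psi> x
            = (\<psi> (x + s *\<^sub>R e) - \<psi> x - s *\<^sub>R partial i \<psi> x) /\<^sub>R s" if "s \<noteq> 0" for s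
          using that by (simp add: scaleR_right_diff_distrib)
        show "\<forall>\<^sub>F s in at 0. norm ((\<psi> (x + s *\<^sub>R e) - \<psi> x) /\<^sub>R s - partial i \<psi> x)
            \<le> norm (\<psi> (x + s *\<^sub>R e) - \<psi> x - s *\<^sub>R partial i \<psi> x) / norm s"
          unfolding eventually_at_filter
        proof (intro always_eventually allI impI)
          fix s :: real assume "s \<noteq> 0"
          then show "norm ((\<psi> (x + s *\<^sub>R e) - \<psi> x) /\<^sub>R s - partial i \<psi> x)
            \<le> norm (\<psi> (x + s *\<^sub>R e) - \<psi> x - s *\<^sub>R partial i \<psi> x) / norm s"
            by (subst eq) (simp_all add: divide_inverse mult.commute)
        qed
      qed
      moreover have "filterlim (\<lambda>n. 1 / real (Suc n)) (at 0) sequentially"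
        unfolding filterlim_at using LIMSEQ_inverse_real_of_nat by (auto simp: inverse_eq_divide)
      ultimately have "(\<lambda>n. (\<psi> (x + (1 / real (Suc n)) *\<^sub>R e) - \<psi> x) /\<^sub>R (1 / real (Suc n))) \<longlonglongrightarrow> partial i \<psi> x"
        by (rule filterlim_compose)
      then show "(\<lambda>n. q n x) \<longlonglongrightarrow> partial i \<psi> x"
        by (simp add: q_def scaleR_conv_of_real field_simps)
    qed
  qed measurable
  then have "(LINT x|lborel. partial i \<psi> x) = 0" by (simp add: q0 LIMSEQ_const_iff)
  then show ?thesis
    using sm(2) test_function_outside[OF partial_test_function[OF psi]]
    by (subst LINT_eq_lborel) (auto intro: smooth_continuous)
qed

lemma integration_by_parts:
  assumes "\<phi> \<in> test_functions D" "\<psi> \<in> test_functions D"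
  shows "(LINT x|M. \<phi> x * partial i \<psi> x) = - (LINT x|M. partial i \<phi> x * \<psi> x)"
proof -
  have sm: "smooth \<phi>" "smooth \<psi>" using assms by (auto simp: test_functions_iff)
  have "0 = (LINT x|M. partial i (\<lambda>x. \<phi> x * \<psi> x) x)"
    using integral_partial_eq_0[OF test_function_mult[OF assms(1) sm(2)]] by simp
  also have "\<dots> = (LINT x|M. \<phi> x * partial i \<psi> x) + (LINT x|M. partial i \<phi> x * \<psi> x)"
    using L2_mult_integrable test_function_L2 partial_test_function assms
    by (simp add: partial_mult[OF sm])
  finally show ?thesis by (simp add: eq_neg_iff_add_eq_0)
qed

abbreviation wg :: "(real^2 \<Rightarrow> complex) \<Rightarrow> 2 \<Rightarrow> real^2 \<Rightarrow> complex" where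
  "wg u i \<equiv> (\<lambda>x. weak_grad D u x $ i)"

text \<open>Since \<open>weak_grad\<close> chooses one weak gradient for each function, this uniqueness is what makes it linear,
  up to null sets, and equal to the classical gradient on test functions.\<close>

lemma weak_grad_unique:
  assumes "is_weak_grad D u g" "is_weak_grad D u g'"
  shows "AE x in M. g x $ i = g' x $ i"
proof -
  have L: "(\<lambda>x. g x $ i) \<in> L2 D" "(\<lambda>x. g' x $ i) \<in> L2 D"
    using assms by (auto simp: is_weak_grad_def)
  have "AE x in M. g x $ i - g' x $ i = 0"
  proof (rule fundamental_lemma[OF L2_diff[OF L]])
    fix \<phi> assume phi: "\<phi> \<in> test_functions D"
    have "- (LINT x|M. g x $ i * \<phi> x) = - (LINT x|M. g' x $ i * \<phi> x)"
      using assms[unfolded is_weak_grad_def, THEN conjunct2, rule_format, OF phi, of i] by simp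
    then have "(LINT x|M. g x $ i * \<phi> x) = (LINT x|M. g' x $ i * \<phi> x)" by simp
    then show "(LINT x|M. (g x $ i - g' x $ i) * \<phi> x) = 0"
      using L2_mult_integrable[OF _ test_function_L2[OF phi]] L by (simp add: left_diff_distrib)
  qed
  then show ?thesis by simp
qed

lemma weak_grad_works: "is_weak_grad D u g \<Longrightarrow> is_weak_grad D u (weak_grad D u)"
  unfolding weak_grad_def by (rule someI[of "is_weak_grad D u" g])

lemma weak_grad_AE: "is_weak_grad D u g \<Longrightarrow> AE x in M. wg u i x = g x $ i"
  by (rule weak_grad_unique[OF weak_grad_works])

lemma H1_weak_grad: "u \<in> H1 D \<Longrightarrow> is_weak_grad D u (weak_grad D u)"
  by (auto simp: H1_def intro: weak_grad_works)

lemma H1_L2 [simp]: "u \<in> H1 D \<Longrightarrow> u \<in> L2 D"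
  by (simp add: H1_def)

lemma wg_L2 [simp]: "u \<in> H1 D \<Longrightarrow> wg u i \<in> L2 D"
  using H1_weak_grad[of u] by (simp add: is_weak_grad_def)

lemma H1_I: "u \<in> L2 D \<Longrightarrow> is_weak_grad D u g \<Longrightarrow> u \<in> H1 D"
  unfolding H1_def by blast

lemma is_weak_grad_combination:
  assumes "u \<in> L2 D" "v \<in> L2 D" "is_weak_grad D u g" "is_weak_grad D v k"
  shows "is_weak_grad D (\<lambda>x. c * u x + v x) (\<lambda>x. \<chi> i. c * g x $ i + k x $ i)"
  unfolding is_weak_grad_def
proof (intro conjI allI ballI)
  fix i show "(\<lambda>x. (\<chi> i. c * g x $ i + k x $ i) $ i) \<in> L2 D"
    using assms L2_subspace by (simp add: is_weak_grad_def)
next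
  fix \<phi> i assume phi: "\<phi> \<in> test_functions D"
  have L: "\<phi> \<in> L2 D" "partial i \<phi> \<in> L2 D" "(\<lambda>x. g x $ i) \<in> L2 D" "(\<lambda>x. k x $ i) \<in> L2 D"
    using assms phi test_function_L2 partial_test_function by (auto simp: is_weak_grad_def)
  note int = L2_mult_integrable[OF assms(1) L(2)] L2_mult_integrable[OF assms(2) L(2)]
    L2_mult_integrable[OF L(3) L(1)] L2_mult_integrable[OF L(4) L(1)]
  have "(LINT x|M. (c * u x + v x) * partial i \<phi> x)
      = c * (LINT x|M. u x * partial i \<phi> x) + (LINT x|M. v x * partial i \<phi> x)"
    using int by (simp add: ring_distribs mult.assoc)
  also have "\<dots> = - (c * (LINT x|M. g x $ i * \<phi> x) + (LINT x|M. k x $ i * \<phi> x))"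
    using assms(3,4) phi by (simp add: is_weak_grad_def)
  also have "\<dots> = - (LINT x|M. (\<chi> i. c * g x $ i + k x $ i) $ i * \<phi> x)"
    using int by (simp add: ring_distribs mult.assoc)
  finally show "(LINT x|M. (c * u x + v x) * partial i \<phi> x)
      = - (LINT x|M. (\<chi> i. c * g x $ i + k x $ i) $ i * \<phi> x)" .
qed

lemma is_weak_grad_cnj:
  assumes "is_weak_grad D u g"
  shows "is_weak_grad D (\<lambda>x. cnj (u x)) (\<lambda>x. \<chi> i. cnj (g x $ i))"
  unfolding is_weak_grad_def
proof (intro conjI allI ballI)
  fix i show "(\<lambda>x. (\<chi> i. cnj (g x $ i)) $ i) \<in> L2 D"
    using assms L2_cnj by (simp add: is_weak_grad_def)
next
  fix \<phi> i assume phi: "\<phi> \<in> test_functions D"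
  have "(LINT x|M. cnj (u x) * partial i \<phi> x) = cnj (LINT x|M. u x * partial i (\<lambda>x. cnj (\<phi> x)) x)"
    unfolding Bochner_Integration.integral_cnj[symmetric]
    by (simp add: partial_cnj[OF test_function_smooth[OF phi]])
  also have "(LINT x|M. u x * partial i (\<lambda>x. cnj (\<phi> x)) x) = - (LINT x|M. g x $ i * cnj (\<phi> x))"
    using assms test_function_cnj[OF phi] by (simp add: is_weak_grad_def)
  also have "cnj \<dots> = - (LINT x|M. (\<chi> i. cnj (g x $ i)) $ i * \<phi> x)"
    unfolding complex_cnj_minus Bochner_Integration.integral_cnj[symmetric] by simp
  finally show "(LINT x|M. cnj (u x) * partial i \<phi> x) = - (LINT x|M. (\<chi> i. cnj (g x $ i)) $ i * \<phi> x)" .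
qed

lemma is_weak_grad_null:
  assumes "u \<in> L2 D" "AE x in M. u x = 0"
  shows "is_weak_grad D u (\<lambda>x. 0)"
  unfolding is_weak_grad_def
proof (intro conjI allI ballI)
  fix \<phi> i assume phi: "\<phi> \<in> test_functions D"
  note [measurable] = L2_measurable[OF assms(1)]
    L2_measurable[OF test_function_L2[OF partial_test_function[OF phi]]]
  have "(LINT x|M. u x * partial i \<phi> x) = (LINT x|M. 0)"
    by (rule integral_cong_AE) (use assms(2) in auto)
  then show "(LINT x|M. u x * partial i \<phi> x) = - (LINT x|M. (0 :: complex^2) $ i * \<phi> x)" by simp
qed (simp add: L2_zero)

lemma is_weak_grad_test_function:
  assumes "\<phi> \<in> test_functions D"
  shows "is_weak_grad D \<phi> (\<lambda>x. \<chi> i. partial i \<phi> x)"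
  unfolding is_weak_grad_def
  using assms by (auto simp: integration_by_parts intro: test_function_L2 partial_test_function)

lemma H1_combination: "u \<in> H1 D \<Longrightarrow> v \<in> H1 D \<Longrightarrow> (\<lambda>x. c * u x + v x) \<in> H1 D"
  by (rule H1_I[OF _ is_weak_grad_combination]) (auto intro: L2_subspace H1_weak_grad)

lemma wg_combination:
  "u \<in> H1 D \<Longrightarrow> v \<in> H1 D \<Longrightarrow> AE x in M. wg (\<lambda>x. c * u x + v x) i x = c * wg u i x + wg v i x"
  using weak_grad_AE[OF is_weak_grad_combination[of u v _ _ c], of "weak_grad D u" "weak_grad D v" i]
  by (simp add: H1_weak_grad)

lemma H1_cnj: "u \<in> H1 D \<Longrightarrow> (\<lambda>x. cnj (u x)) \<in> H1 D"
  by (rule H1_I[OF _ is_weak_grad_cnj]) (auto intro: L2_cnj H1_weak_grad)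

lemma wg_cnj: "u \<in> H1 D \<Longrightarrow> AE x in M. wg (\<lambda>x. cnj (u x)) i x = cnj (wg u i x)"
  using weak_grad_AE[OF is_weak_grad_cnj, of u "weak_grad D u" i] by (simp add: H1_weak_grad)

lemma H1_zero: "(\<lambda>x. 0) \<in> H1 D"
  by (rule H1_I[OF L2_zero is_weak_grad_null]) (auto simp: L2_zero)

lemma H1_test_function: "\<phi> \<in> test_functions D \<Longrightarrow> \<phi> \<in> H1 D"
  by (rule H1_I[OF test_function_L2 is_weak_grad_test_function])

lemma wg_test_function: "\<phi> \<in> test_functions D \<Longrightarrow> AE x in M. wg \<phi> i x = partial i \<phi> x"
  using weak_grad_AE[OF is_weak_grad_test_function] by simp


section \<open>The space of weakly differentiable functions vanishing on the boundary\<close>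

lemma ip_cong_AE:
  assumes "AE x in M. f x = f' x" "AE x in M. g x = g' x" "f \<in> L2 D" "g \<in> L2 D" "f' \<in> L2 D" "g' \<in> L2 D"
  shows "ip f g = ip f' g'"
proof -
  note [measurable] = L2_measurable[OF assms(3)] L2_measurable[OF assms(4)]
    L2_measurable[OF assms(5)] L2_measurable[OF assms(6)]
  show ?thesis
    unfolding ip_def by (rule integral_cong_AE) (use assms(1,2) in auto)
qed

text \<open>The sesquilinear counterpart of \<open>dirichlet_form\<close>; see \<open>dirichlet_form_cnj\<close>.\<close>

definition energy_ip :: "(real^2 \<Rightarrow> complex) \<Rightarrow> (real^2 \<Rightarrow> complex) \<Rightarrow> complex" where
  "energy_ip u v = (\<Sum>i\<in>UNIV. ip (wg u i) (wg v i))"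

definition H1_ip :: "(real^2 \<Rightarrow> complex) \<Rightarrow> (real^2 \<Rightarrow> complex) \<Rightarrow> complex" where
  "H1_ip u v = ip u v + energy_ip u v"

lemma H1_subspace: "L2.subspace (H1 D)"
  unfolding L2.subspace_def
  using H1_zero H1_combination[of _ _ 1] H1_combination[OF _ H1_zero]
  by (auto simp: plus_fun_def zero_fun_def)

lemma wg_add: "u \<in> H1 D \<Longrightarrow> v \<in> H1 D \<Longrightarrow> AE x in M. wg (u + v) i x = (wg u i + wg v i) x"
  using wg_combination[of u v 1 i] by (simp add: plus_fun_def)

lemma wg_cmul:
  assumes u: "u \<in> H1 D"
  shows "AE x in M. wg (\<lambda>x. c * u x) i x = c * wg u i x"
proof -
  have "AE x in M. wg (\<lambda>x. 0) i x = 0"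
    using weak_grad_AE[OF is_weak_grad_null[OF L2_zero], of i] by simp
  with wg_combination[OF u H1_zero, of c i] show ?thesis by eventually_elim simp
qed

lemma energy_ip_add: "\<lbrakk>u \<in> H1 D; v \<in> H1 D; w \<in> H1 D\<rbrakk> \<Longrightarrow> energy_ip (u + v) w = energy_ip u w + energy_ip v w"
proof -
  assume H: "u \<in> H1 D" "v \<in> H1 D" "w \<in> H1 D"
  have uv: "u + v \<in> H1 D" using H H1_combination[of u v 1] by (simp add: plus_fun_def)
  have "ip (wg (u + v) i) (wg w i) = ip (wg u i) (wg w i) + ip (wg v i) (wg w i)" for i
  proof -
    have "ip (wg (u + v) i) (wg w i) = ip (wg u i + wg v i) (wg w i)"
      by (rule ip_cong_AE[OF wg_add[OF H(1,2)]]) (use H uv in \<open>auto intro: L2_add\<close>)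
    then show ?thesis using H by (simp only: L2.ip_add_left wg_L2)
  qed
  then show ?thesis by (simp add: energy_ip_def sum.distrib)
qed

lemma energy_ip_cmul: "\<lbrakk>u \<in> H1 D; w \<in> H1 D\<rbrakk> \<Longrightarrow> energy_ip (\<lambda>x. c * u x) w = c * energy_ip u w"
proof -
  assume H: "u \<in> H1 D" "w \<in> H1 D"
  have cu: "(\<lambda>x. c * u x) \<in> H1 D" using H1_combination[OF H(1) H1_zero] by simp
  have "ip (wg (\<lambda>x. c * u x) i) (wg w i) = c * ip (wg u i) (wg w i)" for i
  proof -
    have "ip (wg (\<lambda>x. c * u x) i) (wg w i) = ip (\<lambda>x. c * wg u i x) (wg w i)"
      by (rule ip_cong_AE[OF wg_cmul[OF H(1)]]) (use H cu L2_cmul in auto)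
    then show ?thesis using H by (simp only: L2.ip_scale_left wg_L2)
  qed
  then show ?thesis by (simp add: energy_ip_def sum_distrib_left)
qed

sublocale E: semi_inner "\<lambda>c f x. c * f x" "H1 D" energy_ip
proof
  fix u v assume "u \<in> H1 D" "v \<in> H1 D"
  then show "energy_ip u v = cnj (energy_ip v u)"
    unfolding energy_ip_def cnj_sum by (intro sum.cong refl L2.ip_commute) auto
next
  fix u assume "u \<in> H1 D"
  then show "0 \<le> Re (energy_ip u u)"
    unfolding energy_ip_def Re_sum by (intro sum_nonneg L2.ip_ge0) auto
qed (use H1_subspace energy_ip_add energy_ip_cmul in auto)

sublocale S: semi_inner "\<lambda>c f x. c * f x" "H1 D" H1_ip
proof
  fix u v assume "u \<in> H1 D" "v \<in> H1 D"
  then show "H1_ip u v = cnj (H1_ip v u)"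
    unfolding H1_ip_def using L2.ip_commute[of u v] E.ip_commute[of u v] by simp
next
  fix u assume "u \<in> H1 D"
  then show "0 \<le> Re (H1_ip u u)"
    unfolding H1_ip_def using L2.ip_ge0[of u] E.ip_ge0[of u] by simp
qed (use H1_subspace in \<open>auto simp: H1_ip_def L2.ip_add_left E.ip_add_left L2.ip_scale_left E.ip_scale_left ring_distribs\<close>)

lemma energy_nrm_sq: "u \<in> H1 D \<Longrightarrow> (E.nrm u)\<^sup>2 = (\<Sum>i\<in>UNIV. (l2_norm D (wg u i))\<^sup>2)"
  by (simp add: E.nrm_sq) (simp add: energy_ip_def ip_self_eq)

lemma H1_nrm_sq: "u \<in> H1 D \<Longrightarrow> (S.nrm u)\<^sup>2 = (l2_norm D u)\<^sup>2 + (E.nrm u)\<^sup>2"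
  by (simp add: S.nrm_sq E.nrm_sq) (simp add: H1_ip_def ip_self_eq)

lemma H1_norm_eq: "u \<in> H1 D \<Longrightarrow> h1_norm D u = S.nrm u"
  unfolding h1_norm_def using H1_nrm_sq[of u] energy_nrm_sq[of u] S.nrm_ge0[of u]
  by (metis real_sqrt_unique)

lemma energy_nrm_le: "u \<in> H1 D \<Longrightarrow> E.nrm u \<le> S.nrm u"
  by (rule power2_le_imp_le) (auto simp: H1_nrm_sq)

lemma l2_norm_le: "u \<in> H1 D \<Longrightarrow> l2_norm D u \<le> S.nrm u"
  by (rule power2_le_imp_le) (auto simp: H1_nrm_sq)

lemma H1_nrm_le: "u \<in> H1 D \<Longrightarrow> S.nrm u \<le> l2_norm D u + E.nrm u"
  by (rule power2_le_imp_le) (auto simp: H1_nrm_sq power2_sum)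

lemma wg_le_energy: "u \<in> H1 D \<Longrightarrow> l2_norm D (wg u i) \<le> E.nrm u"
proof (rule power2_le_imp_le)
  assume "u \<in> H1 D"
  then show "(l2_norm D (wg u i))\<^sup>2 \<le> (E.nrm u)\<^sup>2"
    unfolding energy_nrm_sq[OF \<open>u \<in> H1 D\<close>] by (intro member_le_sum) auto
qed simp

lemma energy_null: "u \<in> H1 D \<Longrightarrow> AE x in M. u x = 0 \<Longrightarrow> E.nrm u = 0"
proof -
  assume u: "u \<in> H1 D" "AE x in M. u x = 0"
  have "l2_norm D (wg u i) = 0" for i
    using weak_grad_AE[OF is_weak_grad_null[OF H1_L2[OF u(1)] u(2)], of i] u(1)
    by (simp add: l2_norm_eq_0_iff)
  then have "(E.nrm u)\<^sup>2 = 0" using energy_nrm_sq[OF u(1)] by simp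
  then show ?thesis by simp
qed

lemma H10_iff: "u \<in> H10 D \<longleftrightarrow> u \<in> H1 D \<and> (\<forall>e>0. \<exists>\<phi>\<in>test_functions D. S.nrm (u - \<phi>) < e)"
proof -
  have "h1_norm D (\<lambda>x. u x - \<phi> x) = S.nrm (u - \<phi>)" if "u \<in> H1 D" "\<phi> \<in> test_functions D" for \<phi>
    using H1_norm_eq[OF S.V_closed(3)[OF that(1) H1_test_function[OF that(2)]]] by (simp add: fun_diff_def)
  then have "(\<exists>\<phi>\<in>test_functions D. h1_norm D (\<lambda>x. u x - \<phi> x) < e)
      \<longleftrightarrow> (\<exists>\<phi>\<in>test_functions D. S.nrm (u - \<phi>) < e)" if "u \<in> H1 D" for e
    using that by (intro bex_cong) auto
  then show ?thesis by (cases "u \<in> H1 D") (simp_all add: H10_def)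
qed

lemma H10_H1 [simp]: "u \<in> H10 D \<Longrightarrow> u \<in> H1 D"
  by (simp add: H10_iff)

lemma H10_approx:
  assumes "u \<in> H10 D" "e > 0"
  shows "\<exists>\<phi>\<in>test_functions D. S.nrm (u - \<phi>) < e"
  using assms by (simp add: H10_iff)

lemma H10_zero: "(\<lambda>x. 0) \<in> H10 D"
  unfolding H10_iff using H1_zero test_function_zero S.nrm_zero by (metis diff_self zero_fun_def)

lemma H10_combination:
  assumes "u \<in> H10 D" "v \<in> H10 D"
  shows "(\<lambda>x. c * u x + v x) \<in> H10 D"
  unfolding H10_iff
proof (intro conjI allI impI)
  show "(\<lambda>x. c * u x + v x) \<in> H1 D" using assms by (intro H1_combination) auto
  fix e :: real assume e: "e > 0"
  define d where "d = e / 2 / (cmod c + 1)"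
  have c1: "cmod c + 1 > 0" by (simp add: add_nonneg_pos)
  have d: "d > 0" using e c1 by (simp add: d_def)
  obtain \<phi> where phi: "\<phi> \<in> test_functions D" "S.nrm (u - \<phi>) < d" using H10_approx[OF assms(1) d] by blast
  obtain \<psi> where psi: "\<psi> \<in> test_functions D" "S.nrm (v - \<psi>) < e / 2"
    using H10_approx[OF assms(2), of "e / 2"] e by auto
  have H: "u - \<phi> \<in> H1 D" "v - \<psi> \<in> H1 D"
    using assms phi(1) psi(1) H1_test_function by (auto intro!: S.V_closed)
  have "S.nrm ((\<lambda>x. c * (u - \<phi>) x) + (v - \<psi>)) \<le> S.nrm (\<lambda>x. c * (u - \<phi>) x) + S.nrm (v - \<psi>)"
    by (rule S.nrm_triangle[OF S.V_closed(4)[OF H(1)] H(2)])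
  also have "S.nrm (\<lambda>x. c * (u - \<phi>) x) = cmod c * S.nrm (u - \<phi>)" by (rule S.nrm_scale[OF H(1)])
  also have "cmod c * S.nrm (u - \<phi>) \<le> (cmod c + 1) * d"
    using phi(2) H(1) by (intro mult_mono) auto
  also have "(cmod c + 1) * d = e / 2"
    unfolding d_def using nonzero_mult_div_cancel_left[of "cmod c + 1" "e / 2"] c1 by simp
  finally have "S.nrm ((\<lambda>x. c * (u - \<phi>) x) + (v - \<psi>)) < e" using psi(2) by linarith
  also have "(\<lambda>x. c * (u - \<phi>) x) + (v - \<psi>) = (\<lambda>x. c * u x + v x) - (\<lambda>x. c * \<phi> x + \<psi> x)"
    by (auto simp: fun_eq_iff algebra_simps)
  finally show "\<exists>\<phi>\<in>test_functions D. S.nrm ((\<lambda>x. c * u x + v x) - \<phi>) < e"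
    using test_function_combination[OF phi(1) psi(1)] by blast
qed

lemma H10_subspace: "L2.subspace (H10 D)"
  unfolding L2.subspace_def
  using H10_zero H10_combination[of _ _ 1] H10_combination[OF _ H10_zero]
  by (auto simp: plus_fun_def zero_fun_def)

lemma l2_norm_cnj: "l2_norm D (\<lambda>x. cnj (u x)) = l2_norm D u"
  by (simp add: l2_norm_def)

lemma H1_nrm_cnj:
  assumes u: "u \<in> H1 D"
  shows "S.nrm (\<lambda>x. cnj (u x)) = S.nrm u"
proof -
  have "l2_norm D (wg (\<lambda>x. cnj (u x)) i) = l2_norm D (wg u i)" for i
    using l2_norm_cong_AE[OF wg_cnj[OF u]] u H1_cnj L2_cnj by (simp add: l2_norm_cnj)
  then have "(S.nrm (\<lambda>x. cnj (u x)))\<^sup>2 = (S.nrm u)\<^sup>2"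
    using u H1_cnj[OF u] by (simp add: H1_nrm_sq energy_nrm_sq l2_norm_cnj)
  then show ?thesis using u H1_cnj[OF u] by simp
qed

lemma H10_cnj:
  assumes "u \<in> H10 D"
  shows "(\<lambda>x. cnj (u x)) \<in> H10 D"
  unfolding H10_iff
proof (intro conjI allI impI)
  show "(\<lambda>x. cnj (u x)) \<in> H1 D" using assms by (intro H1_cnj) auto
  fix e :: real assume "e > 0"
  then obtain \<phi> where phi: "\<phi> \<in> test_functions D" "S.nrm (u - \<phi>) < e" using H10_approx[OF assms] by blast
  have "u - \<phi> \<in> H1 D" using assms H1_test_function[OF phi(1)] by (auto intro!: S.V_closed)
  from H1_nrm_cnj[OF this] phi(2) have "S.nrm (\<lambda>x. cnj ((u - \<phi>) x)) < e" by simp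
  also have "(\<lambda>x. cnj ((u - \<phi>) x)) = (\<lambda>x. cnj (u x)) - (\<lambda>x. cnj (\<phi> x))" by (auto simp: fun_eq_iff)
  finally show "\<exists>\<phi>\<in>test_functions D. S.nrm ((\<lambda>x. cnj (u x)) - \<phi>) < e"
    using test_function_cnj[OF phi(1)] by blast
qed

lemma dirichlet_form_cnj:
  assumes "u \<in> H1 D" "v \<in> H1 D"
  shows "dirichlet_form D u (\<lambda>x. cnj (v x)) = energy_ip u v"
proof -
  have "dirichlet_form D u (\<lambda>x. cnj (v x)) = (\<Sum>i\<in>UNIV. LINT x|M. wg u i x * wg (\<lambda>x. cnj (v x)) i x)"
    unfolding dirichlet_form_def using assms H1_cnj
    by (intro Bochner_Integration.integral_sum L2_mult_integrable) auto
  also have "\<dots> = energy_ip u v"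
    unfolding energy_ip_def
  proof (rule sum.cong)
    fix i
    note [measurable] = L2_measurable[OF wg_L2[OF assms(1)]] L2_measurable[OF wg_L2[OF assms(2)]]
      L2_measurable[OF wg_L2[OF H1_cnj[OF assms(2)]]]
    show "(LINT x|M. wg u i x * wg (\<lambda>x. cnj (v x)) i x) = ip (wg u i) (wg v i)"
      unfolding ip_def by (rule integral_cong_AE) (use wg_cnj[OF assms(2), of i] in auto)
  qed simp
  finally show ?thesis .
qed

text \<open>For a test function \<open>\<phi>\<close>, integration of \<open>\<partial>\<^sub>1 (x\<^sub>1 \<bar>\<phi>\<bar>\<^sup>2)\<close> gives
  \<open>\<parallel>\<phi>\<parallel>\<^sup>2 = - 2 Re \<langle>x\<^sub>1 \<partial>\<^sub>1 \<phi>, \<phi>\<rangle>\<close>, and \<open>x\<^sub>1\<close> is bounded on \<open>D\<close>.\<close>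

lemma Poincare_test_functions:
  assumes R: "\<And>x. x \<in> D \<Longrightarrow> norm x \<le> R" "R \<ge> 0" and phi: "\<phi> \<in> test_functions D"
  shows "l2_norm D \<phi> \<le> 2 * R * E.nrm \<phi>"
proof -
  define X where "X = (\<lambda>x :: real^2. complex_of_real (x $ 1))"
  define d where "d = partial 1 \<phi>"
  have sm: "smooth \<phi>" "smooth (\<lambda>x. cnj (\<phi> x))" "smooth X"
    using phi by (auto simp: test_functions_iff smooth_cnj X_def smooth_coordinate)
  have L: "\<phi> \<in> L2 D" "d \<in> L2 D"
    using phi unfolding d_def by (auto intro: test_function_L2 partial_test_function)
  have Xd_test: "(\<lambda>x. d x * X x) \<in> test_functions D"
    unfolding d_def by (intro test_function_mult partial_test_function phi sm)
  have Xd: "(\<lambda>x. d x * X x) \<in> L2 D" by (rule test_function_L2[OF Xd_test])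
  have psi: "(\<lambda>x. \<phi> x * (cnj (\<phi> x) * X x)) \<in> test_functions D"
    by (intro test_function_mult phi smooth_mult sm)
  have "0 = (LINT x|M. partial 1 (\<lambda>x. \<phi> x * (cnj (\<phi> x) * X x)) x)"
    using integral_partial_eq_0[OF psi] by simp
  also have "\<dots> = (LINT x|M. \<phi> x * cnj (\<phi> x) + \<phi> x * cnj (d x * X x) + (d x * X x) * cnj (\<phi> x))"
  proof (rule Bochner_Integration.integral_cong)
    fix x
    have "partial 1 X x = 1" unfolding X_def by (simp add: partial_coordinate)
    then show "partial 1 (\<lambda>x. \<phi> x * (cnj (\<phi> x) * X x)) x
        = \<phi> x * cnj (\<phi> x) + \<phi> x * cnj (d x * X x) + (d x * X x) * cnj (\<phi> x)"
      using sm by (simp add: partial_mult smooth_mult partial_cnj d_def algebra_simps) (simp add: X_def)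
  qed simp
  also have "\<dots> = ip \<phi> \<phi> + ip \<phi> (\<lambda>x. d x * X x) + ip (\<lambda>x. d x * X x) \<phi>"
    using L2_mult_integrable[OF L(1) L2_cnj[OF L(1)]] L2_mult_integrable[OF L(1) L2_cnj[OF Xd]]
      L2_mult_integrable[OF Xd L2_cnj[OF L(1)]]
    by (simp add: ip_def)
  finally have "ip \<phi> \<phi> + (ip \<phi> (\<lambda>x. d x * X x) + ip (\<lambda>x. d x * X x) \<phi>) = 0"
    by (simp add: add.assoc)
  then have eq: "ip \<phi> \<phi> = - (ip \<phi> (\<lambda>x. d x * X x) + ip (\<lambda>x. d x * X x) \<phi>)"
    by (rule eq_neg_iff_add_eq_0[THEN iffD2])
  have Xd_le: "l2_norm D (\<lambda>x. d x * X x) \<le> R * l2_norm D d"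
  proof -
    have "(LINT x|M. (cmod (d x * X x))\<^sup>2) \<le> (LINT x|M. R\<^sup>2 * (cmod (d x))\<^sup>2)"
    proof (rule integral_mono)
      fix x assume "x \<in> space M"
      then have "\<bar>x $ 1\<bar> \<le> R" using R(1)[of x] component_le_norm_cart[of x 1] by simp
      then have "(\<bar>x $ 1\<bar> * cmod (d x))\<^sup>2 \<le> (R * cmod (d x))\<^sup>2"
        by (intro power_mono mult_right_mono) auto
      then show "(cmod (d x * X x))\<^sup>2 \<le> R\<^sup>2 * (cmod (d x))\<^sup>2"
        by (simp add: X_def norm_mult power_mult_distrib mult.commute)
    qed (use Xd L in \<open>auto intro: L2_integrable_sq integrable_mult_right\<close>)
    then have "l2_norm D (\<lambda>x. d x * X x) \<le> sqrt (R\<^sup>2 * (LINT x|M. (cmod (d x))\<^sup>2))"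
      by (simp add: l2_norm_def)
    also have "\<dots> = R * l2_norm D d" using R(2) by (simp add: l2_norm_def real_sqrt_mult)
    finally show ?thesis .
  qed
  have "(l2_norm D \<phi>)\<^sup>2 = cmod (ip \<phi> \<phi>)" by (simp add: ip_self_eq norm_power)
  also have "\<dots> \<le> cmod (ip \<phi> (\<lambda>x. d x * X x)) + cmod (ip (\<lambda>x. d x * X x) \<phi>)"
    unfolding eq norm_minus_cancel by (rule norm_triangle_ineq)
  also have "\<dots> \<le> 2 * (l2_norm D (\<lambda>x. d x * X x) * l2_norm D \<phi>)"
    using L2.Cauchy_Schwarz[OF L(1) Xd] L2.Cauchy_Schwarz[OF Xd L(1)] by (simp add: mult.commute)
  also have "\<dots> \<le> 2 * ((R * l2_norm D d) * l2_norm D \<phi>)"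
    using Xd_le by (intro mult_left_mono mult_right_mono) auto
  finally have "l2_norm D \<phi> * l2_norm D \<phi> \<le> (2 * R * l2_norm D d) * l2_norm D \<phi>"
    by (simp add: power2_eq_square mult_ac)
  then have "l2_norm D \<phi> \<le> 2 * R * l2_norm D d"
    using R(2) l2_norm_nonneg[of \<phi>] l2_norm_nonneg[of d]
    by (cases "l2_norm D \<phi> = 0") (simp_all add: mult_le_cancel_right)
  also have "l2_norm D d = l2_norm D (wg \<phi> 1)"
    using wg_test_function[OF phi, of 1] L(2) H1_test_function[OF phi] unfolding d_def
    by (intro l2_norm_cong_AE) (auto elim: AE_mp)
  also have "2 * R * l2_norm D (wg \<phi> 1) \<le> 2 * R * E.nrm \<phi>"
    using wg_le_energy[OF H1_test_function[OF phi]] R(2) by (intro mult_left_mono) auto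
  finally show ?thesis .
qed

text \<open>Both sides are continuous in the norm of \<open>H1 D\<close>, in which test functions are dense in \<open>H10 D\<close>.\<close>

lemma Poincare: "\<exists>C>0. \<forall>u\<in>H10 D. l2_norm D u \<le> C * E.nrm u"
proof -
  obtain R where R: "R > 0" "\<And>x. x \<in> D \<Longrightarrow> norm x \<le> R"
    using D_bounded unfolding bounded_pos by blast
  define C where "C = 2 * R"
  have C: "C > 0" using R by (simp add: C_def)
  have "l2_norm D u \<le> C * E.nrm u" if u: "u \<in> H10 D" for u
  proof (rule field_le_epsilon)
    fix e :: real assume "e > 0"
    define d where "d = e / (1 + C)"
    have d: "d > 0" using \<open>e > 0\<close> C by (simp add: d_def)
    obtain \<phi> where phi: "\<phi> \<in> test_functions D" "S.nrm (u - \<phi>) < d" using H10_approx[OF u d] by blast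
    have H: "u \<in> H1 D" "\<phi> \<in> H1 D" "u - \<phi> \<in> H1 D"
      using u H1_test_function[OF phi(1)] by (auto intro!: S.V_closed)
    have "l2_norm D u \<le> l2_norm D (u - \<phi>) + l2_norm D \<phi>"
      using L2.nrm_triangle[of "u - \<phi>" \<phi>] H by simp
    also have "l2_norm D (u - \<phi>) \<le> d" using l2_norm_le[OF H(3)] phi(2) by simp
    also have "l2_norm D \<phi> \<le> C * E.nrm \<phi>"
      unfolding C_def by (rule Poincare_test_functions[OF R(2)]) (use R phi in auto)
    also have "E.nrm \<phi> \<le> E.nrm u + E.nrm (u - \<phi>)"
      using E.nrm_triangle_diff[of u "u - \<phi>"] H by simp
    also have "E.nrm (u - \<phi>) \<le> d" using energy_nrm_le[OF H(3)] phi(2) by simp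
    finally have "l2_norm D u \<le> d + C * (E.nrm u + d)" using C by simp
    also have "d + C * (E.nrm u + d) = C * E.nrm u + (1 + C) * d" by (simp add: algebra_simps)
    also have "(1 + C) * d = e" using C by (simp add: d_def)
    finally show "l2_norm D u \<le> C * E.nrm u + e" .
  qed
  with C show ?thesis by blast
qed

text \<open>By the Poincare inequality a Cauchy sequence in the energy norm converges in \<open>L\<^sup>2\<close> together with its
  gradients. The identity that defines weak gradients passes to the limit, so the limit of the gradients is the weak
  gradient of the limit.\<close>

lemma H10_energy_complete:
  assumes s: "\<And>n. s n \<in> H10 D" and cauchy: "E.cauchy s"
  shows "\<exists>u\<in>H10 D. E.converges s u"
proof -
  obtain C where C: "C > 0" "\<And>u. u \<in> H10 D \<Longrightarrow> l2_norm D u \<le> C * E.nrm u" using Poincare by blast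
  have sH: "s n \<in> H1 D" for n using s by simp
  have diff: "s m - s n \<in> H10 D" for m n using L2.subspace_diff[OF H10_subspace s s] .
  have cau: "\<exists>N. \<forall>m\<ge>N. \<forall>n\<ge>N. E.nrm (s m - s n) < e" if "e > 0" for e
    using cauchy that unfolding E.cauchy_def by blast
  have "L2.cauchy s"
    unfolding L2.cauchy_def
  proof (intro allI impI)
    fix e :: real assume "e > 0"
    then obtain N where N: "\<And>m n. m \<ge> N \<Longrightarrow> n \<ge> N \<Longrightarrow> E.nrm (s m - s n) < e / C"
      using cau[of "e / C"] C(1) by (metis divide_pos_pos)
    have "L2.nrm (s m - s n) < e" if "m \<ge> N" "n \<ge> N" for m n
      using C(2)[OF diff[of m n]] N[OF that] C(1) by (simp add: field_simps)
    then show "\<exists>N. \<forall>m\<ge>N. \<forall>n\<ge>N. L2.nrm (s m - s n) < e" by blast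
  qed
  then obtain u where u: "u \<in> L2 D" "L2.converges s u" using L2.complete[of s] sH by auto
  have wg_diff: "l2_norm D (wg (s m) i - wg v i) = l2_norm D (wg (s m - v) i)" if v: "v \<in> H1 D" for m v i
  proof (rule l2_norm_cong_AE)
    have "AE x in M. wg ((s m - v) + v) i x = (wg (s m - v) i + wg v i) x"
      by (rule wg_add) (use sH v in auto)
    then show "AE x in M. (wg (s m) i - wg v i) x = wg (s m - v) i x" by (auto elim: AE_mp)
  qed (use sH v in auto)
  have "\<exists>k\<in>L2 D. L2.converges (\<lambda>n. wg (s n) i) k" for i
  proof (rule L2.complete)
    show "L2.cauchy (\<lambda>n. wg (s n) i)"
      unfolding L2.cauchy_def
    proof (intro allI impI)
      fix e :: real assume "e > 0"
      then obtain N where N: "\<forall>m\<ge>N. \<forall>n\<ge>N. E.nrm (s m - s n) < e" using cau by blast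
      have "L2.nrm (wg (s m) i - wg (s n) i) \<le> E.nrm (s m - s n)" for m n
        using wg_le_energy[of "s m - s n" i] wg_diff[OF sH[of n], of m i] diff by simp
      then show "\<exists>N. \<forall>m\<ge>N. \<forall>n\<ge>N. L2.nrm (wg (s m) i - wg (s n) i) < e"
        using N order_le_less_trans by blast
    qed
  qed (use sH in auto)
  then obtain k where k: "\<And>i. k i \<in> L2 D" "\<And>i. L2.converges (\<lambda>n. wg (s n) i) (k i)" by metis
  have weak: "is_weak_grad D u (\<lambda>x. \<chi> i. k i x)"
    unfolding is_weak_grad_def
  proof (intro conjI allI ballI)
    fix \<phi> i assume phi: "\<phi> \<in> test_functions D"
    let ?c = "\<lambda>f x. cnj (f x) :: complex"
    have L: "?c \<phi> \<in> L2 D" "?c (partial i \<phi>) \<in> L2 D"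
      using phi by (auto intro: L2_cnj test_function_L2 partial_test_function)
    have "(\<lambda>n. ip (s n) (?c (partial i \<phi>))) \<longlonglongrightarrow> ip u (?c (partial i \<phi>))"
      by (rule L2.converges_ip[OF u(2)]) (use sH u L in auto)
    moreover have "ip (s n) (?c (partial i \<phi>)) = - ip (wg (s n) i) (?c \<phi>)" for n
      using H1_weak_grad[OF sH[of n]] phi by (simp add: ip_def is_weak_grad_def)
    moreover have "(\<lambda>n. - ip (wg (s n) i) (?c \<phi>)) \<longlonglongrightarrow> - ip (k i) (?c \<phi>)"
      by (intro tendsto_minus L2.converges_ip[OF k(2)]) (use sH k L in auto)
    ultimately have "ip u (?c (partial i \<phi>)) = - ip (k i) (?c \<phi>)"
      using LIMSEQ_unique by simp
    then show "(LINT x|M. u x * partial i \<phi> x) = - (LINT x|M. (\<chi> i. k i x) $ i * \<phi> x)"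
      by (simp add: ip_def)
  qed (use k in simp)
  have uH: "u \<in> H1 D" by (rule H1_I[OF u(1) weak])
  have wu: "AE x in M. wg u i x = k i x" for i using weak_grad_AE[OF weak, of i] by simp
  have "(\<lambda>n. l2_norm D (wg (s n - u) i)) \<longlonglongrightarrow> 0" for i
  proof -
    have "l2_norm D (wg (s n - u) i) = l2_norm D (wg (s n) i - k i)" for n
      unfolding wg_diff[OF uH, symmetric]
      by (rule l2_norm_cong_AE) (use wu[of i] sH uH k in \<open>auto elim: AE_mp\<close>)
    then show ?thesis using k(2)[of i] by (simp add: L2.converges_def)
  qed
  then have "(\<lambda>n. \<Sum>i\<in>UNIV. (l2_norm D (wg (s n - u) i))\<^sup>2) \<longlonglongrightarrow> (\<Sum>i\<in>(UNIV :: 2 set). 0\<^sup>2)"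
    by (intro tendsto_intros)
  then have "(\<lambda>n. (E.nrm (s n - u))\<^sup>2) \<longlonglongrightarrow> 0"
    using sH uH by (simp add: energy_nrm_sq)
  then have "(\<lambda>n. sqrt ((E.nrm (s n - u))\<^sup>2)) \<longlonglongrightarrow> sqrt 0" by (intro tendsto_intros)
  then have conv: "E.converges s u" using sH uH by (simp add: E.converges_def)
  have "u \<in> H10 D"
    unfolding H10_iff
  proof (intro conjI allI impI uH)
    fix e :: real assume "e > 0"
    have "(\<lambda>n. l2_norm D (s n - u) + E.nrm (s n - u)) \<longlonglongrightarrow> 0 + 0"
      using u(2) conv by (intro tendsto_add) (simp_all add: L2.converges_def E.converges_def)
    from order_tendstoD(2)[OF this, of "e / 2"] \<open>e > 0\<close>
    obtain n where n: "l2_norm D (s n - u) + E.nrm (s n - u) < e / 2"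
      by (auto simp: eventually_sequentially)
    then have near: "S.nrm (s n - u) < e / 2" using H1_nrm_le[of "s n - u"] sH uH by simp
    obtain \<phi> where phi: "\<phi> \<in> test_functions D" "S.nrm (s n - \<phi>) < e / 2"
      using H10_approx[OF s, of "e / 2"] \<open>e > 0\<close> by auto
    have "S.nrm (u - \<phi>) < e"
      using S.nrm_triangle_le[of u "s n" \<phi>] S.nrm_minus_commute[of u "s n"] near phi sH uH
        H1_test_function[OF phi(1)] by simp
    then show "\<exists>\<phi>\<in>test_functions D. S.nrm (u - \<phi>) < e" using phi(1) by blast
  qed
  with conv show ?thesis by blast
qed

end

section \<open>Solution operators on Galerkin spaces\<close>

text \<open>The spaces in which the boundary value problem is solved: \<open>H10 D\<close> and its finite element subspaces.
  Closure under conjugation links the bilinear \<open>dirichlet_form\<close> to the inner product \<open>energy_ip\<close>.\<close>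

locale galerkin = bounded_domain +
  fixes W :: "(real^2 \<Rightarrow> complex) set"
  assumes W_H10: "W \<subseteq> H10 D"
    and W_subspace: "L2.subspace W"
    and W_cnj: "v \<in> W \<Longrightarrow> (\<lambda>x. cnj (v x)) \<in> W"
    and W_complete: "\<lbrakk>\<And>n. s n \<in> W; E.cauchy s\<rbrakk> \<Longrightarrow> \<exists>u\<in>W. E.converges s u"
begin

lemma W_H1 [simp]: "v \<in> W \<Longrightarrow> v \<in> H1 D"
  using W_H10 by auto

abbreviation T :: "(real^2 \<Rightarrow> complex) \<Rightarrow> real^2 \<Rightarrow> complex" where
  "T \<equiv> solution_op D W"

text \<open>The representation theorem yields \<open>u'\<close> with \<open>\<langle>\<nabla>v, \<nabla>u'\<rangle> = \<integral> f v\<close>; the bilinear problem is solved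
  by its complex conjugate.\<close>

lemma solution_exists:
  assumes f: "f \<in> L2 D"
  shows "\<exists>u. u \<in> W \<and> (\<forall>v\<in>W. dirichlet_form D u v = l2_pairing D f v)"
proof -
  interpret W: semi_inner "\<lambda>c f x. c * f x" W energy_ip
    by (rule E.semi_inner_subset[OF W_subspace]) auto
  interpret W: semi_hilbert "\<lambda>c f x. c * f x" W energy_ip
    by unfold_locales (rule W_complete)
  obtain C where C: "C > 0" "\<And>u. u \<in> H10 D \<Longrightarrow> l2_norm D u \<le> C * E.nrm u" using Poincare by blast
  have pair: "l2_pairing D f v = ip f (\<lambda>x. cnj (v x))" for v
    by (simp add: l2_pairing_def ip_def)
  have int: "integrable M (\<lambda>x. f x * v x)" if "v \<in> W" for v
    using L2_mult_integrable[OF f] that by simp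
  have "\<exists>u\<in>W. \<forall>v\<in>W. energy_ip v u = l2_pairing D f v"
  proof (rule W.Riesz_representation)
    fix v w assume "v \<in> W" "w \<in> W"
    then show "l2_pairing D f (v + w) = l2_pairing D f v + l2_pairing D f w"
      using int by (simp add: l2_pairing_def distrib_left)
  next
    fix v and c :: complex assume "v \<in> W"
    show "l2_pairing D f (\<lambda>x. c * v x) = c * l2_pairing D f v"
      by (simp add: l2_pairing_def mult.left_commute[of _ c])
  next
    fix v assume v: "v \<in> W"
    have "cmod (l2_pairing D f v) \<le> l2_norm D f * l2_norm D v"
      unfolding pair using L2.Cauchy_Schwarz[OF f L2_cnj[OF H1_L2[OF W_H1[OF v]]]]
      by (simp add: l2_norm_cnj)
    also have "\<dots> \<le> l2_norm D f * (C * E.nrm v)"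
      using C(2) v W_H10 by (intro mult_left_mono) auto
    finally show "cmod (l2_pairing D f v) \<le> (l2_norm D f * C) * W.nrm v" by (simp add: mult.assoc)
  qed
  then obtain u where u: "u \<in> W" "\<And>v. v \<in> W \<Longrightarrow> energy_ip v u = l2_pairing D f v" by blast
  have "dirichlet_form D (\<lambda>x. cnj (u x)) v = l2_pairing D f v" if "v \<in> W" for v
  proof -
    have "dirichlet_form D (\<lambda>x. cnj (u x)) v = dirichlet_form D v (\<lambda>x. cnj (u x))"
      by (simp add: dirichlet_form_def mult.commute)
    then show ?thesis using dirichlet_form_cnj[of v u] u that by simp
  qed
  then show ?thesis using W_cnj[OF u(1)] by blast
qed

lemma
  assumes "f \<in> L2 D"
  shows T_in_W [simp]: "T f \<in> W"
    and T_energy: "v \<in> W \<Longrightarrow> energy_ip (T f) v = ip f v"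
proof -
  have *: "T f \<in> W \<and> (\<forall>v\<in>W. dirichlet_form D (T f) v = l2_pairing D f v)"
    unfolding solution_op_def by (rule someI_ex[OF solution_exists[OF assms]])
  then show TW: "T f \<in> W" by blast
  assume v: "v \<in> W"
  have "energy_ip (T f) v = dirichlet_form D (T f) (\<lambda>x. cnj (v x))"
    using dirichlet_form_cnj[of "T f" v] TW v by simp
  also have "\<dots> = l2_pairing D f (\<lambda>x. cnj (v x))" using * W_cnj[OF v] by blast
  also have "\<dots> = ip f v" by (simp add: l2_pairing_def ip_def)
  finally show "energy_ip (T f) v = ip f v" .
qed

lemma T_L2 [simp]: "f \<in> L2 D \<Longrightarrow> T f \<in> L2 D"
  using T_in_W[of f] by simp

text \<open>Test the equation with its own solution:
  \<open>\<parallel>\<nabla>T f\<parallel>\<^sup>2 = \<langle>f, T f\<rangle> \<le> \<parallel>f\<parallel> \<parallel>T f\<parallel> \<le> C \<parallel>f\<parallel> \<parallel>\<nabla>T f\<parallel>\<close>.\<close>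

lemma T_energy_bound: "\<exists>C>0. \<forall>f\<in>L2 D. E.nrm (T f) \<le> C * l2_norm D f"
proof -
  obtain C where C: "C > 0" "\<And>u. u \<in> H10 D \<Longrightarrow> l2_norm D u \<le> C * E.nrm u" using Poincare by blast
  have "E.nrm (T f) \<le> C * l2_norm D f" if f: "f \<in> L2 D" for f
  proof -
    have "(E.nrm (T f))\<^sup>2 = cmod (ip f (T f))"
      using E.ip_self[of "T f"] T_energy[OF f T_in_W[OF f]] f by (simp add: norm_power)
    also have "\<dots> \<le> l2_norm D f * l2_norm D (T f)"
      using L2.Cauchy_Schwarz[OF f T_L2[OF f]] by simp
    also have "\<dots> \<le> l2_norm D f * (C * E.nrm (T f))"
      using C(2) T_in_W[OF f] W_H10 by (intro mult_left_mono) auto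
    finally have "E.nrm (T f) * E.nrm (T f) \<le> (C * l2_norm D f) * E.nrm (T f)"
      by (simp add: power2_eq_square mult_ac)
    then show ?thesis
      using C(1) E.nrm_ge0[OF W_H1[OF T_in_W[OF f]]]
      by (cases "E.nrm (T f) = 0") (auto simp: mult_le_cancel_right simp del: E.nrm_ge0)
  qed
  with C(1) show ?thesis by blast
qed

text \<open>Symmetry: \<open>\<langle>T f, g\<rangle> = \<langle>\<nabla>T f, \<nabla>T g\<rangle> = \<langle>f, T g\<rangle>\<close>.\<close>

sublocale T: symmetric_operator_hilbert "\<lambda>c f x. c * f x" "L2 D" ip T
proof
  fix f g assume fg: "f \<in> L2 D" "g \<in> L2 D"
  have "ip (T f) g = cnj (ip g (T f))" using fg by (intro L2.ip_commute) auto
  also have "\<dots> = cnj (energy_ip (T g) (T f))" using fg by (simp add: T_energy)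
  also have "\<dots> = energy_ip (T f) (T g)" by (rule E.ip_commute[symmetric]) (use fg in auto)
  also have "\<dots> = ip f (T g)" using fg by (simp add: T_energy)
  finally show "ip (T f) g = ip f (T g)" .
next
  obtain C B where C: "C > 0" "\<And>u. u \<in> H10 D \<Longrightarrow> l2_norm D u \<le> C * E.nrm u"
    and B: "\<And>f. f \<in> L2 D \<Longrightarrow> E.nrm (T f) \<le> B * l2_norm D f"
    using Poincare T_energy_bound by blast
  have "L2.nrm (T f) \<le> (C * B) * L2.nrm f" if f: "f \<in> L2 D" for f
  proof -
    have "T f \<in> H10 D" using T_in_W[OF f] W_H10 by blast
    from order_trans[OF C(2)[OF this] mult_left_mono[OF B[OF f], of C]] C(1) show ?thesis
      by (simp add: mult.assoc)
  qed
  then show "\<exists>K. \<forall>f\<in>L2 D. L2.nrm (T f) \<le> K * L2.nrm f" by blast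
qed simp

lemma shift_apply: "T.shift \<mu> f = (\<lambda>x. T f x - \<mu> * f x)"
  by (simp add: T.shift_def fun_diff_def)

lemma l2_eq_nrm: "f \<in> L2 D \<Longrightarrow> g \<in> L2 D \<Longrightarrow> l2_eq D f g \<longleftrightarrow> l2_norm D (f - g) = 0"
  by (simp add: l2_eq_iff fun_diff_def)


section \<open>Bounded invertibility and eigenvalues\<close>

text \<open>The space \<open>X\<close> will be \<open>L2 D\<close> for the continuous and \<open>W\<close> for the discrete problem; in both cases the bound is one on
  all of \<open>L2 D\<close>. A solution \<open>u\<close> of \<open>(T - \<mu>) u = f\<close> equals \<open>(T u - f) / \<mu>\<close>, which lies in every space that contains \<open>f\<close>
  and the range of \<open>T\<close>.\<close>

lemma has_bounded_inverse_if_bounded_below: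
  assumes X: "W \<subseteq> X" "X \<subseteq> L2 D" "L2.subspace X" and mu: "\<mu> \<noteq> 0"
    and c: "c > 0" "\<And>v. v \<in> L2 D \<Longrightarrow> c * l2_norm D v \<le> l2_norm D (T.shift \<mu> v)"
  shows "has_bounded_inverse D X (T.shift \<mu>)"
proof -
  have XL: "f \<in> L2 D" if "f \<in> X" for f using X that by blast
  have Xclosed: "(\<lambda>x. a * f x + g x) \<in> X" "f - g \<in> X" "(\<lambda>x. a * f x) \<in> X" if "f \<in> X" "g \<in> X" for f g a
    using L2.subspace_add[OF X(3) L2.subspace_scale[OF X(3) that(1)] that(2)]
      L2.subspace_diff[OF X(3) that] L2.subspace_scale[OF X(3) that(1)] by (simp_all add: plus_fun_def)
  have inj: "l2_norm D (u - v) = 0"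
    if "u \<in> L2 D" "v \<in> L2 D" "l2_norm D (T.shift \<mu> u - T.shift \<mu> v) = 0" for u v
  proof -
    have "l2_norm D (T.shift \<mu> (u - v)) = 0"
      using T.shift_diff[of u v \<mu>] L2.nrm_cong[of "T.shift \<mu> (u - v)" "T.shift \<mu> u - T.shift \<mu> v"] that by simp
    then have "c * l2_norm D (u - v) \<le> 0" using c(2)[of "u - v"] that by simp
    then show ?thesis using c(1) l2_norm_nonneg[of "u - v"] by (simp add: mult_le_0_iff)
  qed
  define S where "S f = (SOME u. u \<in> L2 D \<and> l2_norm D (T.shift \<mu> u - f) = 0)" for f
  have S: "S f \<in> L2 D" "l2_norm D (T.shift \<mu> (S f) - f) = 0" if "f \<in> L2 D" for f
  proof -
    have "\<exists>u. u \<in> L2 D \<and> l2_norm D (T.shift \<mu> u - f) = 0"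
      using T.shift_surjective[OF c(1) _ that, of \<mu>] c(2) by auto
    from someI_ex[OF this] show "S f \<in> L2 D" "l2_norm D (T.shift \<mu> (S f) - f) = 0"
      by (simp_all add: S_def)
  qed
  define B where "B f = (\<lambda>x. (1 / \<mu>) * (T (S f) - f) x)" for f
  have BX: "B f \<in> X" if "f \<in> X" for f
    unfolding B_def using that X(1) T_in_W[OF S(1)[OF XL[OF that]]] by (intro Xclosed(3) Xclosed(2)) auto
  have BS: "l2_norm D (S f - B f) = 0" if f: "f \<in> X" for f
  proof -
    have "S f - B f = (\<lambda>x. (- (1 / \<mu>)) * (T.shift \<mu> (S f) - f) x)"
      using mu by (simp add: B_def shift_apply fun_eq_iff field_simps)
    moreover have "T.shift \<mu> (S f) - f \<in> L2 D" using S(1) XL[OF f] by (auto intro!: L2.V_closed)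
    from L2.nrm_scale[OF this, of "- (1 / \<mu>)"] S(2)[OF XL[OF f]]
    have "l2_norm D (\<lambda>x. (- (1 / \<mu>)) * (T.shift \<mu> (S f) - f) x) = 0" by simp
    ultimately show ?thesis by simp
  qed
  have AB: "l2_norm D (T.shift \<mu> (B f) - f) = 0" if f: "f \<in> X" for f
  proof -
    have L: "S f \<in> L2 D" "B f \<in> L2 D" "f \<in> L2 D" using f XL BX S(1) by auto
    obtain K where K: "\<And>x. x \<in> L2 D \<Longrightarrow> L2.nrm (T.shift \<mu> x) \<le> K * L2.nrm x" using T.shift_bounded by blast
    have "l2_norm D (T.shift \<mu> (S f - B f)) \<le> 0" using K[of "S f - B f"] BS[OF f] L by simp
    then have "l2_norm D (T.shift \<mu> (S f - B f)) = 0" by (intro antisym) auto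
    then have "l2_norm D (T.shift \<mu> (S f) - T.shift \<mu> (B f)) = 0"
      using T.shift_diff[of "S f" "B f" \<mu>] L
        L2.nrm_cong[of "T.shift \<mu> (S f - B f)" "T.shift \<mu> (S f) - T.shift \<mu> (B f)"] by simp
    then have "l2_norm D (T.shift \<mu> (B f) - T.shift \<mu> (S f)) = 0"
      using L2.nrm_minus_commute[of "T.shift \<mu> (S f)" "T.shift \<mu> (B f)"] L by simp
    then show ?thesis
      using L2.nrm_triangle_le[of "T.shift \<mu> (B f)" "T.shift \<mu> (S f)" f] S(2)[OF L(3)] L
        l2_norm_nonneg[of "T.shift \<mu> (B f) - f"] by simp
  qed
  have AX: "T.shift \<mu> f \<in> X" if "f \<in> X" for f
    unfolding T.shift_def using that X(1) T_in_W[OF XL[OF that]] by (intro Xclosed(2) Xclosed(3)[of f f]) auto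
  have "bounded_op D X B"
    unfolding bounded_op_def
  proof (intro conjI ballI allI)
    fix f g and a :: complex assume fg: "f \<in> X" "g \<in> X"
    define k where "k = (\<lambda>x. a * f x + g x)"
    define l where "l = (\<lambda>x. a * B f x + B g x)"
    have kX: "k \<in> X" unfolding k_def by (rule Xclosed(1)[OF fg])
    have lX: "l \<in> X" unfolding l_def by (rule Xclosed(1)[OF BX[OF fg(1)] BX[OF fg(2)]])
    have L: "k \<in> L2 D" "l \<in> L2 D" "B k \<in> L2 D" "B f \<in> L2 D" "B g \<in> L2 D" "f \<in> L2 D" "g \<in> L2 D"
      using kX lX fg BX XL by auto
    have l_eq: "l = (\<lambda>x. a * B f x) + B g" by (simp add: l_def plus_fun_def)
    have k_eq: "k = (\<lambda>x. a * f x) + g" by (simp add: k_def plus_fun_def)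
    have null: "ip (T.shift \<mu> (B q) - q) w = 0" if "q \<in> X" "w \<in> L2 D" for q w
      by (rule L2.null_ip) (use AB[OF that(1)] that XL BX in \<open>auto intro!: L2.V_closed\<close>)
    have "l2_norm D (T.shift \<mu> (B k) - T.shift \<mu> l) = 0"
    proof -
      have "L2.nrm (T.shift \<mu> (B k) - T.shift \<mu> l) = 0"
      proof (rule L2.null_if_orthogonal)
        fix w assume w: "w \<in> L2 D"
        have eq: "ip (T.shift \<mu> (B q)) w = ip q w" if "q \<in> X" for q
          using null[OF that w] L2.ip_diff_left[of "T.shift \<mu> (B q)" q w] that XL BX w by simp
        have "ip (T.shift \<mu> l) w = ip l (T.shift (cnj \<mu>) w)" using T.shift_adjoint L w by simp
        also have "\<dots> = a * ip (B f) (T.shift (cnj \<mu>) w) + ip (B g) (T.shift (cnj \<mu>) w)"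
          unfolding l_eq using L w by (simp only: L2.ip_add_left L2.ip_scale_left L2.V_closed T.shift_closed)
        also have "\<dots> = a * ip (T.shift \<mu> (B f)) w + ip (T.shift \<mu> (B g)) w"
          using T.shift_adjoint L w by simp
        also have "\<dots> = a * ip f w + ip g w" using eq fg by simp
        also have "\<dots> = ip k w"
          unfolding k_eq using L w by (simp only: L2.ip_add_left L2.ip_scale_left L2.V_closed)
        also have "\<dots> = ip (T.shift \<mu> (B k)) w" using eq[OF kX] by simp
        finally show "ip (T.shift \<mu> (B k) - T.shift \<mu> l) w = 0"
          using L w by (simp add: L2.ip_diff_left)
      qed (use L in auto)
      then show ?thesis by simp
    qed
    from inj[OF L(3,2) this] show "l2_eq D (B (\<lambda>x. a * f x + g x)) (\<lambda>x. a * B f x + B g x)"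
      using L by (simp add: l2_eq_nrm flip: k_def l_def)
  next
    have "l2_norm D (B f) \<le> (1 / c) * l2_norm D f" if f: "f \<in> X" for f
    proof -
      have "l2_norm D (T.shift \<mu> (B f)) = l2_norm D f"
        using L2.nrm_cong[of "T.shift \<mu> (B f)" f] AB[OF f] f XL BX by simp
      then show ?thesis using c(2)[OF XL[OF BX[OF f]]] c(1) by (simp add: field_simps)
    qed
    then show "\<exists>C. \<forall>f\<in>X. l2_norm D (B f) \<le> C * l2_norm D f" by blast
  qed (rule BX)
  moreover have "l2_eq D (T.shift \<mu> (B f)) f \<and> l2_eq D (B (T.shift \<mu> f)) f" if f: "f \<in> X" for f
  proof
    show "l2_eq D (T.shift \<mu> (B f)) f" using AB[OF f] f XL BX by (simp add: l2_eq_nrm)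
    have "l2_norm D (B (T.shift \<mu> f) - f) = 0"
      by (rule inj) (use AB[OF AX[OF f]] XL BX AX f in auto)
    then show "l2_eq D (B (T.shift \<mu> f)) f" using XL BX AX f by (simp add: l2_eq_nrm)
  qed
  ultimately show ?thesis unfolding has_bounded_inverse_def by blast
qed

text \<open>If \<open>v\<close> is an eigenvector in \<open>L2 D\<close>, then so is \<open>T v = \<mu> v\<close>, which lies in \<open>X\<close>.\<close>

lemma no_bounded_inverse_at_eigenvalue:
  assumes X: "W \<subseteq> X" "X \<subseteq> L2 D" "L2.subspace X" and mu: "\<mu> \<noteq> 0"
    and v: "v \<in> L2 D" "l2_norm D v \<noteq> 0" "l2_norm D (T.shift \<mu> v) = 0"
  shows "\<not> has_bounded_inverse D X (T.shift \<mu>)"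
proof
  assume "has_bounded_inverse D X (T.shift \<mu>)"
  then obtain B C where B: "\<And>f. f \<in> X \<Longrightarrow> B f \<in> X" "\<And>f. f \<in> X \<Longrightarrow> l2_norm D (B f) \<le> C * l2_norm D f"
    "\<And>f. f \<in> X \<Longrightarrow> l2_eq D (B (T.shift \<mu> f)) f"
    unfolding has_bounded_inverse_def bounded_op_def by blast
  define w where "w = T v"
  have w: "w \<in> X" "w \<in> L2 D" using X(1) T_in_W[OF v(1)] v(1) by (auto simp: w_def)
  have nz: "l2_norm D w \<noteq> 0"
  proof -
    have "l2_norm D w = l2_norm D (\<lambda>x. \<mu> * v x)"
      using L2.nrm_cong[of w "\<lambda>x. \<mu> * v x"] v w L2_cmul[OF v(1)] by (simp add: w_def T.shift_def)
    also have "\<dots> = cmod \<mu> * l2_norm D v" using L2.nrm_scale[OF v(1)] by simp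
    finally show ?thesis using mu v(2) by simp
  qed
  have "L2.nrm (T.shift \<mu> w) = 0"
  proof (rule L2.null_if_orthogonal)
    fix y assume y: "y \<in> L2 D"
    have "ip (T.shift \<mu> w) y = ip (T.shift \<mu> v) (T y)"
      unfolding w_def using T.shift_adjoint[of "T v" y \<mu>] T.shift_adjoint[of v "T y" \<mu>] T.A_sym v(1) y
      by (simp add: T.shift_def L2.ip_diff_right L2.ip_diff_left L2.ip_scale_left L2.ip_scale_right L2_cmul)
    then show "ip (T.shift \<mu> w) y = 0" using L2.null_ip[of "T.shift \<mu> v" "T y"] v y by simp
  qed (use w in auto)
  moreover have sX: "T.shift \<mu> w \<in> X"
    unfolding T.shift_def using L2.subspace_diff[OF X(3)] L2.subspace_scale[OF X(3) w(1)] X(1) T_in_W[OF w(2)]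
    by auto
  ultimately have "l2_norm D (B (T.shift \<mu> w)) \<le> 0" using B(2)[OF sX] by simp
  moreover have "l2_norm D (B (T.shift \<mu> w)) = l2_norm D w"
    using B(3)[OF w(1)] l2_norm_cong_AE[of "B (T.shift \<mu> w)" w] B(1)[OF sX] X(2) w
    by (auto simp: l2_eq_def)
  ultimately show False using nz l2_norm_nonneg[of w] by simp
qed

end

locale compact_galerkin = galerkin +
  assumes T_compact: "L2.compact_op T"
begin

sublocale T: compact_symmetric_operator "\<lambda>c f x. c * f x" "L2 D" ip T
  by unfold_locales (rule T_compact)

end


section \<open>Eigenvectors have rank one\<close>

context galerkin
begin

abbreviation F :: "complex \<Rightarrow> (real^2 \<Rightarrow> complex) \<Rightarrow> real^2 \<Rightarrow> complex" where
  "F z \<equiv> T.shift (1 / z)"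

lemma has_op_derivative_F:
  assumes "z \<noteq> 0"
  shows "has_op_derivative D (L2 D) F (\<lambda>u x. (1 / z\<^sup>2) * u x) z"
  unfolding has_op_derivative_def
proof (intro conjI allI impI)
  show "bounded_op D (L2 D) (\<lambda>u x. (1 / z\<^sup>2) * u x)"
    unfolding bounded_op_def
  proof (intro conjI ballI allI)
    have "l2_norm D (\<lambda>x. (1 / z\<^sup>2) * f x) \<le> cmod (1 / z\<^sup>2) * l2_norm D f" if "f \<in> L2 D" for f
      using L2.nrm_scale[OF that, of "1 / z\<^sup>2"] by simp
    then show "\<exists>C. \<forall>f\<in>L2 D. l2_norm D (\<lambda>x. (1 / z\<^sup>2) * f x) \<le> C * l2_norm D f" by blast
    show "l2_eq D (\<lambda>x. (1 / z\<^sup>2) * (c * f x + g x)) (\<lambda>x. c * ((1 / z\<^sup>2) * f x) + (1 / z\<^sup>2) * g x)" for f g c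
      by (simp add: l2_eq_def add_divide_distrib)
  qed (rule L2_cmul)
  fix e :: real assume "e > 0"
  have "((\<lambda>z. - (1 / z)) has_field_derivative 1 / z\<^sup>2) (at z)"
    using assms by (auto intro!: derivative_eq_intros simp: power2_eq_square)
  then have "(\<lambda>w. (- (1 / (z + w)) - - (1 / z)) / w) \<midarrow>0\<rightarrow> 1 / z\<^sup>2" by (simp add: DERIV_def)
  from LIM_D[OF this \<open>e > 0\<close>] obtain d where d: "d > 0"
    "\<And>w. w \<noteq> 0 \<Longrightarrow> cmod w < d \<Longrightarrow> cmod ((- (1 / (z + w)) - - (1 / z)) / w - 1 / z\<^sup>2) < e" by auto
  have "l2_norm D (\<lambda>x. (F (z + w) u x - F z u x) / w - (1 / z\<^sup>2) * u x) \<le> e * l2_norm D u"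
    if w: "0 < cmod w" "cmod w < d" and u: "u \<in> L2 D" for w u
  proof -
    define k where "k = (- (1 / (z + w)) - - (1 / z)) / w - 1 / z\<^sup>2"
    have "(\<lambda>x. (F (z + w) u x - F z u x) / w - (1 / z\<^sup>2) * u x) = (\<lambda>x. k * u x)"
    proof
      fix x
      have "F (z + w) u x - F z u x = (- (1 / (z + w)) - - (1 / z)) * u x"
        by (simp add: shift_apply ring_distribs)
      then show "(F (z + w) u x - F z u x) / w - (1 / z\<^sup>2) * u x = k * u x"
        by (simp add: k_def left_diff_distrib)
    qed
    then have "l2_norm D (\<lambda>x. (F (z + w) u x - F z u x) / w - (1 / z\<^sup>2) * u x) = cmod k * l2_norm D u"
      using L2.nrm_scale[OF u, of k] by simp
    also have "\<dots> \<le> e * l2_norm D u"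
      using d(2)[of w] w by (intro mult_right_mono) (auto simp: k_def)
    finally show ?thesis .
  qed
  with d(1) show "\<exists>\<delta>>0. \<forall>w. 0 < cmod w \<and> cmod w < \<delta> \<longrightarrow> (\<forall>u\<in>L2 D.
      l2_norm D (\<lambda>x. (F (z + w) u x - F z u x) / w - (1 / z\<^sup>2) * u x) \<le> e * l2_norm D u)" by blast
qed

lemma has_op_derivative_unique:
  assumes A: "has_op_derivative D (L2 D) F A z" and B: "has_op_derivative D (L2 D) F B z" and u: "u \<in> L2 D"
  shows "l2_norm D (A u - B u) = 0"
proof -
  have L: "A u \<in> L2 D" "B u \<in> L2 D"
    using A B u by (auto simp: has_op_derivative_def bounded_op_def)
  have "l2_norm D (A u - B u) \<le> 0 + e" if "e > 0" for e
  proof -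
    have cancel: "e / 2 / k * k = e / 2" if "k \<noteq> 0" for k :: real using that by simp
    define e' where "e' = e / 2 / (l2_norm D u + 1)"
    have pos: "l2_norm D u + 1 > 0" by (simp add: add_nonneg_pos)
    have e': "e' > 0" using that pos by (simp add: e'_def)
    from A[unfolded has_op_derivative_def, THEN conjunct2, rule_format, OF e'] obtain d1 where d1: "d1 > 0"
      "\<And>w. 0 < cmod w \<Longrightarrow> cmod w < d1 \<Longrightarrow> l2_norm D (\<lambda>x. (F (z + w) u x - F z u x) / w - A u x) \<le> e' * l2_norm D u"
      using u by blast
    from B[unfolded has_op_derivative_def, THEN conjunct2, rule_format, OF e'] obtain d2 where d2: "d2 > 0"
      "\<And>w. 0 < cmod w \<Longrightarrow> cmod w < d2 \<Longrightarrow> l2_norm D (\<lambda>x. (F (z + w) u x - F z u x) / w - B u x) \<le> e' * l2_norm D u"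
      using u by blast
    define w :: complex where "w = of_real (min d1 d2 / 2)"
    have w: "0 < cmod w" "cmod w < d1" "cmod w < d2" using d1(1) d2(1) by (auto simp: w_def)
    define q where "q = (\<lambda>x. (1 / w) * (F (z + w) u - F z u) x)"
    have q: "q \<in> L2 D" unfolding q_def
      by (rule L2.V_closed(4)[OF L2.V_closed(3)[OF T.shift_closed[OF u] T.shift_closed[OF u]]])
    have "l2_norm D (q - A u) \<le> e' * l2_norm D u" "l2_norm D (q - B u) \<le> e' * l2_norm D u"
      using d1(2)[OF w(1,2)] d2(2)[OF w(1,3)] by (simp_all add: q_def fun_diff_def)
    then have "l2_norm D (A u - B u) \<le> 2 * (e' * l2_norm D u)"
      using L2.nrm_triangle_le[of "A u" q "B u"] L2.nrm_minus_commute[of q "A u"] L q by simp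
    also have "\<dots> \<le> 2 * (e' * (l2_norm D u + 1))" using e' by (intro mult_left_mono) auto
    also have "e' * (l2_norm D u + 1) = e / 2"
      unfolding e'_def by (rule cancel) (use pos in simp)
    finally show ?thesis by linarith
  qed
  then have "l2_norm D (A u - B u) \<le> 0" by (rule field_le_epsilon)
  then show ?thesis using l2_norm_nonneg[of "A u - B u"] by simp
qed

text \<open>The derivative is selected by choice among operators that differ by null functions.\<close>

lemma op_deriv_F:
  assumes "z \<noteq> 0" "u \<in> L2 D"
  shows "AE x in M. op_deriv D (L2 D) 1 F z u x = (1 / z\<^sup>2) * u x"
proof -
  have A: "has_op_derivative D (L2 D) F (op_deriv D (L2 D) 1 F z) z"
    using someI[of "\<lambda>A. has_op_derivative D (L2 D) F A z", OF has_op_derivative_F[OF assms(1)]] by simp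
  then have "op_deriv D (L2 D) 1 F z u \<in> L2 D"
    using assms(2) by (simp add: has_op_derivative_def bounded_op_def)
  from l2_eq_nrm[OF this L2_cmul[OF assms(2)]]
  have "l2_eq D (op_deriv D (L2 D) 1 F z u) (\<lambda>x. (1 / z\<^sup>2) * u x)"
    using has_op_derivative_unique[OF A has_op_derivative_F[OF assms(1)] assms(2)] by blast
  then show ?thesis by (simp add: l2_eq_def)
qed

text \<open>As \<open>F'(z) = z\<^sup>-\<^sup>2\<close>, a Jordan chain of length two is a chain of generalised eigenvectors of the
  symmetric operator \<open>T\<close>.\<close>

lemma jordan_chain_length:
  assumes z: "z \<noteq> 0" and u: "u0 \<in> eigenvectors D (L2 D) F z"
  shows "{k. \<exists>u. u 0 = u0 \<and> jordan_chain D (L2 D) F z k u} = {1}"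
proof (intro equalityI subsetI)
  have u0: "u0 \<in> L2 D" "l2_norm D u0 \<noteq> 0" "l2_norm D (F z u0) = 0"
    using u l2_norm_eq_0_iff by (auto simp: eigenvectors_def l2_eq_def)
  fix k assume "k \<in> {k. \<exists>u. u 0 = u0 \<and> jordan_chain D (L2 D) F z k u}"
  then obtain u where u: "u 0 = u0" "jordan_chain D (L2 D) F z k u" by blast
  have "k \<le> 1"
  proof (rule ccontr)
    assume "\<not> k \<le> 1"
    then have k: "1 < k" by simp
    have L: "u 1 \<in> L2 D" "u0 \<in> L2 D" using u k u0 by (auto simp: jordan_chain_def)
    have "l2_eq D (\<lambda>x. \<Sum>j\<le>1. 1 / fact j * op_deriv D (L2 D) j F z (u (1 - j)) x) (\<lambda>_. 0)"
      using u(2) k unfolding jordan_chain_def by blast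
    then have "AE x in M. F z (u 1) x + op_deriv D (L2 D) 1 F z u0 x = 0"
      by (simp add: l2_eq_def u(1))
    moreover have "AE x in M. op_deriv D (L2 D) 1 F z u0 x = (1 / z\<^sup>2) * u0 x"
      by (rule op_deriv_F[OF z L(2)])
    ultimately have "AE x in M. (F z (u 1) - (\<lambda>x. (- (1 / z\<^sup>2)) * u0 x)) x = 0"
      by eventually_elim simp
    moreover have "F z (u 1) - (\<lambda>x. (- (1 / z\<^sup>2)) * u0 x) \<in> L2 D"
      by (intro L2.V_closed L T.shift_closed)
    ultimately have "L2.nrm (F z (u 1) - (\<lambda>x. (- (1 / z\<^sup>2)) * u0 x)) = 0"
      using l2_norm_eq_0_iff by simp
    then have "- (1 / z\<^sup>2) = 0"
      by (rule T.no_generalized_eigenvectors[rotated 3]) (use u0 L in auto)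
    with z show False by simp
  qed
  moreover have "k \<ge> 1" using u(2) by (simp add: jordan_chain_def)
  ultimately show "k \<in> {1}" by simp
next
  fix k :: nat assume "k \<in> {1}"
  then have "jordan_chain D (L2 D) F z k (\<lambda>_. u0)"
    using u by (simp add: jordan_chain_def eigenvectors_def)
  then show "k \<in> {k. \<exists>u. u 0 = u0 \<and> jordan_chain D (L2 D) F z k u}" by auto
qed

lemma max_rank_eq_1:
  assumes "z \<noteq> 0" "eigenvectors D (L2 D) F z \<noteq> {}"
  shows "max_rank D (L2 D) F z = 1"
proof -
  have "eigenvector_rank D (L2 D) F z u0 = 1" if "u0 \<in> eigenvectors D (L2 D) F z" for u0
    unfolding eigenvector_rank_def jordan_chain_length[OF assms(1) that] by simp
  then have "eigenvector_rank D (L2 D) F z ` eigenvectors D (L2 D) F z = {1}" using assms(2) by auto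
  then show ?thesis by (simp add: max_rank_def)
qed

end


section \<open>Finite element spaces\<close>

context bounded_domain
begin

lemma H10_galerkin: "galerkin D (H10 D)"
  by unfold_locales (auto intro: H10_subspace H10_cnj H10_energy_complete)

lemma fem_space_subspace: "L2.subspace (fem_space D \<T>)"
proof -
  have comb: "(\<lambda>x. a * u x + v x) \<in> fem_space D \<T>" if u: "u \<in> fem_space D \<T>" and v: "v \<in> fem_space D \<T>" for a u v
    unfolding fem_space_def
  proof (intro CollectI conjI ballI)
    show "(\<lambda>x. a * u x + v x) \<in> H10 D" using u v by (intro H10_combination) (auto simp: fem_space_def)
    show "continuous_on (closure D) (\<lambda>x. a * u x + v x)"
      using u v by (auto simp: fem_space_def intro!: continuous_intros)
    show "a * u x + v x = 0" if "x \<in> frontier D" for x using u v that by (simp add: fem_space_def)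
    fix K assume "K \<in> \<T>"
    then have "\<exists>l c. linear l \<and> (\<forall>x\<in>K. u x = l x + c)" "\<exists>l c. linear l \<and> (\<forall>x\<in>K. v x = l x + c)"
      using u v by (simp_all add: fem_space_def)
    then obtain l c l' c' where l: "linear l" "\<forall>x\<in>K. u x = l x + c"
      and l': "linear l'" "\<forall>x\<in>K. v x = l' x + c'"
      by blast
    have "linear (\<lambda>x. a * l x + l' x)"
      using l(1) l'(1) by (auto simp: linear_iff algebra_simps)
    moreover have "\<forall>x\<in>K. a * u x + v x = (a * l x + l' x) + (a * c + c')"
      using l(2) l'(2) by (simp add: algebra_simps)
    ultimately show "\<exists>l c. linear l \<and> (\<forall>x\<in>K. a * u x + v x = l x + c)" by blast
  qed
  have "linear (\<lambda>x :: real^2. 0 :: complex)" by (simp add: linear_iff)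
  then have zero: "(\<lambda>x. 0) \<in> fem_space D \<T>"
    unfolding fem_space_def by (auto simp: H10_zero intro!: exI[of _ "\<lambda>x. 0"])
  show ?thesis
    unfolding L2.subspace_def using zero comb[of _ _ 1] comb[OF _ zero]
    by (auto simp: plus_fun_def zero_fun_def)
qed

lemma fem_space_cnj:
  assumes v: "v \<in> fem_space D \<T>"
  shows "(\<lambda>x. cnj (v x)) \<in> fem_space D \<T>"
  unfolding fem_space_def
proof (intro CollectI conjI ballI)
  show "(\<lambda>x. cnj (v x)) \<in> H10 D" using v by (intro H10_cnj) (auto simp: fem_space_def)
  show "continuous_on (closure D) (\<lambda>x. cnj (v x))"
    using v by (auto simp: fem_space_def intro!: continuous_on_cnj)
  show "cnj (v x) = 0" if "x \<in> frontier D" for x using v that by (simp add: fem_space_def)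
  fix K assume "K \<in> \<T>"
  then obtain l c where l: "linear l" "\<And>x. x \<in> K \<Longrightarrow> v x = l x + c"
    using v unfolding fem_space_def by blast
  have "linear (\<lambda>x. cnj (l x))" using l(1) by (auto simp: linear_iff complex_cnj_scaleR)
  moreover have "\<forall>x\<in>K. cnj (v x) = cnj (l x) + cnj c" using l(2) by simp
  ultimately show "\<exists>l c. linear l \<and> (\<forall>x\<in>K. cnj (v x) = l x + c)" by blast
qed

text \<open>A finite element function is determined by its values at the finitely many vertices.\<close>

lemma fem_space_bounded_subconverges:
  fixes s :: "nat \<Rightarrow> real^2 \<Rightarrow> complex"
  assumes mesh: "triangular_mesh D \<T>"
    and s: "\<And>n. s n \<in> fem_space D \<T>" "\<And>n. E.nrm (s n) \<le> K"
  shows "\<exists>r y. strict_mono r \<and> y \<in> fem_space D \<T> \<and> E.converges (\<lambda>n. s (r n)) y"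
proof -
  have sub: "fem_space D \<T> \<subseteq> H1 D" by (auto simp: fem_space_def)
  have "\<forall>K\<in>\<T>. \<exists>C. finite C \<and> K = convex hull C"
  proof
    fix K assume "K \<in> \<T>"
    then have "2 simplex K" using mesh by (simp add: triangular_mesh_def)
    then obtain C where "\<not> affine_dependent C" "K = convex hull C" by (auto simp: simplex)
    then show "\<exists>C. finite C \<and> K = convex hull C" using aff_independent_finite by blast
  qed
  then obtain vert where vert: "\<And>K. K \<in> \<T> \<Longrightarrow> finite (vert K)" "\<And>K. K \<in> \<T> \<Longrightarrow> K = convex hull (vert K)"
    by metis
  define P where "P = (\<Union>K\<in>\<T>. vert K)"
  have "finite \<T>" using mesh by (simp add: triangular_mesh_def triangulation_def)
  then have P: "finite P" using vert by (simp add: P_def)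
  show ?thesis
  proof (rule E.bounded_sequence_subconverges[where P = P and N = "\<lambda>v p. v p", OF P fem_space_subspace sub])
    fix v assume v: "v \<in> fem_space D \<T>" and zero: "\<And>p. p \<in> P \<Longrightarrow> v p = 0"
    have "v x = 0" if x: "x \<in> D" for x
    proof -
      have "x \<in> \<Union>\<T>" using mesh x closure_subset by (auto simp: triangular_mesh_def)
      then obtain K where K: "K \<in> \<T>" "x \<in> K" by blast
      obtain l c where l: "linear l" "\<And>x. x \<in> K \<Longrightarrow> v x = l x + c"
        using v K(1) unfolding fem_space_def by blast
      have "vert K \<subseteq> {x. l x + c = 0}"
      proof
        fix p assume p: "p \<in> vert K"
        then have "p \<in> K" using vert(2)[OF K(1)] hull_inc by metis
        then show "p \<in> {x. l x + c = 0}" using zero[of p] l(2)[of p] K(1) p by (auto simp: P_def)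
      qed
      moreover have "convex {x. l x + c = 0}"
      proof (rule convexI)
        fix x y and a b :: real
        assume "x \<in> {x. l x + c = 0}" "y \<in> {x. l x + c = 0}" and ab: "a + b = 1"
        then have "l x = - c" "l y = - c" by (auto simp: eq_neg_iff_add_eq_0)
        then have "l (a *\<^sub>R x + b *\<^sub>R y) = - ((a + b) *\<^sub>R c)"
          using l(1) by (simp add: linear_add linear_cmul scaleR_left_distrib)
        then show "a *\<^sub>R x + b *\<^sub>R y \<in> {x. l x + c = 0}" using ab by simp
      qed
      ultimately have "K \<subseteq> {x. l x + c = 0}"
        using vert(2)[OF K(1)] hull_minimal by metis
      then show ?thesis using K l(2) by auto
    qed
    then have "AE x in M. v x = 0" by (intro AE_I2) simp
    with energy_null[OF subsetD[OF sub v]] show "E.nrm v = 0" by blast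
  qed (use s in auto)
qed

text \<open>Images of a bounded sequence in \<open>L\<^sup>2\<close> are bounded in energy, hence subconverge in the energy norm by finite
  dimension, and then in \<open>L\<^sup>2\<close> by the Poincare inequality. Completeness follows in the same way.\<close>

lemma fem_space_compact_galerkin:
  assumes mesh: "triangular_mesh D \<T>"
  shows "compact_galerkin D (fem_space D \<T>)"
proof -
  have sub: "fem_space D \<T> \<subseteq> H10 D" by (auto simp: fem_space_def)
  interpret galerkin D "fem_space D \<T>"
  proof
    fix s assume s: "\<And>n. s n \<in> fem_space D \<T>" and cauchy: "E.cauchy s"
    have sH: "s n \<in> H1 D" for n by (rule H10_H1[OF subsetD[OF sub s]])
    from E.cauchy_bounded[OF cauchy sH] obtain K where "\<And>n. E.nrm (s n) \<le> K" by blast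
    from fem_space_bounded_subconverges[where s = s, OF mesh s this]
    obtain r y where y: "strict_mono r" "y \<in> fem_space D \<T>" "E.converges (\<lambda>n. s (r n)) y"
      by (elim exE conjE)
    have "E.converges s y"
      by (rule E.cauchy_subseq_converges[OF cauchy sH H10_H1[OF subsetD[OF sub y(2)]] y(1,3)])
    with y(2) show "\<exists>u\<in>fem_space D \<T>. E.converges s u" by blast
  qed (use sub fem_space_subspace fem_space_cnj in auto)
  show ?thesis
  proof
    show "L2.compact_op T"
      unfolding L2.compact_op_def
    proof (intro allI impI)
      fix f :: "nat \<Rightarrow> real^2 \<Rightarrow> complex" assume f: "\<forall>n. f n \<in> L2 D \<and> L2.nrm (f n) \<le> 1"
      obtain B where B: "B > 0" "\<And>f. f \<in> L2 D \<Longrightarrow> E.nrm (T f) \<le> B * l2_norm D f"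
        using T_energy_bound by blast
      obtain C where C: "C > 0" "\<And>u. u \<in> H10 D \<Longrightarrow> l2_norm D u \<le> C * E.nrm u" using Poincare by blast
      have "E.nrm (T (f n)) \<le> B" for n
        using B(2)[of "f n"] f mult_left_mono[of "l2_norm D (f n)" 1 B] B(1) by (auto intro: order_trans)
      from fem_space_bounded_subconverges[where s = "\<lambda>n. T (f n)", OF mesh _ this]
      obtain r y where y: "strict_mono r" "y \<in> fem_space D \<T>" "E.converges (\<lambda>n. T (f (r n))) y"
        using f by auto
      have "L2.converges (\<lambda>n. T (f (r n))) y"
      proof (rule L2.converges_squeeze)
        show "L2.nrm (T (f (r n)) - y) \<le> C * E.nrm (T (f (r n)) - y)" for n
          using C(2)[of "T (f (r n)) - y"] L2.subspace_diff[OF fem_space_subspace T_in_W y(2)] f sub by auto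
        show "(\<lambda>n. C * E.nrm (T (f (r n)) - y)) \<longlonglongrightarrow> 0"
          using y(3) tendsto_mult_left[of "\<lambda>n. E.nrm (T (f (r n)) - y)" 0 sequentially C]
          by (simp add: E.converges_def)
      qed (use f y in auto)
      moreover have "y \<in> L2 D" by (rule H1_L2[OF H10_H1[OF subsetD[OF sub y(2)]]])
      ultimately show "\<exists>r y. strict_mono r \<and> y \<in> L2 D \<and> L2.converges (\<lambda>n. T (f (r n))) y"
        using y(1) by blast
    qed
  qed
qed

end


section \<open>Convergence of the eigenvalues\<close>

lemma (in compact_galerkin) eigenvector_if_no_bounded_inverse:
  assumes "\<mu> \<noteq> 0" "W \<subseteq> X" "X \<subseteq> L2 D" "L2.subspace X" "\<not> has_bounded_inverse D X (T.shift \<mu>)"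
  shows "\<exists>v\<in>L2 D. l2_norm D v = 1 \<and> l2_norm D (T.shift \<mu> v) = 0"
proof -
  have "\<exists>v\<in>L2 D. l2_norm D (T.shift \<mu> v) < c * l2_norm D v" if "c > 0" for c
    using has_bounded_inverse_if_bounded_below[OF assms(2,3,4,1) that] assms(5) by force
  then show ?thesis using T.eigenvector_if_not_bounded_below[OF assms(1)] by simp
qed

theorem theorem3p4:
  fixes D :: "(real^2) set" and H :: "real set" and mesh :: "real \<Rightarrow> (real^2) set set"
    and \<beta> :: real and \<Omega> :: "complex set" and lam0 :: complex
  assumes "lipschitz_domain D"
    and "H \<subseteq> {0<..}" and "0 islimpt H"
    and "regular_mesh_family D H mesh"
    and "\<beta> > 1 / 2" and "convex D \<longrightarrow> \<beta> = 1"
    and "error_estimate D H mesh \<beta>"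
    and "compact \<Omega>" and "0 \<notin> \<Omega>"
    and "op_resolvent_set D (L2 D) \<Omega> (F_cont D) \<noteq> {}"
    and "lam0 \<in> spectrum_cont D \<Omega>"
  shows "(lam0 \<in> interior \<Omega> \<longrightarrow>
           (\<exists>lam. (\<forall>\<^sub>F h in at 0 within H. lam h \<in> spectrum_disc D (mesh h) \<Omega>) \<and>
                (lam \<longlongrightarrow> lam0) (at 0 within H)))
       \<and> (\<forall>lam. (\<forall>\<^sub>F h in at 0 within H. lam h \<in> spectrum_disc D (mesh h) \<Omega>) \<and>
                (lam \<longlongrightarrow> lam0) (at 0 within H) \<longrightarrow>
            (\<exists>C>0. \<forall>\<^sub>F h in at 0 within H.
               cmod (lam h - lam0)
                 \<le> C * h powr (2 * \<beta> / real (max_rank D (L2 D) (F_cont D) lam0))))"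
proof -
  interpret bounded_domain D
    using assms(1) by unfold_locales (auto simp: lipschitz_domain_def)
  interpret galerkin D "H10 D" by (rule H10_galerkin)
  have H10_L2: "H10 D \<subseteq> L2 D" by (auto intro: H1_L2 H10_H1)
  let ?W = "\<lambda>h. fem_space D (mesh h)"
  have disc: "compact_galerkin D (?W h)" if "h \<in> H" for h
    using assms(4) that by (intro fem_space_compact_galerkin) (simp add: regular_mesh_family_def)
  have W_L2: "?W h \<subseteq> L2 D" for h by (auto simp: fem_space_def)
  obtain C where C: "C > 0" and err: "\<And>h f. h \<in> H \<Longrightarrow> f \<in> L2 D \<Longrightarrow>
      l2_norm D (T f - solution_op D (?W h) f) \<le> C * h powr (2 * \<beta>) * l2_norm D f"
    using assms(7) unfolding error_estimate_def fun_diff_def by blast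
  define \<epsilon> where "\<epsilon> h = C * h powr (2 * \<beta>)" for h
  let ?A = "at 0 within H"
  have nontriv: "?A \<noteq> bot" using assms(3) by (simp add: trivial_limit_within)
  have inH: "\<forall>\<^sub>F h in ?A. h \<in> H" by (simp add: eventually_at_filter)
  have eps0: "(\<epsilon> \<longlongrightarrow> 0) ?A"
  proof -
    have "\<forall>\<^sub>F h in ?A. 0 \<le> h" using inH by eventually_elim (use assms(2) in auto)
    then have "((\<lambda>h. h powr (2 * \<beta>)) \<longlongrightarrow> 0) ?A"
      using assms(5) by (intro tendsto_zero_powrI[where b = "2 * \<beta>"] tendsto_intros) auto
    from tendsto_mult_left[OF this, of C] show ?thesis by (simp add: \<epsilon>_def[abs_def])
  qed
  have eps_ge0: "0 \<le> \<epsilon> h" for h using C by (simp add: \<epsilon>_def)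

  \<comment> \<open>\<open>T\<close> is the limit in norm of the discrete solution operators.\<close>
  have "L2.compact_op T"
  proof (rule L2.compact_op_limit)
    fix e :: real assume e: "e > 0"
    have "\<forall>\<^sub>F h in ?A. h \<in> H \<and> \<epsilon> h < e" using inH order_tendstoD(2)[OF eps0 e] by eventually_elim simp
    then obtain h where h: "h \<in> H" "\<epsilon> h < e" using eventually_happens'[OF nontriv] by blast
    interpret h: compact_galerkin D "?W h" by (rule disc[OF h(1)])
    have "h.T f \<in> L2 D \<and> L2.nrm (T f - h.T f) \<le> e * L2.nrm f" if f: "f \<in> L2 D" for f
      using err[OF h(1) f] mult_right_mono[of "\<epsilon> h" e "l2_norm D f"] h(2) f by (simp add: \<epsilon>_def)
    then show "\<exists>B. L2.compact_op B \<and> (\<forall>f\<in>L2 D. B f \<in> L2 D \<and> L2.nrm (T f - B f) \<le> e * L2.nrm f)"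
      using h.T_compact by blast
  qed simp
  then interpret compact_galerkin D "H10 D" by unfold_locales

  have lam0: "lam0 \<in> \<Omega>" "lam0 \<noteq> 0"
    using assms(9,11) by (auto simp: spectrum_cont_def op_spectrum_def)
  have F_cont_eq: "F_cont D = F" by (rule ext)+ (simp add: F_cont_def shift_apply)
  define \<mu> where "\<mu> = 1 / lam0"
  have mu: "\<mu> \<noteq> 0" using lam0 by (simp add: \<mu>_def)
  have "\<not> has_bounded_inverse D (L2 D) (T.shift \<mu>)"
    using assms(11) lam0(1)
    by (simp add: spectrum_cont_def op_spectrum_def op_resolvent_set_def F_cont_eq \<mu>_def)
  then obtain v0 where v0: "v0 \<in> L2 D" "l2_norm D v0 = 1" "l2_norm D (T.shift \<mu> v0) = 0"
    using eigenvector_if_no_bounded_inverse[OF mu H10_L2 order_refl L2.V_subspace] by blast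
  have mu_real: "cnj \<mu> = \<mu>" using T.eigenvalue_real[of v0 \<mu>] v0 by simp
  define m where "m = Re \<mu>"
  have mu_m: "\<mu> = of_real m" using mu_real by (simp add: m_def complex_eq_iff)
  then have m0: "m \<noteq> 0" using mu by auto
  have "v0 \<in> eigenvectors D (L2 D) F lam0"
    using v0 l2_norm_eq_0_iff[OF v0(1)] l2_norm_eq_0_iff[OF T.shift_closed[OF v0(1)], of \<mu>]
    by (auto simp: eigenvectors_def l2_eq_def \<mu>_def)
  then have rank: "max_rank D (L2 D) (F_cont D) lam0 = 1"
    using max_rank_eq_1[OF lam0(2)] by (auto simp: F_cont_eq)

  \<comment> \<open>The eigenvector \<open>v0\<close> of \<open>T\<close> is an approximate eigenvector of the discrete operator, with defect \<open>\<epsilon> h\<close>.\<close>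
  have disc_eigenvalue: "\<exists>\<nu>. \<nu> \<noteq> 0 \<and> \<bar>\<nu> - m\<bar> \<le> \<epsilon> h
      \<and> \<not> has_bounded_inverse D (?W h) (F_disc D (mesh h) (1 / of_real \<nu>))"
    if h: "h \<in> H" "\<epsilon> h < \<bar>m\<bar>" for h
  proof -
    interpret h: compact_galerkin D "?W h" by (rule disc[OF h(1)])
    have "l2_norm D (h.T.shift (of_real m) v0) \<le> \<epsilon> h * l2_norm D v0"
    proof -
      have "T.shift \<mu> v0 - (T v0 - h.T v0) = h.T.shift (of_real m) v0"
        by (simp add: T.shift_def h.T.shift_def mu_m)
      then have "l2_norm D (h.T.shift (of_real m) v0) \<le> l2_norm D (T.shift \<mu> v0) + l2_norm D (T v0 - h.T v0)"
        using L2.nrm_triangle_diff[of "T.shift \<mu> v0" "T v0 - h.T v0"] v0(1) by simp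
      then show ?thesis using err[OF h(1) v0(1)] v0 by (simp add: \<epsilon>_def)
    qed
    then obtain \<nu> v where nu: "\<bar>\<nu> - m\<bar> \<le> \<epsilon> h"
      and v: "v \<in> L2 D" "l2_norm D v \<noteq> 0" "l2_norm D (h.T.shift (of_real \<nu>) v) = 0"
      using h.T.eigenvalue_near_approximate_eigenvalue[of v0 m "\<epsilon> h"] v0 h(2) by auto
    have "\<nu> \<noteq> 0" using nu h(2) by auto
    moreover have "F_disc D (mesh h) (1 / of_real \<nu>) = h.T.shift (of_real \<nu>)"
      by (rule ext) (simp add: F_disc_def h.shift_apply)
    ultimately show ?thesis
      using h.no_bounded_inverse_at_eigenvalue[OF order_refl W_L2 h.W_subspace _ v] nu by auto
  qed

  obtain \<delta> where \<delta>: "\<delta> > 0"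
    "\<And>\<nu> v. cmod (\<nu> - \<mu>) < \<delta> \<Longrightarrow> v \<in> L2 D \<Longrightarrow> cmod (\<nu> - \<mu>) / 2 * l2_norm D v \<le> l2_norm D (T.shift \<nu> v)"
    using T.shift_lower_bound_near_eigenvalue[OF mu mu_real] unfolding nrm_eq by blast
  \<comment> \<open>Conversely, a discrete eigenvector at \<open>1 / z\<close> is an approximate eigenvector of \<open>T\<close>, with defect \<open>\<epsilon> h\<close>.\<close>
  have disc_close: "cmod (1 / z - \<mu>) \<le> 2 * \<epsilon> h"
    if h: "h \<in> H" and z: "z \<in> spectrum_disc D (mesh h) \<Omega>" "cmod (1 / z - \<mu>) < \<delta>" for h z
  proof -
    interpret h: compact_galerkin D "?W h" by (rule disc[OF h])
    have z0: "z \<noteq> 0" using z(1) assms(9) by (auto simp: spectrum_disc_def op_spectrum_def)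
    have "F_disc D (mesh h) z = h.T.shift (1 / z)"
      by (rule ext) (simp add: F_disc_def h.shift_apply)
    then have "\<not> has_bounded_inverse D (?W h) (h.T.shift (1 / z))"
      using z(1) by (auto simp: spectrum_disc_def op_spectrum_def op_resolvent_set_def)
    moreover have "1 / z \<noteq> 0" using z0 by simp
    ultimately obtain v where v: "v \<in> L2 D" "l2_norm D v = 1" "l2_norm D (h.T.shift (1 / z) v) = 0"
      using h.eigenvector_if_no_bounded_inverse[OF _ order_refl W_L2 h.W_subspace] by blast
    have "T.shift (1 / z) v = h.T.shift (1 / z) v + (T v - h.T v)"
      by (simp add: T.shift_def h.T.shift_def)
    then have "l2_norm D (T.shift (1 / z) v) \<le> l2_norm D (h.T.shift (1 / z) v) + l2_norm D (T v - h.T v)"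
      using L2.nrm_triangle[of "h.T.shift (1 / z) v" "T v - h.T v"] v(1) by simp
    also have "\<dots> \<le> \<epsilon> h" using v err[OF h v(1)] by (simp add: \<epsilon>_def)
    finally show ?thesis using \<delta>(2)[OF z(2) v(1)] v(2) by simp
  qed

  show ?thesis
  proof (intro conjI impI allI)
    assume int: "lam0 \<in> interior \<Omega>"
    obtain \<nu> where nu: "\<And>h. h \<in> H \<Longrightarrow> \<epsilon> h < \<bar>m\<bar> \<Longrightarrow> \<nu> h \<noteq> 0 \<and> \<bar>\<nu> h - m\<bar> \<le> \<epsilon> h
      \<and> \<not> has_bounded_inverse D (?W h) (F_disc D (mesh h) (1 / of_real (\<nu> h)))"
      using disc_eigenvalue by metis
    have good: "\<forall>\<^sub>F h in ?A. h \<in> H \<and> \<epsilon> h < \<bar>m\<bar>"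
      using inH order_tendstoD(2)[OF eps0, of "\<bar>m\<bar>"] m0 by (auto elim: eventually_elim2)
    define lam where "lam h = 1 / complex_of_real (\<nu> h)" for h
    have "(\<nu> \<longlongrightarrow> m) ?A"
    proof (rule LIM_zero_cancel, rule Lim_null_comparison[OF _ eps0])
      show "\<forall>\<^sub>F h in ?A. norm (\<nu> h - m) \<le> \<epsilon> h" using good by eventually_elim (use nu in auto)
    qed
    then have "(lam \<longlongrightarrow> 1 / of_real m) ?A"
      unfolding lam_def using m0 by (intro tendsto_intros) auto
    moreover have "1 / of_real m = lam0" using lam0(2) by (simp add: \<mu>_def flip: mu_m)
    ultimately have lim: "(lam \<longlongrightarrow> lam0) ?A" by simp
    have "\<forall>\<^sub>F h in ?A. lam h \<in> interior \<Omega>"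
      by (rule topological_tendstoD[OF lim open_interior int])
    with good have "\<forall>\<^sub>F h in ?A. lam h \<in> spectrum_disc D (mesh h) \<Omega>"
    proof eventually_elim
      case (elim h)
      then have "lam h \<in> \<Omega>" using interior_subset by blast
      then show ?case
        using nu[of h] elim by (simp add: lam_def spectrum_disc_def op_spectrum_def op_resolvent_set_def)
    qed
    with lim show "\<exists>lam. (\<forall>\<^sub>F h in ?A. lam h \<in> spectrum_disc D (mesh h) \<Omega>) \<and> (lam \<longlongrightarrow> lam0) ?A"
      by blast
  next
    fix lam assume "(\<forall>\<^sub>F h in ?A. lam h \<in> spectrum_disc D (mesh h) \<Omega>) \<and> (lam \<longlongrightarrow> lam0) ?A"
    then have spec: "\<forall>\<^sub>F h in ?A. lam h \<in> spectrum_disc D (mesh h) \<Omega>" and lim: "(lam \<longlongrightarrow> lam0) ?A"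
      by blast+
    have "((\<lambda>h. 1 / lam h - \<mu>) \<longlongrightarrow> 1 / lam0 - \<mu>) ?A"
      using lim lam0(2) by (intro tendsto_intros)
    then have "((\<lambda>h. cmod (1 / lam h - \<mu>)) \<longlongrightarrow> 0) ?A"
      using tendsto_norm by (fastforce simp: \<mu>_def)
    from order_tendstoD(2)[OF this \<delta>(1)] have near: "\<forall>\<^sub>F h in ?A. cmod (1 / lam h - \<mu>) < \<delta>" .
    have bdd: "\<forall>\<^sub>F h in ?A. cmod (lam h) < cmod lam0 + 1"
      using order_tendstoD(2)[OF tendsto_norm[OF lim], of "cmod lam0 + 1"] by simp
    \<comment> \<open>\<open>\<bar>lam h - lam0\<bar> = \<bar>lam h\<bar> \<bar>lam0\<bar> \<bar>1 / lam h - 1 / lam0\<bar>\<close>, where \<open>\<bar>lam h\<bar> < \<bar>lam0\<bar> + 1\<close> for small \<open>h\<close>.\<close>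
    define K where "K = 2 * C * (cmod lam0 + 1) * cmod lam0"
    have "K > 0" using C lam0(2) by (simp add: K_def add_nonneg_pos)
    moreover have "\<forall>\<^sub>F h in ?A. cmod (lam h - lam0) \<le> K * h powr (2 * \<beta>)"
      using spec near bdd inH
    proof eventually_elim
      case (elim h)
      have nz: "lam h \<noteq> 0" using elim(1) assms(9) by (auto simp: spectrum_disc_def op_spectrum_def)
      then have "lam h - lam0 = - (lam h * lam0 * (1 / lam h - \<mu>))"
        using lam0(2) by (simp add: \<mu>_def field_simps)
      then have "cmod (lam h - lam0) = cmod (lam h) * cmod lam0 * cmod (1 / lam h - \<mu>)"
        by (simp add: norm_mult)
      also have "\<dots> \<le> (cmod lam0 + 1) * cmod lam0 * (2 * \<epsilon> h)"
        using disc_close[OF elim(4) elim(1,2)] elim(3) by (intro mult_mono) auto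
      finally show ?case by (simp add: K_def \<epsilon>_def algebra_simps)
    qed
    ultimately show "\<exists>C>0. \<forall>\<^sub>F h in ?A. cmod (lam h - lam0)
        \<le> C * h powr (2 * \<beta> / real (max_rank D (L2 D) (F_cont D) lam0))"
      by (intro exI[of _ K]) (simp add: rank)
  qed
qed

end
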